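(* Let $\Omega=(a,b)$ be a bounded interval, let $\lambda>0$, and assume that $K:[0,\infty)\to[0,\infty)$ satisfies (K1), (K2) and (K3). Assume that $g\in L^\infty(a,b)$ is non-decreasing (resp. non-increasing). Let $M>0$ be such that $M\ge \operatorname{ess\,sup}_{(a,b)}g-\operatorname{ess\,inf}_{(a,b)}g$. Let $U\in BV(a,b)$ be a minimizer of $TV_{Kg}$ over $BV(a,b)$. Then $U$ must be a non-decreasing (resp. non-increasing) piecewise constant function (with finitely many jumps) satisfying $\operatorname{ess\,inf} g\le U\le \operatorname{ess\,sup} g$ on $(a,b)$. Moreover, the number $m$ of jumps of $U$ satisfies $$m\le\left[\frac{(b-a)\lambda}{2C_M}\right]+1,$$ where $C_M$ is the constant in (K2) and $[r]$ denotes the integer part of $r\ge0$.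
   Context: Conditions on $K$: (K1) $K$ is lower semicontinuous and non-decreasing with $K(0)=0$. (K2) For any $M>0$ there exists a constant $C_M>0$ such that $K(\rho_1)+K(\rho_2)\ge K(\rho_1+\rho_2)+C_M\rho_1\rho_2$ for all $\rho_1,\rho_2\ge0$ with $\rho_1+\rho_2\le M$. (K3) $\lim_{\rho\to0}K(\rho)/\rho=1$. For $u\in BV(\Omega)$, $\Omega=(a,b)$, with distributional derivative $Du$, jump set $J_u$ and one-sided limits $u^\pm$ at points of $J_u$, set $$TV_K(u)=\int_{\Omega\setminus J_u}|Du|+\sum_{x\in J_u}K(|u^+(x)-u^-(x)|),\qquad TV_{Kg}(u)=TV_K(u)+\frac{\lambda}{2}\int_\Omega|u-g|^2\,dx.$$ Functions are identified when equal almost everywhere; monotonicity and pointwise properties refer to suitable representatives. *)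

theory Defs
  imports "HOL-Analysis.Analysis" "HOL-Probability.Essential_Supremum"
begin

section \<open>The jump cost\<close>

definition lower_semicontinuous_on :: "real set \<Rightarrow> (real \<Rightarrow> real) \<Rightarrow> bool" where
  "lower_semicontinuous_on S f \<longleftrightarrow>
     (\<forall>x\<in>S. \<forall>c<f x. eventually (\<lambda>y. c < f y) (at x within S))"

text \<open>A cost \<open>K : [0,\<infinity>) \<rightarrow> [0,\<infinity>)\<close> is a total function whose values at negative arguments
  are never used.\<close>

definition K1 :: "(real \<Rightarrow> real) \<Rightarrow> bool" where
  "K1 K \<longleftrightarrow> lower_semicontinuous_on {0..} K \<and> mono_on {0..} K \<and> K 0 = 0"

definition K2_const :: "(real \<Rightarrow> real) \<Rightarrow> real \<Rightarrow> real \<Rightarrow> bool" where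
  "K2_const K M C \<longleftrightarrow> C > 0 \<and>
     (\<forall>r s. 0 \<le> r \<longrightarrow> 0 \<le> s \<longrightarrow> r + s \<le> M \<longrightarrow> K r + K s \<ge> K (r + s) + C * r * s)"

definition K2 :: "(real \<Rightarrow> real) \<Rightarrow> bool" where
  "K2 K \<longleftrightarrow> (\<forall>M>0. \<exists>C. K2_const K M C)"

definition K3 :: "(real \<Rightarrow> real) \<Rightarrow> bool" where
  "K3 K \<longleftrightarrow> ((\<lambda>r. K r / r) \<longlongrightarrow> 1) (at_right 0)"


section \<open>Functions on an interval up to null sets\<close>

definition ae_eq :: "real \<Rightarrow> real \<Rightarrow> (real \<Rightarrow> real) \<Rightarrow> (real \<Rightarrow> real) \<Rightarrow> bool" where
  "ae_eq a b u v \<longleftrightarrow> (AE x in lebesgue_on {a<..<b}. u x = v x)"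

definition Linfty :: "real \<Rightarrow> real \<Rightarrow> (real \<Rightarrow> real) set" where
  "Linfty a b = {g. g \<in> borel_measurable (lebesgue_on {a<..<b}) \<and>
     (\<exists>B. AE x in lebesgue_on {a<..<b}. \<bar>g x\<bar> \<le> B)}"

definition ess_sup :: "real \<Rightarrow> real \<Rightarrow> (real \<Rightarrow> real) \<Rightarrow> ereal" where
  "ess_sup a b g = esssup (lebesgue_on {a<..<b}) (\<lambda>x. ereal (g x))"

definition ess_inf :: "real \<Rightarrow> real \<Rightarrow> (real \<Rightarrow> real) \<Rightarrow> ereal" where
  "ess_inf a b g = - esssup (lebesgue_on {a<..<b}) (\<lambda>x. - ereal (g x))"

definition nondecreasing_ae :: "real \<Rightarrow> real \<Rightarrow> (real \<Rightarrow> real) \<Rightarrow> bool" where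
  "nondecreasing_ae a b g \<longleftrightarrow> (\<exists>h. ae_eq a b h g \<and> mono_on {a<..<b} h)"

definition nonincreasing_ae :: "real \<Rightarrow> real \<Rightarrow> (real \<Rightarrow> real) \<Rightarrow> bool" where
  "nonincreasing_ae a b g \<longleftrightarrow> (\<exists>h. ae_eq a b h g \<and> antimono_on {a<..<b} h)"

definition piecewise_constant :: "real \<Rightarrow> real \<Rightarrow> (real \<Rightarrow> real) \<Rightarrow> bool" where
  "piecewise_constant a b v \<longleftrightarrow>
     (\<exists>S. finite S \<and> (\<forall>I \<in> components ({a<..<b} - S). v constant_on I))"


section \<open>Functions of bounded variation on an interval\<close>

definition test_function :: "real \<Rightarrow> real \<Rightarrow> (real \<Rightarrow> real) \<Rightarrow> bool" where
  "test_function a b \<phi> \<longleftrightarrow>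
     (\<forall>n. (deriv ^^ n) \<phi> differentiable_on UNIV) \<and>
     (\<exists>S. compact S \<and> S \<subseteq> {a<..<b} \<and> (\<forall>x. x \<notin> S \<longrightarrow> \<phi> x = 0))"

text \<open>A finite signed Borel measure on \<open>(a,b)\<close> is represented by its set function \<open>\<nu>\<close>, the
  difference of two finite positive measures; neither \<open>\<nu>\<close> nor integration against it depends
  on the decomposition. Since \<^const>\<open>measure\<close> vanishes on non-measurable sets, \<open>\<nu>\<close> is
  determined on all of \<^typ>\<open>real set\<close>.\<close>

definition has_distr_deriv :: "real \<Rightarrow> real \<Rightarrow> (real \<Rightarrow> real) \<Rightarrow> (real set \<Rightarrow> real) \<Rightarrow> bool" where
  "has_distr_deriv a b u \<nu> \<longleftrightarrow>
     (\<exists>P N. finite_measure P \<and> finite_measure N \<and>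
        sets P = sets (restrict_space borel {a<..<b}) \<and>
        sets N = sets (restrict_space borel {a<..<b}) \<and>
        \<nu> = (\<lambda>E. measure P E - measure N E) \<and>
        (\<forall>\<phi>. test_function a b \<phi> \<longrightarrow>
           (LINT x|lebesgue_on {a<..<b}. u x * deriv \<phi> x)
             = - ((LINT x|P. \<phi> x) - (LINT x|N. \<phi> x))))"

definition BV :: "real \<Rightarrow> real \<Rightarrow> (real \<Rightarrow> real) set" where
  "BV a b = {u. integrable (lebesgue_on {a<..<b}) u \<and> (\<exists>\<nu>. has_distr_deriv a b u \<nu>)}"

definition distr_deriv :: "real \<Rightarrow> real \<Rightarrow> (real \<Rightarrow> real) \<Rightarrow> real set \<Rightarrow> real" where
  "distr_deriv a b u = (THE \<nu>. has_distr_deriv a b u \<nu>)"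

definition total_variation :: "(real set \<Rightarrow> real) \<Rightarrow> real set \<Rightarrow> ennreal" where
  "total_variation \<nu> B =
     (SUP E \<in> {E :: nat \<Rightarrow> real set. range E \<subseteq> sets borel \<and> disjoint_family E \<and> (\<Union>n. E n) = B}.
        \<Sum>n. ennreal \<bar>\<nu> (E n)\<bar>)"

text \<open>One-sided limits are taken along a suitable representative, so that they depend only on
  the almost-everywhere class of \<open>u\<close>.\<close>

definition has_left_lim :: "real \<Rightarrow> real \<Rightarrow> (real \<Rightarrow> real) \<Rightarrow> real \<Rightarrow> real \<Rightarrow> bool" where
  "has_left_lim a b u x l \<longleftrightarrow> (\<exists>v. ae_eq a b v u \<and> (v \<longlongrightarrow> l) (at_left x))"

definition has_right_lim :: "real \<Rightarrow> real \<Rightarrow> (real \<Rightarrow> real) \<Rightarrow> real \<Rightarrow> real \<Rightarrow> bool" where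
  "has_right_lim a b u x l \<longleftrightarrow> (\<exists>v. ae_eq a b v u \<and> (v \<longlongrightarrow> l) (at_right x))"

definition left_lim :: "real \<Rightarrow> real \<Rightarrow> (real \<Rightarrow> real) \<Rightarrow> real \<Rightarrow> real" where
  "left_lim a b u x = (THE l. has_left_lim a b u x l)"

definition right_lim :: "real \<Rightarrow> real \<Rightarrow> (real \<Rightarrow> real) \<Rightarrow> real \<Rightarrow> real" where
  "right_lim a b u x = (THE l. has_right_lim a b u x l)"

definition jump_set :: "real \<Rightarrow> real \<Rightarrow> (real \<Rightarrow> real) \<Rightarrow> real set" where
  "jump_set a b u =
     {x \<in> {a<..<b}. \<exists>l r. has_left_lim a b u x l \<and> has_right_lim a b u x r \<and> l \<noteq> r}"


section \<open>The functionals\<close>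

definition TV_K :: "(real \<Rightarrow> real) \<Rightarrow> real \<Rightarrow> real \<Rightarrow> (real \<Rightarrow> real) \<Rightarrow> ennreal" where
  "TV_K K a b u =
     total_variation (distr_deriv a b u) ({a<..<b} - jump_set a b u)
     + (\<Sum>\<^sub>\<infinity>x\<in>jump_set a b u. ennreal (K \<bar>right_lim a b u x - left_lim a b u x\<bar>))"

definition TV_Kg ::
  "(real \<Rightarrow> real) \<Rightarrow> real \<Rightarrow> (real \<Rightarrow> real) \<Rightarrow> real \<Rightarrow> real \<Rightarrow> (real \<Rightarrow> real) \<Rightarrow> ennreal" where
  "TV_Kg K lam g a b u =
     TV_K K a b u
     + ennreal (lam / 2) * (\<integral>\<^sup>+x. ennreal (\<bar>u x - g x\<bar>\<^sup>2) \<partial>lebesgue_on {a<..<b})"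

definition is_minimizer_on :: "('a \<Rightarrow> 'b::order) \<Rightarrow> 'a set \<Rightarrow> 'a \<Rightarrow> bool" where
  "is_minimizer_on F X U \<longleftrightarrow> U \<in> X \<and> (\<forall>v\<in>X. F U \<le> F v)"

end

theory Submission
  imports Defs "HOL-Probability.Distribution_Functions" "HOL-Probability.Giry_Monad"
begin

text \<open>
  A BV function is, almost everywhere, \<open>V x = c + \<nu> (a,x]\<close> for a finite signed measure \<open>\<nu>\<close>, and its energy
  \<open>TV\<^sub>K\<close> depends only on \<open>\<mu> = |\<nu>|\<close>: it is \<open>\<mu>\<close> of the non-atoms plus the sum of \<open>K (\<mu> {x})\<close>. Conversely every
  \<open>w\<close> with \<open>|w y - w x| \<le> \<mu> (x,y]\<close> is BV with at most that energy, which makes competitors easy to price.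

  Truncating a minimizer \<open>V\<close> at a level, on the whole interval or on one side of a point where \<open>V\<close> crosses
  that level downwards, does not raise the energy; comparing fidelities gives the bounds and, for
  monotone \<open>g\<close>, the monotonicity of \<open>V\<close>. For a non-decreasing \<open>V\<close> and \<open>s < t\<close> one then concentrates the
  increase of \<open>V\<close> on \<open>(s,t]\<close> in a single jump, at the point where \<open>g\<close> crosses \<open>(V s + V t) / 2\<close>. With
  \<open>Q = sup (V - V s) (V t - V)\<close> over \<open>[s,t]\<close>, the fidelity grows by at most \<open>(\<lambda>/2) (t - s) Q\<close>, while (K2) shows that
  the energy drops by at least \<open>C Q\<close>. Hence \<open>Q = 0\<close> as soon as \<open>t - s < 2 C / \<lambda>\<close>: on short intervals \<open>V\<close> takes
  only two values, so jumps are at least \<open>2 C / \<lambda>\<close> apart and \<open>V\<close> is constant between them.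
\<close>

section \<open>Smooth bumps and the du Bois-Reymond lemma\<close>

text \<open>Two one-sided estimates replace computations with distributional derivatives: the energy
  of \<open>U\<close> is bounded below through the variation measure of its primitive, that of a
  competitor above through any measure dominating its increments. The first rests on the structure
  of BV functions on an interval, hence on du Bois-Reymond, hence on a supply of functions with
  derivatives of all orders. The second is a Jordan decomposition.

  (K2) acts twice. As plain subadditivity, combined with (K3), it yields \<open>K r \<le> r\<close>,
  so diffuse variation can be merged into an atom at no extra cost. Its quadratic surplus, applied
  to the increments \<open>V x - V s\<close> and \<open>V t - V x\<close>, is the very product that
  the estimate of the fidelity produces; both sides are then multiples of the same quantity, and
  \<open>2 * C / lam\<close> is the length at which the factors \<open>C\<close> and
  \<open>lam / 2 * (t - s)\<close> balance. As \<open>V\<close> is merely right-continuous, the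
  supremum of the product may not be attained; so the drop of energy is shown for each splitting
  point and the supremum is taken afterwards.\<close>

definition flat :: "real poly \<Rightarrow> real \<Rightarrow> real" where
  "flat p x = (if x > 0 then poly p (1 / x) * exp (- (1 / x)) else 0)"

lemma poly_div_exp_tendsto_0: "((\<lambda>y::real. poly p y * exp (- y)) \<longlongrightarrow> 0) at_top"
proof -
  have "((\<lambda>y. \<Sum>i\<le>degree p. coeff p i * (y ^ i / exp y)) \<longlongrightarrow> (\<Sum>i\<le>degree p. coeff p i * 0)) at_top"
    by (intro tendsto_intros tendsto_power_div_exp_0)
  then show ?thesis
    by (simp add: poly_altdef exp_minus sum_divide_distrib field_simps)
qed

lemma flat_tendsto_0: "(flat p \<longlongrightarrow> 0) (at_right 0)"
proof -
  have "((\<lambda>x. poly p (inverse x) * exp (- (inverse x))) \<longlongrightarrow> 0) (at_right 0)"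
    by (rule filterlim_compose[OF poly_div_exp_tendsto_0 filterlim_inverse_at_top_right])
  moreover have "\<forall>\<^sub>F x in at_right 0. poly p (inverse x) * exp (- (inverse x)) = flat p x"
    by (auto simp: flat_def eventually_at_filter inverse_eq_divide)
  ultimately show ?thesis
    by (rule Lim_transform_eventually)
qed

text \<open>In the variable \<open>y = 1 / x\<close> the chain rule sends \<open>p\<close> to
  \<open>y^2 * (p - pderiv p)\<close>. The family is thus closed under differentiation, which makes
  derivatives of every order available at once.\<close>

lemma has_real_derivative_flat:
  "(flat p has_real_derivative flat (monom 1 2 * (p - pderiv p)) x) (at x)"
proof -
  consider "x > 0" | "x < 0" | "x = 0" by linarith
  then show ?thesis
  proof cases
    case 1
    have "((\<lambda>x. poly p (1 / x) * exp (- (1 / x))) has_real_derivative flat (monom 1 2 * (p - pderiv p)) x) (at x)"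
      using 1 by (auto intro!: derivative_eq_intros DERIV_chain2[OF poly_DERIV]
          simp: flat_def poly_monom field_simps power2_eq_square)
    then show ?thesis
      by (rule has_field_derivative_transform_within_open[where S="{0<..}"]) (use 1 in \<open>auto simp: flat_def\<close>)
  next
    case 2
    have "((\<lambda>x. 0) has_real_derivative flat (monom 1 2 * (p - pderiv p)) x) (at x)"
      using 2 by (auto simp: flat_def)
    then show ?thesis
      by (rule has_field_derivative_transform_within_open[where S="{..<0}"]) (use 2 in \<open>auto simp: flat_def\<close>)
  next
    case 3
    \<comment> \<open>Dividing by \<open>h\<close> multiplies the polynomial in \<open>1 / h\<close>
      by its variable, so the difference quotient is again a \<open>flat\<close> function.\<close>
    have "((\<lambda>h. flat p h / h) \<longlongrightarrow> 0) (at_right 0)"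
      by (rule Lim_transform_eventually[OF flat_tendsto_0[of "pCons 0 p"]])
        (auto simp: flat_def eventually_at_filter)
    moreover have "((\<lambda>h. flat p h / h) \<longlongrightarrow> 0) (at_left 0)"
      by (rule tendsto_eventually) (auto simp: flat_def eventually_at_filter)
    ultimately have "((\<lambda>h. flat p h / h) \<longlongrightarrow> 0) (at 0)"
      by (simp add: filterlim_split_at)
    then show ?thesis
      using 3 by (simp add: DERIV_def flat_def)
  qed
qed

lemma DERIV_flat_compose:
  assumes "(f has_real_derivative d) (at x)"
  shows "((\<lambda>x. flat p (f x)) has_real_derivative flat (monom 1 2 * (p - pderiv p)) (f x) * d) (at x)"
  using DERIV_chain2[OF has_real_derivative_flat assms] .

inductive_set bumps :: "(real \<Rightarrow> real) set" where
  base: "(\<lambda>x. flat p (k * (x - s)) * flat q (k * (t - x))) \<in> bumps"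
| add: "f \<in> bumps \<Longrightarrow> g \<in> bumps \<Longrightarrow> (\<lambda>x. f x + g x) \<in> bumps"

lemma flat_smult: "flat (smult c p) x = c * flat p x"
  by (simp add: flat_def)

lemma bumps_cmult: "f \<in> bumps \<Longrightarrow> (\<lambda>x. c * f x) \<in> bumps"
proof (induction rule: bumps.induct)
  case (base p k s q t)
  show ?case
    using bumps.base[of "smult c p" k s q t] by (simp add: flat_smult mult.assoc)
next
  case (add f g)
  then show ?case using bumps.add[OF add.IH] by (simp add: algebra_simps)
qed

lemma bumps_DERIV: "f \<in> bumps \<Longrightarrow> \<exists>g\<in>bumps. \<forall>x. (f has_real_derivative g x) (at x)"
proof (induction rule: bumps.induct)
  case (base p k s q t)
  define D :: "real poly \<Rightarrow> real poly" where "D p = monom 1 2 * (p - pderiv p)" for p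
  define g where "g x = flat (smult k (D p)) (k * (x - s)) * flat q (k * (t - x))
     + flat p (k * (x - s)) * flat (smult (-k) (D q)) (k * (t - x))" for x
  have "g \<in> bumps"
    unfolding g_def by (intro bumps.intros)
  moreover have "((\<lambda>x. flat p (k * (x - s)) * flat q (k * (t - x))) has_real_derivative g x) (at x)" for x
  proof -
    have "((\<lambda>x. k * (x - s)) has_real_derivative k) (at x)"
      "((\<lambda>x. k * (t - x)) has_real_derivative - k) (at x)"
      by (auto intro!: derivative_eq_intros)
    from DERIV_mult[OF this[THEN DERIV_flat_compose]] show ?thesis
      unfolding flat_smult D_def g_def by (rule DERIV_cong) (simp add: algebra_simps)
  qed
  ultimately show ?case by blast
next
  case (add f g)
  then obtain f' g' where "f' \<in> bumps" "\<And>x. (f has_real_derivative f' x) (at x)"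
    "g' \<in> bumps" "\<And>x. (g has_real_derivative g' x) (at x)" by blast
  then have "\<forall>x. ((\<lambda>x. f x + g x) has_real_derivative f' x + g' x) (at x)"
    by (simp add: DERIV_add)
  with bumps.add[OF \<open>f' \<in> bumps\<close> \<open>g' \<in> bumps\<close>] show ?case
    by (intro bexI[where x="\<lambda>x. f' x + g' x"])
qed

lemma bumps_deriv: "f \<in> bumps \<Longrightarrow> deriv f \<in> bumps"
proof -
  assume "f \<in> bumps"
  then obtain g where g: "g \<in> bumps" "\<forall>x. (f has_real_derivative g x) (at x)"
    using bumps_DERIV by blast
  then have "deriv f = g" by (auto intro: DERIV_imp_deriv)
  with g show ?thesis by simp
qed

lemma bumps_deriv_funpow: "f \<in> bumps \<Longrightarrow> (deriv ^^ n) f \<in> bumps"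
  by (induction n) (auto intro: bumps_deriv)

lemma bumps_differentiable: "f \<in> bumps \<Longrightarrow> f differentiable_on UNIV"
  using bumps_DERIV by (fastforce simp: differentiable_on_def real_differentiable_def)

lemma bumps_continuous: "f \<in> bumps \<Longrightarrow> continuous_on A f"
  using bumps_differentiable differentiable_imp_continuous_on continuous_on_subset by blast

text \<open>The vanishing integral brings the antiderivative back to zero to the right of
  \<open>t\<close>, so that its support is compact. Its higher derivatives are those of
  \<open>f\<close>, so smoothness is inherited.\<close>

lemma bumps_antiderivative_test_function:
  assumes "a < s" "t < b" and f: "f \<in> bumps" and "\<And>x. x \<notin> {s..t} \<Longrightarrow> f x = 0"
    and "integral {a..b} f = 0"
  obtains \<phi> where "test_function a b \<phi>" "deriv \<phi> = f"
proof -
  define \<phi> where "\<phi> x = (if x \<in> {a..b} then integral {a..x} f else 0)" for x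
  have int: "f integrable_on {u..v}" for u v
    by (intro integrable_continuous_interval bumps_continuous f)
  have zero: "\<phi> x = 0" if "x \<notin> {s..t}" for x
  proof -
    have "\<phi> x = 0" if "x \<in> {a..b}" "x < s"
      using that assms integral_cong[of "{a..x}" f "\<lambda>_. 0"] by (simp add: \<phi>_def)
    moreover have "\<phi> x = 0" if "x \<in> {a..b}" "t < x"
    proof -
      have "integral {a..x} f + integral {x..b} f = 0"
        using that assms(5) int by (subst Henstock_Kurzweil_Integration.integral_combine) auto
      moreover have "integral {x..b} f = 0"
        using that assms integral_cong[of "{x..b}" f "\<lambda>_. 0"] by simp
      ultimately show ?thesis using that by (simp add: \<phi>_def)
    qed
    ultimately show ?thesis using that by (force simp: \<phi>_def)
  qed
  have deriv: "(\<phi> has_real_derivative f x) (at x)" for x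
  proof (cases "x \<in> {a<..<b}")
    case True
    have "((\<lambda>x. integral {a..x} f) has_real_derivative f x) (at x within {a..b})"
      using True by (intro integral_has_real_derivative bumps_continuous f) auto
    then have "((\<lambda>x. integral {a..x} f) has_real_derivative f x) (at x)"
      using True by (metis at_within_Icc_at greaterThanLessThan_iff)
    then show ?thesis
      by (rule has_field_derivative_transform_within_open[where S="{a<..<b}"])
        (use True in \<open>auto simp: \<phi>_def\<close>)
  next
    case False
    then have x: "x \<notin> {s..t}" using assms by auto
    have "((\<lambda>x. 0) has_real_derivative f x) (at x)"
      using x assms by simp
    then show ?thesis
      by (rule has_field_derivative_transform_within_open[where S="- {s..t}"])
        (use x zero in auto)
  qed
  then have d: "deriv \<phi> = f" by (auto intro: DERIV_imp_deriv)
  have "(deriv ^^ n) \<phi> differentiable_on UNIV" for n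
  proof (cases n)
    case 0
    then show ?thesis using deriv by (auto simp: differentiable_on_def real_differentiable_def)
  next
    case (Suc m)
    then show ?thesis
      using d by (simp add: funpow_Suc_right bumps_deriv_funpow f bumps_differentiable del: funpow.simps)
  qed
  moreover have "compact {s..t}" "{s..t} \<subseteq> {a<..<b}"
    using assms by auto
  ultimately have "test_function a b \<phi>"
    unfolding test_function_def using zero by blast
  with d that show thesis by blast
qed

text \<open>Lebesgue differentiation: at almost every point the averages over
  \<open>[x, x + r]\<close> converge to the value of the function, and here they are zero for all
  small \<open>r\<close>.\<close>

lemma integral_intervals_0_imp_AE_0:
  fixes h :: "real \<Rightarrow> real"
  assumes int: "integrable (lebesgue_on {a<..<b}) h"
    and 0: "\<And>s t. a < s \<Longrightarrow> s < t \<Longrightarrow> t < b \<Longrightarrow> integral {s..t} h = 0"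
  shows "AE x in lebesgue_on {a<..<b}. h x = 0"
proof -
  define F where "F x = (if x \<in> {a<..<b} then h x else 0)" for x
  have "integrable lebesgue F"
    unfolding F_def using int by (subst Lebesgue_Measure.integrable_restrict_UNIV) auto
  then have "F integrable_on UNIV"
    by (metis integrable_on_lebesgue_on lebesgue_on_UNIV_eq sets.top space_completion space_lborel space_borel)
  then have "F integrable_on cbox u v" for u v
    by (rule integrable_on_subcbox) simp
  then obtain N where N: "negligible N"
    and lim: "\<And>x e. x \<notin> N \<Longrightarrow> 0 < e \<Longrightarrow> \<exists>d>0. \<forall>r. 0 < r \<and> r < d \<longrightarrow>
        norm (integral (cbox x (x + r *\<^sub>R One)) F /\<^sub>R r ^ DIM(real) - F x) < e"
    using integrable_ccontinuous_explicit[of F] by blast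
  have "h x = 0" if x: "x \<in> {a<..<b}" "x \<notin> N" for x
  proof (rule ccontr)
    assume "h x \<noteq> 0"
    then obtain d where d: "d > 0" and lim': "\<And>r. 0 < r \<Longrightarrow> r < d \<Longrightarrow>
        norm (integral (cbox x (x + r *\<^sub>R One)) F /\<^sub>R r ^ DIM(real) - F x) < \<bar>h x\<bar>"
      using lim[OF x(2), of "\<bar>h x\<bar>"] by auto
    define r where "r = min (d / 2) ((b - x) / 2)"
    have r: "0 < r" "r < d" "x + r < b"
      using d x by (auto simp: r_def min_def field_simps)
    have "integral {x..x + r} F = integral {x..x + r} h"
      by (rule integral_cong) (use x r in \<open>auto simp: F_def\<close>)
    also have "\<dots> = 0" using 0 x r by simp
    finally show False
      using lim'[OF r(1,2)] x by (simp add: F_def)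
  qed
  moreover have "AE x in lebesgue. x \<notin> N"
    using N by (simp add: AE_not_in negligible_iff_null_sets)
  ultimately show ?thesis
    by (subst AE_restrict_space_iff) auto
qed

section \<open>Bumps approximating the indicator of an interval, and du Bois-Reymond\<close>

definition bump :: "real \<Rightarrow> real \<Rightarrow> nat \<Rightarrow> real \<Rightarrow> real" where
  "bump s t n = (\<lambda>x. flat 1 (real (Suc n) * (x - s)) * flat 1 (real (Suc n) * (t - x)))"

lemma bump_in_bumps: "bump s t n \<in> bumps"
  unfolding bump_def by (rule bumps.base)

lemma bump_eq_0: "x \<notin> {s<..<t} \<Longrightarrow> bump s t n x = 0"
  by (auto simp: bump_def flat_def zero_less_mult_iff simp del: of_nat_Suc)

lemma bump_pos: "x \<in> {s<..<t} \<Longrightarrow> 0 < bump s t n x"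
  by (auto simp: bump_def flat_def zero_less_mult_iff simp del: of_nat_Suc)

lemma bump_bounds: "0 \<le> bump s t n x" "bump s t n x \<le> 1"
  by (auto simp: bump_def flat_def intro!: mult_le_one)

text \<open>The scale \<open>Suc n\<close> divides the exponents \<open>1 / (x - s)\<close> and
  \<open>1 / (t - x)\<close>, which therefore tend to zero inside the interval. With the bounds 0
  and 1 this prepares dominated convergence.\<close>

lemma bump_tendsto: "(\<lambda>n. bump s t n x) \<longlonglongrightarrow> indicator {s<..<t} x"
proof (cases "x \<in> {s<..<t}")
  case True
  have lim: "(\<lambda>n. flat 1 (real (Suc n) * y)) \<longlonglongrightarrow> 1" if "y > 0" for y
  proof -
    have "(\<lambda>n. exp (- (inverse (real (Suc n)) * (1 / y)))) \<longlonglongrightarrow> exp (- (0 * (1 / y)))"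
      by (intro tendsto_intros LIMSEQ_inverse_real_of_nat)
    moreover have "exp (- (inverse (real (Suc n)) * (1 / y))) = flat 1 (real (Suc n) * y)" for n
      using that by (simp add: flat_def zero_less_mult_iff divide_inverse del: of_nat_Suc)
    ultimately show ?thesis by simp
  qed
  show ?thesis
    using tendsto_mult[OF lim[of "x - s"] lim[of "t - x"]] True by (simp add: bump_def)
qed (simp add: bump_eq_0)

lemma integrable_mult_bump:
  assumes "integrable (lebesgue_on A) f" and "A \<in> sets lebesgue"
  shows "integrable (lebesgue_on A) (\<lambda>x. f x * bump s t n x)"
proof (rule Bochner_Integration.integrable_bound[OF assms(1)])
  have "bump s t n \<in> borel_measurable (lebesgue_on A)"
    by (intro continuous_imp_measurable_on_sets_lebesgue bumps_continuous bump_in_bumps assms)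
  then show "(\<lambda>x. f x * bump s t n x) \<in> borel_measurable (lebesgue_on A)"
    using assms by measurable
  show "AE x in lebesgue_on A. norm (f x * bump s t n x) \<le> norm (f x)"
    using bump_bounds by (auto simp: abs_mult intro!: mult_left_le)
qed

text \<open>A null set contains no interval of positive length. Arguments that refute an
  almost-everywhere statement at each point of an interval end here.\<close>

lemma AE_notin_interval:
  fixes a b s t :: real
  assumes "AE x in lebesgue_on {a<..<b}. x \<notin> {s<..<t}" "a \<le> s" "t \<le> b"
  shows "t \<le> s"
proof (rule ccontr)
  assume "\<not> t \<le> s"
  have "AE x in lebesgue. x \<in> {a<..<b} \<longrightarrow> x \<notin> {s<..<t}"
    using assms(1) by (subst (asm) AE_restrict_space_iff) auto
  then have "AE x in lebesgue. x \<notin> {s<..<t}"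
    using assms(2,3) by (auto elim!: eventually_mono)
  then have "emeasure lebesgue {s<..<t} = 0"
    by (subst (asm) AE_iff_null_sets[symmetric]) auto
  with \<open>\<not> t \<le> s\<close> show False by simp
qed

lemma du_Bois_Reymond:
  assumes ab: "a < b" and f: "integrable (lebesgue_on {a<..<b}) f"
    and orth: "\<And>\<phi>. test_function a b \<phi> \<Longrightarrow> (LINT x|lebesgue_on {a<..<b}. f x * deriv \<phi> x) = 0"
  shows "\<exists>c. AE x in lebesgue_on {a<..<b}. f x = c"
proof -
  let ?M = "lebesgue_on {a<..<b}"
  let ?I = "\<lambda>s t n. integral\<^sup>L ?M (bump s t n)"
  have finM: "finite_measure ?M"
    by (intro finite_measureI) (use ab in \<open>simp add: emeasure_restrict_space\<close>)
  then have one: "integrable ?M (\<lambda>x. 1 :: real)"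
    by (simp add: finite_measure.integrable_const)
  have fbump: "integrable ?M (\<lambda>x. f x * bump s t n x)" for s t n
    by (intro integrable_mult_bump f) auto
  have ibump: "integrable ?M (bump s t n)" for s t n
    using integrable_mult_bump[OF one] by simp
  have proportional: "?I s' t' m * (LINT x|?M. f x * bump s t n x) = ?I s t n * (LINT x|?M. f x * bump s' t' m x)"
    if st: "a < s" "s < t" "t < b" "a < s'" "s' < t'" "t' < b" for s t s' t' m n
  proof -
    \<comment> \<open>A combination of the two bumps with vanishing integral, hence the derivative
      of a test function. Orthogonality then says that \<open>f\<close> integrates against bumps in
      proportion to their masses.\<close>
    define \<psi> where "\<psi> x = ?I s' t' m * bump s t n x + (- ?I s t n) * bump s' t' m x" for x
    have \<psi>: "\<psi> \<in> bumps"
      unfolding \<psi>_def by (intro bumps.add bumps_cmult bump_in_bumps)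
    have "integrable ?M \<psi>"
      unfolding \<psi>_def using ibump by auto
    then have "integral {a<..<b} \<psi> = integral\<^sup>L ?M \<psi>"
      by (simp add: lebesgue_integral_eq_integral)
    also have "\<dots> = 0"
      unfolding \<psi>_def using ibump by simp
    finally have 0: "integral {a..b} \<psi> = 0"
      by (simp add: integral_open_interval_real)
    have supp: "\<psi> x = 0" if "x \<notin> {min s s'..max t t'}" for x
    proof -
      have "x \<notin> {s<..<t}" "x \<notin> {s'<..<t'}" using that by auto
      then show ?thesis by (simp add: \<psi>_def bump_eq_0)
    qed
    obtain \<phi> where "test_function a b \<phi>" "deriv \<phi> = \<psi>"
      by (rule bumps_antiderivative_test_function[of a "min s s'" "max t t'" b \<psi>])
        (use st \<psi> 0 supp in auto)
    then have "(LINT x|?M. f x * \<psi> x) = 0"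
      using orth by metis
    moreover have "f x * \<psi> x = ?I s' t' m * (f x * bump s t n x) - ?I s t n * (f x * bump s' t' m x)" for x
      by (simp add: \<psi>_def algebra_simps)
    ultimately show ?thesis using fbump by simp
  qed
  define s0 where "s0 = a + (b - a) / 3"
  define t0 where "t0 = a + 2 * (b - a) / 3"
  have s0t0: "a < s0" "s0 < t0" "t0 < b" using ab by (auto simp: s0_def t0_def field_simps)
  have "?I s0 t0 0 \<noteq> 0"
  proof
    assume "?I s0 t0 0 = 0"
    then have "AE x in ?M. bump s0 t0 0 x = 0"
      using integral_nonneg_eq_0_iff_AE[OF ibump] bump_bounds by auto
    then have "AE x in ?M. x \<notin> {s0<..<t0}"
      by eventually_elim (metis bump_pos less_irrefl)
    from AE_notin_interval[OF this] show False using s0t0 by simp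
  qed
  \<comment> \<open>The common factor of proportionality, read off from a reference bump on the
    middle third of the interval.\<close>
  define c where "c = (LINT x|?M. f x * bump s0 t0 0 x) / ?I s0 t0 0"
  have eq: "(LINT x|?M. (f x - c) * bump s t n x) = 0" if "a < s" "s < t" "t < b" for s t n
  proof -
    have "(LINT x|?M. (f x - c) * bump s t n x) = (LINT x|?M. f x * bump s t n x) - c * ?I s t n"
      using fbump ibump by (simp add: left_diff_distrib)
    also have "\<dots> = 0"
      using proportional[OF that s0t0, of 0 n] \<open>?I s0 t0 0 \<noteq> 0\<close> by (simp add: c_def field_simps)
    finally show ?thesis .
  qed
  have fc: "integrable ?M (\<lambda>x. f x - c)"
    using f one by (auto simp: finM finite_measure.integrable_const)
  have "AE x in ?M. f x - c = 0"
  proof (rule integral_intervals_0_imp_AE_0[OF fc])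
    fix s t assume st: "a < s" "s < t" "t < b"
    have "(\<lambda>n. LINT x|?M. (f x - c) * bump s t n x) \<longlonglongrightarrow> (LINT x|?M. (f x - c) * indicator {s<..<t} x)"
    proof (rule integral_dominated_convergence[where w="\<lambda>x. norm (f x - c)"])
      show "(\<lambda>x. (f x - c) * indicator {s<..<t} x) \<in> borel_measurable ?M"
      proof -
        have "{s<..<t} \<in> sets ?M"
          using st by (subst sets_restrict_space_iff) auto
        then show ?thesis
          using fc by (intro borel_measurable_times borel_measurable_indicator) auto
      qed
      show "AE x in ?M. norm ((f x - c) * bump s t n x) \<le> norm (f x - c)" for n
        using bump_bounds by (auto simp: abs_mult intro!: mult_left_le)
      show "AE x in ?M. (\<lambda>n. (f x - c) * bump s t n x) \<longlonglongrightarrow> (f x - c) * indicator {s<..<t} x"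
        by (intro AE_I2 tendsto_intros bump_tendsto)
      show "(\<lambda>x. (f x - c) * bump s t n x) \<in> borel_measurable ?M" for n
        using integrable_mult_bump[OF fc] by auto
    qed (use fc in auto)
    then have "(LINT x|?M. (f x - c) * indicator {s<..<t} x) = 0"
      using eq[OF st] by (simp add: LIMSEQ_const_iff)
    moreover have "(\<lambda>x. (f x - c) * indicator {s<..<t} x) = (\<lambda>x. if x \<in> {s<..<t} then f x - c else 0)"
      by (auto simp: indicator_def)
    ultimately have "integral\<^sup>L ?M (\<lambda>x. if x \<in> {s<..<t} then f x - c else 0) = 0"
      by simp
    then have "integral\<^sup>L (lebesgue_on {s<..<t}) (\<lambda>x. f x - c) = 0"
      using st by (subst (asm) Lebesgue_Measure.integral_restrict) auto
    moreover have "integrable (lebesgue_on {s<..<t}) (\<lambda>x. f x - c)"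
    proof -
      have "set_integrable lebesgue {a<..<b} (\<lambda>x. f x - c)"
        using fc by (simp add: set_integrable_def integrable_restrict_space)
      then have "set_integrable lebesgue {s<..<t} (\<lambda>x. f x - c)"
        by (rule set_integrable_subset) (use st in auto)
      then show ?thesis by (simp add: set_integrable_def integrable_restrict_space)
    qed
    ultimately show "integral {s..t} (\<lambda>x. f x - c) = 0"
      by (simp add: lebesgue_integral_eq_integral integral_open_interval_real)
  qed
  then show ?thesis by auto
qed

section \<open>Finite Borel measures on the line\<close>

lemma finite_borel_measure_iff:
  "finite_borel_measure \<mu> \<longleftrightarrow> sets \<mu> = sets borel \<and> finite_measure \<mu>"
  by (auto simp: finite_borel_measure_def finite_borel_measure_axioms_def)

lemma finite_borelD:
  assumes "finite_borel_measure \<mu>"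
  shows "sets \<mu> = sets borel" "finite_measure \<mu>" "space \<mu> = UNIV"
  using assms sets_eq_imp_space_eq[of \<mu> borel] by (auto simp: finite_borel_measure_iff)

lemma finite_borel_emeasure: "finite_borel_measure \<mu> \<Longrightarrow> emeasure \<mu> E = ennreal (measure \<mu> E)"
  by (simp add: finite_borel_measure_iff finite_measure.emeasure_eq_measure)

lemma finite_borel_mono:
  "finite_borel_measure \<mu> \<Longrightarrow> A \<subseteq> B \<Longrightarrow> B \<in> sets borel \<Longrightarrow> measure \<mu> A \<le> measure \<mu> B"
  by (simp add: finite_borel_measure_iff finite_measure.finite_measure_mono)

lemma finite_borel_Un:
  "finite_borel_measure \<mu> \<Longrightarrow> A \<in> sets borel \<Longrightarrow> B \<in> sets borel \<Longrightarrow> A \<inter> B = {}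
    \<Longrightarrow> measure \<mu> (A \<union> B) = measure \<mu> A + measure \<mu> B"
  by (simp add: finite_borel_measure_iff finite_measure.finite_measure_Union)

lemma finite_borel_Ioc:
  assumes "finite_borel_measure \<mu>" "x \<le> y" "y \<le> z"
  shows "measure \<mu> {x<..z} = measure \<mu> {x<..y} + measure \<mu> {y<..z}"
  using finite_borel_Un[OF assms(1), of "{x<..y}" "{y<..z}"] assms
  by (simp add: ivl_disj_un_two ivl_disj_int_two)

lemma countable_atoms: "finite_borel_measure \<mu> \<Longrightarrow> countable {x. measure \<mu> {x} \<noteq> 0}"
  by (simp add: finite_borel_measure_iff finite_measure.countable_support)

section \<open>Sums, restrictions and point masses\<close>

lemma finite_borel_sum:
  assumes "finite_borel_measure M" "finite_borel_measure N"
  obtains S where "finite_borel_measure S" "\<And>E. measure S E = measure M E + measure N E"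
proof -
  define S where "S = measure_of (space M) (sets M) (\<lambda>E. emeasure M E + emeasure N E)"
  have sets: "sets S = sets borel"
    using finite_borelD(1)[OF assms(1)] unfolding S_def by (metis sets.sets_measure_of_eq)
  have e: "emeasure S E = emeasure M E + emeasure N E" if "E \<in> sets borel" for E
    unfolding S_def
  proof (rule emeasure_measure_of_sigma)
    show "sigma_algebra (space M) (sets M)" ..
    show "countably_additive (sets M) (\<lambda>E. emeasure M E + emeasure N E)"
      using finite_borelD[OF assms(1)] finite_borelD[OF assms(2)]
      by (auto simp: countably_additive_def suminf_add[symmetric] suminf_emeasure[symmetric])
  qed (use that finite_borelD[OF assms(1)] in \<open>auto simp: positive_def\<close>)
  have "finite_borel_measure S"
    unfolding finite_borel_measure_iff
    using sets sets_eq_imp_space_eq[OF sets] finite_borelD[OF assms(1)] finite_borelD[OF assms(2)]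
    by (auto intro!: finite_measureI simp: e finite_borel_emeasure[OF assms(1)] finite_borel_emeasure[OF assms(2)])
  moreover have "measure S E = measure M E + measure N E" for E
  proof (cases "E \<in> sets borel")
    case True
    have "ennreal (measure S E) = ennreal (measure M E + measure N E)"
      using e[OF True] by (simp add: finite_borel_emeasure[OF assms(1)] finite_borel_emeasure[OF assms(2)]
          finite_borel_emeasure[OF calculation])
    then show ?thesis by (simp del: ennreal_plus)
  next
    case False
    then show ?thesis
      using sets finite_borelD(1)[OF assms(1)] finite_borelD(1)[OF assms(2)] by (simp add: measure_notin_sets)
  qed
  ultimately show thesis by (rule that)
qed

lemma finite_borel_restrict:
  assumes "finite_borel_measure M" "A \<in> sets borel"
  obtains S where "finite_borel_measure S" "\<And>E. E \<in> sets borel \<Longrightarrow> measure S E = measure M (E \<inter> A)"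
proof
  let ?S = "density M (indicator A)"
  have e: "emeasure ?S E = emeasure M (E \<inter> A)" if "E \<in> sets borel" for E
    using that assms finite_borelD(1)[OF assms(1)] by (simp add: emeasure_restricted Int_commute)
  show "finite_borel_measure ?S"
    unfolding finite_borel_measure_iff
    using finite_borelD[OF assms(1)] e by (auto intro!: finite_measureI simp: finite_borel_emeasure[OF assms(1)])
  show "measure ?S E = measure M (E \<inter> A)" if "E \<in> sets borel" for E
    using e[OF that] by (simp add: measure_def)
qed

lemma finite_borel_dirac:
  assumes "c \<ge> 0"
  obtains S where "finite_borel_measure S" "\<And>E. E \<in> sets borel \<Longrightarrow> measure S E = c * indicator E \<theta>"
proof
  let ?S = "scale_measure (ennreal c) (return borel \<theta>)"
  have e: "emeasure ?S E = ennreal (c * indicator E \<theta>)" if "E \<in> sets borel" for E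
    using that assms by (auto simp: indicator_def)
  show "finite_borel_measure ?S"
    unfolding finite_borel_measure_iff using e by (auto intro!: finite_measureI simp: space_scale_measure)
  show "measure ?S E = c * indicator E \<theta>" if "E \<in> sets borel" for E
    using e[OF that] assms by (simp add: measure_def)
qed

section \<open>Uniqueness of measures and the variation of a signed measure\<close>

lemma finite_borel_cong:
  assumes "a < b" and M: "finite_borel_measure M" and N: "finite_borel_measure N"
    and eq: "\<And>x. x \<in> {a<..<b} \<Longrightarrow> measure M {a<..x} = measure N {a<..x}"
    and E: "E \<in> sets borel" "E \<subseteq> {a<..<b}"
  shows "measure M E = measure N E"
proof -
  interpret M: finite_measure M using M by (simp add: finite_borel_measure_iff)
  interpret N: finite_measure N using N by (simp add: finite_borel_measure_iff)
  note sets[simp] = finite_borelD(1)[OF M] finite_borelD(1)[OF N]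
  let ?O = "{a<..<b}"
  \<comment> \<open>The intervals of the hypothesis stop short of \<open>b\<close>, so agreement on
    all of \<open>?O\<close> is a limit; half-lines reaching beyond \<open>b\<close> and complements
    depend on it. In the sequence below, the offset 2 makes the first point the midpoint, hence
    interior.\<close>
  have total: "measure M ?O = measure N ?O"
  proof -
    define x where "x n = b - (b - a) / real (n + 2)" for n
    have x: "x n \<in> ?O" for n
      using assms(1) mult_right_mono[of a b "real n"] by (auto simp: x_def field_simps)
    have "x \<longlonglongrightarrow> b - 0"
      unfolding x_def by (intro tendsto_intros real_tendsto_divide_at_top[OF tendsto_const]
          filterlim_compose[OF filterlim_real_sequentially] filterlim_add_const_nat_at_top)
    then have "\<exists>n. z < x n" if "z < b" for z
      using that order_tendstoD(1)[of x b sequentially z] eventually_happens'[of sequentially] by auto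
    then have un: "(\<Union>n. {a<..x n}) = ?O"
    proof (intro equalityI subsetI)
      fix y assume "y \<in> (\<Union>n. {a<..x n})"
      then obtain n where "a < y" "y \<le> x n" by auto
      then show "y \<in> ?O" using x[of n] by auto
    next
      fix y assume y: "y \<in> ?O"
      then obtain n where "y < x n" using \<open>\<And>z. z < b \<Longrightarrow> \<exists>n. z < x n\<close>[of y] by auto
      then show "y \<in> (\<Union>n. {a<..x n})" using y by (auto intro!: exI[of _ n])
    qed
    have inc: "incseq (\<lambda>n. {a<..x n})"
    proof -
      have "x n \<le> x m" if "n \<le> m" for n m
        using that assms(1) by (auto simp: x_def intro!: divide_left_mono)
      then show ?thesis by (force simp: incseq_def)
    qed
    have "(\<lambda>n. measure M {a<..x n}) \<longlonglongrightarrow> measure M ?O"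
      using M.finite_Lim_measure_incseq[OF _ inc] un by (simp add: image_subset_iff)
    moreover have "(\<lambda>n. measure N {a<..x n}) \<longlonglongrightarrow> measure N ?O"
      using N.finite_Lim_measure_incseq[OF _ inc] un by (simp add: image_subset_iff)
    ultimately show ?thesis
      using eq[OF x] LIMSEQ_unique by auto
  qed
  have "Int_stable (range (atMost :: real \<Rightarrow> _))"
    by (auto simp: Int_stable_def)
  moreover have "range (atMost :: real \<Rightarrow> _) \<subseteq> Pow UNIV"
    by simp
  moreover have "E \<in> sigma_sets UNIV (range atMost)"
    using E(1) by (metis borel_eq_atMost sets_measure_of top_greatest Pow_UNIV)
  ultimately have "measure M (E \<inter> ?O) = measure N (E \<inter> ?O)"
  proof (induction rule: sigma_sets_induct_disjoint)
    case (basic A)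
    then obtain x where A: "A = {..x}" by auto
    consider "x \<le> a" | "x \<in> ?O" | "b \<le> x" by force
    then show ?case
    proof cases
      case 1
      then have "A \<inter> ?O = {}" using A by auto
      then show ?thesis by simp
    next
      case 2
      then have "A \<inter> ?O = {a<..x}" using A by auto
      then show ?thesis using eq 2 by simp
    next
      case 3
      then have "A \<inter> ?O = ?O" using A by auto
      then show ?thesis using total by simp
    qed
  next
    case empty
    show ?case by simp
  next
    case (compl A)
    then have A: "A \<in> sets borel" by (metis borel_eq_atMost sets_measure_of top_greatest Pow_UNIV)
    have "(UNIV - A) \<inter> ?O = ?O - (A \<inter> ?O)" by auto
    then show ?case
      using A compl(2) total by (simp add: M.finite_measure_Diff N.finite_measure_Diff)
  next
    case (union A)
    then have A: "A i \<in> sets borel" for i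
      by (metis borel_eq_atMost sets_measure_of top_greatest Pow_UNIV range_subsetD)
    have d: "disjoint_family (\<lambda>i. A i \<inter> ?O)" "range (\<lambda>i. A i \<inter> ?O) \<subseteq> sets borel"
      using union(1) A by (auto simp: disjoint_family_on_def)
    have "(\<lambda>i. measure M (A i \<inter> ?O)) sums measure M (\<Union>i. A i \<inter> ?O)"
      using d by (intro M.finite_measure_UNION) auto
    moreover have "(\<lambda>i. measure N (A i \<inter> ?O)) sums measure N (\<Union>i. A i \<inter> ?O)"
      using d by (intro N.finite_measure_UNION) auto
    ultimately show ?case
      using union(3) by (simp add: sums_unique2)
  qed
  then show ?thesis using E(2) by (simp add: Int_absorb2)
qed

text \<open>Signed measures are compared by moving negative parts across:
  \<open>P - N = P' - N'\<close> becomes an equality of sums, and these are positive measures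
  again.\<close>

lemma finite_borel_cong_sum:
  assumes "a < b" and "finite_borel_measure M" "finite_borel_measure N" "finite_borel_measure M'" "finite_borel_measure N'"
    and "\<And>x. x \<in> {a<..<b} \<Longrightarrow>
      measure M {a<..x} + measure N {a<..x} = measure M' {a<..x} + measure N' {a<..x}"
    and "E \<in> sets borel" "E \<subseteq> {a<..<b}"
  shows "measure M E + measure N E = measure M' E + measure N' E"
proof -
  obtain S where S: "finite_borel_measure S" "\<And>E. measure S E = measure M E + measure N E"
    using finite_borel_sum assms by blast
  obtain S' where S': "finite_borel_measure S'" "\<And>E. measure S' E = measure M' E + measure N' E"
    using finite_borel_sum assms by blast
  show ?thesis
    using finite_borel_cong[OF assms(1) S(1) S'(1)] assms S S' by simp
qed

text \<open>The variation measure is \<open>P - N\<close> on a Hahn set \<open>Y\<close> and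
  \<open>N - P\<close> off it. The pieces \<open>B \<inter> Y\<close> and \<open>B - Y\<close>,
  followed by empty sets, form the partition that detects its full mass in the supremum
  \<open>total_variation\<close>.\<close>

lemma Hahn_variation:
  assumes P: "finite_borel_measure P" and N: "finite_borel_measure N"
  obtains \<mu> where "finite_borel_measure \<mu>"
    and "\<And>E. \<bar>measure P E - measure N E\<bar> \<le> measure \<mu> E"
    and "\<And>x. measure \<mu> {x} = \<bar>measure P {x} - measure N {x}\<bar>"
    and "\<And>B. B \<in> sets borel \<Longrightarrow>
      ennreal (measure \<mu> B) \<le> total_variation (\<lambda>E. measure P E - measure N E) B"
proof -
  note sets[simp] = finite_borelD(1)[OF P] finite_borelD(1)[OF N]
  obtain Y where Y[measurable]: "Y \<in> sets borel"
    and on: "\<And>X. X \<in> sets borel \<Longrightarrow> X \<subseteq> Y \<Longrightarrow> emeasure N X \<le> emeasure P X"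
    and off: "\<And>X. X \<in> sets borel \<Longrightarrow> X \<inter> Y = {} \<Longrightarrow> emeasure P X \<le> emeasure N X"
    using finite_unsigned_Hahn_decomposition[of P N] finite_borelD[OF P] finite_borelD[OF N] by auto
  have on': "measure N (E \<inter> Y) \<le> measure P (E \<inter> Y)" and off': "measure P (E - Y) \<le> measure N (E - Y)"
    if "E \<in> sets borel" for E
    using on[of "E \<inter> Y"] off[of "E - Y"] that
    by (auto simp: finite_borel_emeasure[OF P] finite_borel_emeasure[OF N])
  obtain P1 where P1: "finite_borel_measure P1" "\<And>E. E \<in> sets borel \<Longrightarrow> measure P1 E = measure P (E \<inter> Y)"
    using finite_borel_restrict[OF P Y] by blast
  obtain N1 where N1: "finite_borel_measure N1" "\<And>E. E \<in> sets borel \<Longrightarrow> measure N1 E = measure N (E \<inter> Y)"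
    using finite_borel_restrict[OF N Y] by blast
  have Y': "- Y \<in> sets borel" by simp
  obtain P2 where P2: "finite_borel_measure P2" "\<And>E. E \<in> sets borel \<Longrightarrow> measure P2 E = measure P (E - Y)"
    using finite_borel_restrict[OF P Y'] by (auto simp: Diff_eq)
  obtain N2 where N2: "finite_borel_measure N2" "\<And>E. E \<in> sets borel \<Longrightarrow> measure N2 E = measure N (E - Y)"
    using finite_borel_restrict[OF N Y'] by (auto simp: Diff_eq)
  have diff: "\<exists>D. finite_borel_measure D \<and> (\<forall>E\<in>sets borel. measure D E = measure A E - measure B E)"
    if A: "finite_borel_measure A" and B: "finite_borel_measure B" and le: "\<And>E. E \<in> sets borel \<Longrightarrow> measure B E \<le> measure A E" for A B
  proof -
    let ?D = "diff_measure A B"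
    have e: "emeasure ?D E = ennreal (measure A E - measure B E)" if "E \<in> sets borel" for E
      using that A B le by (subst emeasure_diff_measure)
        (auto simp: finite_borelD finite_borel_emeasure[OF A] finite_borel_emeasure[OF B] ennreal_minus)
    have "finite_borel_measure ?D"
      unfolding finite_borel_measure_iff using finite_borelD[OF A] e[of UNIV] by (auto intro!: finite_measureI)
    moreover have "measure ?D E = measure A E - measure B E" if "E \<in> sets borel" for E
      using e[OF that] le[OF that] by (simp add: measure_def)
    ultimately show ?thesis by blast
  qed
  obtain D1 where D1: "finite_borel_measure D1"
      "\<And>E. E \<in> sets borel \<Longrightarrow> measure D1 E = measure P (E \<inter> Y) - measure N (E \<inter> Y)"
    using diff[OF P1(1) N1(1)] P1(2) N1(2) on' by auto
  obtain D2 where D2: "finite_borel_measure D2"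
      "\<And>E. E \<in> sets borel \<Longrightarrow> measure D2 E = measure N (E - Y) - measure P (E - Y)"
    using diff[OF N2(1) P2(1)] P2(2) N2(2) off' by auto
  obtain \<mu> where \<mu>: "finite_borel_measure \<mu>" "\<And>E. measure \<mu> E = measure D1 E + measure D2 E"
    using finite_borel_sum[OF D1(1) D2(1)] by blast
  have split: "measure P E = measure P (E \<inter> Y) + measure P (E - Y)"
    "measure N E = measure N (E \<inter> Y) + measure N (E - Y)" if "E \<in> sets borel" for E
    using that finite_borel_Un[OF P, of "E \<inter> Y" "E - Y"] finite_borel_Un[OF N, of "E \<inter> Y" "E - Y"]
    by (auto simp: Int_Diff_Un Int_Diff_disjoint)
  show thesis
  proof
    show "finite_borel_measure \<mu>" by fact
    show "\<bar>measure P E - measure N E\<bar> \<le> measure \<mu> E" for E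
    proof (cases "E \<in> sets borel")
      case True
      then show ?thesis
        using split[OF True] on'[OF True] off'[OF True] by (simp add: \<mu>(2) D1(2) D2(2))
    qed (simp add: measure_notin_sets)
    show "measure \<mu> {x} = \<bar>measure P {x} - measure N {x}\<bar>" for x
      using on'[of "{x}"] off'[of "{x}"] by (cases "x \<in> Y") (auto simp: \<mu>(2) D1(2) D2(2) insert_Diff_if)
    fix B :: "real set" assume B: "B \<in> sets borel"
    let ?\<nu> = "\<lambda>E. measure P E - measure N E"
    let ?E = "\<lambda>n::nat. if n = 0 then B \<inter> Y else if n = 1 then B - Y else {}"
    have "ennreal (measure \<mu> B) = ennreal \<bar>?\<nu> (B \<inter> Y)\<bar> + ennreal \<bar>?\<nu> (B - Y)\<bar>"
      using on'[OF B] off'[OF B] B by (simp add: \<mu>(2) D1(2) D2(2) ennreal_plus[symmetric] del: ennreal_plus)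
    also have "\<dots> = (\<Sum>n\<in>{0, 1}. ennreal \<bar>?\<nu> (?E n)\<bar>)"
      by simp
    also have "\<dots> \<le> (\<Sum>n. ennreal \<bar>?\<nu> (?E n)\<bar>)"
      by (rule sum_le_suminf) auto
    also have "\<dots> \<le> total_variation ?\<nu> B"
      unfolding total_variation_def
    proof (rule SUP_upper)
      have "range ?E \<subseteq> sets borel" using B by auto
      moreover have "disjoint_family ?E" by (auto simp: disjoint_family_on_def)
      moreover have "(\<Union>n. ?E n) = B" by (auto split: if_splits)
      ultimately show "?E \<in> {E. range E \<subseteq> sets borel \<and> disjoint_family E \<and> \<Union> (range E) = B}"
        by blast
    qed
    finally show "ennreal (measure \<mu> B) \<le> total_variation ?\<nu> B" .
  qed
qed

lemma total_variation_le:
  assumes "finite_borel_measure \<mu>" "B \<in> sets borel"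
    and "\<And>E. E \<in> sets borel \<Longrightarrow> E \<subseteq> B \<Longrightarrow> \<bar>\<nu> E\<bar> \<le> measure \<mu> E"
  shows "total_variation \<nu> B \<le> ennreal (measure \<mu> B)"
  unfolding total_variation_def
proof (rule SUP_least, safe)
  fix E :: "nat \<Rightarrow> real set"
  assume E: "range E \<subseteq> sets borel" "disjoint_family E" and B: "B = \<Union> (range E)"
  have "(\<Sum>n. ennreal \<bar>\<nu> (E n)\<bar>) \<le> (\<Sum>n. emeasure \<mu> (E n))"
    using assms E B by (intro suminf_le) (auto simp: finite_borel_emeasure)
  also have "\<dots> = emeasure \<mu> (\<Union> (range E))"
    using E finite_borelD[OF assms(1)] by (intro suminf_emeasure) auto
  finally show "(\<Sum>n. ennreal \<bar>\<nu> (E n)\<bar>) \<le> ennreal (measure \<mu> (\<Union> (range E)))"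
    by (simp add: finite_borel_emeasure[OF assms(1)])
qed

section \<open>Primitives of measures and their distributional derivatives\<close>

lemma Ioc_measure_at_right:
  assumes "finite_borel_measure P" "a \<le> y"
  shows "((\<lambda>x. measure P {a<..x}) \<longlongrightarrow> measure P {a<..y}) (at_right y)"
proof -
  interpret finite_borel_measure P by fact
  have eq: "measure P {a<..x} = cdf P x - cdf P a" if "a \<le> x" for x
    using cdf_diff_eq[of a x] that by (cases "a = x") auto
  have "((\<lambda>x. cdf P x - cdf P a) \<longlongrightarrow> cdf P y - cdf P a) (at_right y)"
    using cdf_is_right_cont[of y] by (intro tendsto_intros) (simp add: continuous_within)
  then have "((\<lambda>x. cdf P x - cdf P a) \<longlongrightarrow> measure P {a<..y}) (at_right y)"
    by (simp add: eq assms)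
  then show ?thesis
    by (rule Lim_transform_eventually)
      (use assms in \<open>auto simp: eventually_at_filter eq intro!: always_eventually\<close>)
qed

text \<open>The limit from the left misses exactly the atom at \<open>y\<close>; the jumps of a
  primitive are read off from this.\<close>

lemma Ioc_measure_at_left:
  assumes "finite_borel_measure P" "a < y"
  shows "((\<lambda>x. measure P {a<..x}) \<longlongrightarrow> measure P {a<..y} - measure P {y}) (at_left y)"
proof -
  interpret finite_borel_measure P by fact
  have eq: "measure P {a<..x} = cdf P x - cdf P a" if "a \<le> x" for x
    using cdf_diff_eq[of a x] that by (cases "a = x") auto
  have "measure P {..y} = measure P {..<y} + measure P {y}"
    using finite_borel_Un[OF assms(1), of "{..<y}" "{y}"] by (simp add: ivl_disj_un_singleton del: Un_insert_right)
  then have "measure P {..<y} = cdf P y - measure P {y}"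
    by (simp add: cdf_def)
  then have "((\<lambda>x. cdf P x - cdf P a) \<longlongrightarrow> (cdf P y - measure P {y}) - cdf P a) (at_left y)"
    using cdf_at_left[of y] by (intro tendsto_intros) simp
  then have "((\<lambda>x. cdf P x - cdf P a) \<longlongrightarrow> measure P {a<..y} - measure P {y}) (at_left y)"
    using assms by (simp add: eq algebra_simps)
  moreover have "\<forall>\<^sub>F x in at_left y. cdf P x - cdf P a = measure P {a<..x}"
    using eventually_at_left[OF \<open>a < y\<close>, of "\<lambda>x. cdf P x - cdf P a = measure P {a<..x}"] assms eq by auto
  ultimately show ?thesis
    by (rule Lim_transform_eventually)
qed

lemma borel_measurable_Ioc_measure:
  assumes "finite_borel_measure P"
  shows "(\<lambda>x. measure P {a<..x}) \<in> borel_measurable borel"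
  by (rule borel_measurable_mono) (auto intro!: monoI finite_borel_mono[OF assms])

lemma test_functionD:
  assumes "test_function a b \<phi>"
  shows "(\<phi> has_real_derivative deriv \<phi> x) (at x)" "continuous_on A (deriv \<phi>)" "continuous_on A \<phi>"
    and "x \<notin> {a<..<b} \<Longrightarrow> \<phi> x = 0"
proof -
  have diff: "(deriv ^^ n) \<phi> differentiable_on UNIV" for n
    using assms by (simp add: test_function_def)
  have "\<phi> differentiable_on UNIV" using diff[of 0] by simp
  then show "(\<phi> has_real_derivative deriv \<phi> x) (at x)"
    by (metis DERIV_deriv_iff_real_differentiable UNIV_I differentiable_on_def)
  show "continuous_on A \<phi>"
    using \<open>\<phi> differentiable_on UNIV\<close> differentiable_imp_continuous_on continuous_on_subset by blast
  have "deriv \<phi> differentiable_on UNIV" using diff[of 1] by simp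
  then show "continuous_on A (deriv \<phi>)"
    using differentiable_imp_continuous_on continuous_on_subset by blast
  show "x \<notin> {a<..<b} \<Longrightarrow> \<phi> x = 0"
    using assms by (auto simp: test_function_def)
qed

lemma test_function_bounded:
  assumes "test_function a b \<phi>"
  obtains B where "\<And>x. x \<in> {a<..<b} \<Longrightarrow> \<bar>deriv \<phi> x\<bar> \<le> B"
proof -
  have "compact (deriv \<phi> ` {a..b})"
    by (intro compact_continuous_image test_functionD(2)[OF assms]) simp
  then obtain B where "\<forall>y\<in>deriv \<phi> ` {a..b}. norm y \<le> B"
    using compact_imp_bounded bounded_iff by blast
  then show thesis by (intro that[of B]) auto
qed

lemma lebesgue_on_integral_eq_lborel:
  fixes f :: "real \<Rightarrow> real"
  assumes "f \<in> borel_measurable borel"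
  shows "(LINT x|lebesgue_on {a<..<b}. f x) = (LINT x|lborel. indicator {a<..<b} x * f x)"
  using assms by (simp add: integral_restrict_space integral_completion)

lemma integral_deriv_test_function:
  assumes "test_function a b \<phi>" "a \<le> t" "t \<le> b"
  shows "(LINT x|lborel. indicator {t..b} x * deriv \<phi> x) = - \<phi> t"
  using integral_FTC_atLeastAtMost[OF assms(3), of \<phi> "deriv \<phi>"] test_functionD[OF assms(1)]
  by (simp add: has_real_derivative_iff_has_vector_derivative has_vector_derivative_at_within)

lemma integrable_lebesgue_on_bounded:
  fixes f :: "real \<Rightarrow> real"
  assumes "f \<in> borel_measurable borel" "\<And>x. x \<in> {a<..<b} \<Longrightarrow> \<bar>f x\<bar> \<le> B"
  shows "integrable (lebesgue_on {a<..<b}) f"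
proof (rule integrableI_bounded_set[where A="{a<..<b}" and B=B])
  show "f \<in> borel_measurable (lebesgue_on {a<..<b})"
    using assms by (intro measurable_restrict_space1) (simp add: measurable_completion)
  show "emeasure (lebesgue_on {a<..<b}) {a<..<b} < \<infinity>"
    by (cases "a \<le> b") (auto simp: emeasure_restrict_space)
qed (use assms in \<open>auto intro!: AE_I2\<close>)

text \<open>Integration by parts as Fubini on the triangle \<open>a < t \<le> x < b\<close>:
  integrating \<open>deriv \<phi>\<close> over \<open>x\<close> first leaves
  \<open>- \<phi> t\<close>, since \<open>\<phi>\<close> vanishes at \<open>b\<close>.\<close>

lemma integral_Ioc_measure_deriv:
  assumes "a < b" and P: "finite_borel_measure P" and \<phi>: "test_function a b \<phi>"
  shows "(LINT x|lebesgue_on {a<..<b}. measure P {a<..x} * deriv \<phi> x)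
    = - (LINT t|restrict_space P {a<..<b}. \<phi> t)"
proof -
  interpret Q: finite_borel_measure P by fact
  interpret pair_sigma_finite lborel P ..
  note [measurable_cong] = Q.M_is_borel
  obtain B where B: "\<And>x. x \<in> {a<..<b} \<Longrightarrow> \<bar>deriv \<phi> x\<bar> \<le> B"
    using test_function_bounded[OF \<phi>] by blast
  have [measurable]: "deriv \<phi> \<in> borel_measurable borel" "\<phi> \<in> borel_measurable borel"
    by (intro borel_measurable_continuous_onI test_functionD[OF \<phi>])+
  define F where "F x t = (if a < x \<and> x < b \<and> a < t \<and> t \<le> x then deriv \<phi> x else 0)" for x t
  have "integrable (lborel \<Otimes>\<^sub>M P) (case_prod F)"
  proof (rule integrableI_bounded_set[where A="{a<..<b} \<times> UNIV" and B=B])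
    show "{a<..<b} \<times> UNIV \<in> sets (lborel \<Otimes>\<^sub>M P)"
      using Q.borel_UNIV sets.top[of P] by (intro pair_measureI) auto
    show "case_prod F \<in> borel_measurable (lborel \<Otimes>\<^sub>M P)"
      unfolding F_def by measurable
    have "emeasure (lborel \<Otimes>\<^sub>M P) ({a<..<b} \<times> UNIV) = emeasure lborel {a<..<b} * emeasure P UNIV"
      using Q.borel_UNIV sets.top[of P] by (intro Q.emeasure_pair_measure_Times) (auto simp del: space_borel)
    then show "emeasure (lborel \<Otimes>\<^sub>M P) ({a<..<b} \<times> UNIV) < \<infinity>"
      using assms(1) by (simp add: Q.emeasure_eq_measure ennreal_mult_less_top)
    show "AE z in lborel \<Otimes>\<^sub>M P. z \<in> {a<..<b} \<times> UNIV \<longrightarrow> norm (case_prod F z) \<le> B"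
    proof (rule AE_I2, safe)
      fix x t :: real assume "x \<in> {a<..<b}"
      then have 1: "\<bar>deriv \<phi> x\<bar> \<le> B" by (rule B)
      then have "0 \<le> B" by linarith
      with 1 show "norm (F x t) \<le> B" by (simp add: F_def)
    qed
    show "AE z in lborel \<Otimes>\<^sub>M P. z \<notin> {a<..<b} \<times> UNIV \<longrightarrow> case_prod F z = 0"
      by (auto simp: F_def intro!: AE_I2 split: if_splits)
  qed
  then have fub: "(LINT t|P. LINT x|lborel. F x t) = (LINT x|lborel. LINT t|P. F x t)"
    by (rule Fubini_integral)
  have "(LINT t|P. F x t) = indicator {a<..<b} x * (measure P {a<..x} * deriv \<phi> x)" for x
  proof -
    have "F x t = indicator {a<..x} t * (indicator {a<..<b} x * deriv \<phi> x)" for t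
      by (auto simp: F_def indicator_def)
    then show ?thesis
      using Q.borel_UNIV by (simp add: Q.M_is_borel mult_ac)
  qed
  moreover have "(LINT x|lborel. F x t) = - (indicator {a<..<b} t * \<phi> t)" for t
  proof (cases "t \<in> {a<..<b}")
    case True
    have "(LINT x|lborel. F x t) = (LINT x|lborel. indicator {t..b} x * deriv \<phi> x)"
    proof (rule integral_cong_AE)
      show "AE x in lborel. F x t = indicator {t..b} x * deriv \<phi> x"
        using AE_lborel_singleton[of b] by eventually_elim (use True in \<open>auto simp: F_def\<close>)
    qed (auto simp: F_def)
    also have "\<dots> = - \<phi> t"
      using True by (intro integral_deriv_test_function[OF \<phi>]) auto
    finally show ?thesis using True by simp
  next
    case False
    then have "F x t = 0" for x by (auto simp: F_def)
    then show ?thesis using False by simp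
  qed
  ultimately have "(LINT x|lborel. indicator {a<..<b} x * (measure P {a<..x} * deriv \<phi> x))
      = - (LINT t|P. indicator {a<..<b} t * \<phi> t)"
    using fub by simp
  moreover have "(LINT x|lebesgue_on {a<..<b}. measure P {a<..x} * deriv \<phi> x)
      = (LINT x|lborel. indicator {a<..<b} x * (measure P {a<..x} * deriv \<phi> x))"
    using borel_measurable_Ioc_measure[OF P] by (intro lebesgue_on_integral_eq_lborel borel_measurable_times) auto
  moreover have "(LINT t|restrict_space P {a<..<b}. \<phi> t) = (LINT t|P. indicator {a<..<b} t * \<phi> t)"
    by (simp add: integral_restrict_space Q.M_is_borel)
  ultimately show ?thesis by simp
qed

text \<open>Restricting before evaluating makes this function zero off the Borel subsets of
  \<open>(a,b)\<close>, in agreement with \<open>has_distr_deriv\<close>; derivatives can then be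
  equal as functions on all sets.\<close>

definition signed_on :: "real \<Rightarrow> real \<Rightarrow> real measure \<Rightarrow> real measure \<Rightarrow> real set \<Rightarrow> real" where
  "signed_on a b P N E = measure (restrict_space P {a<..<b}) E - measure (restrict_space N {a<..<b}) E"

lemma signed_eq:
  assumes "finite_borel_measure P" "finite_borel_measure N" "E \<in> sets borel"  "E \<subseteq> {a<..<b}"
  shows "signed_on a b P N E = measure P E - measure N E"
  using assms finite_borelD(1)[OF assms(1)] finite_borelD(1)[OF assms(2)]
  by (simp add: signed_on_def measure_restrict_space)

lemma signed_eq_0:
  assumes "finite_borel_measure P" "finite_borel_measure N" "\<not> (E \<in> sets borel \<and> E \<subseteq> {a<..<b})"
  shows "signed_on a b P N E = 0"
proof -
  have "E \<notin> sets (restrict_space P {a<..<b})" "E \<notin> sets (restrict_space N {a<..<b})"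
    using assms by (auto simp: sets_restrict_space_iff finite_borelD(1))
  then show ?thesis by (simp add: signed_on_def measure_notin_sets)
qed

lemma integrable_Ioc_measure:
  assumes "finite_borel_measure P"
  shows "integrable (lebesgue_on {a<..<b}) (\<lambda>x. measure P {a<..x})"
  by (rule integrable_lebesgue_on_bounded[where B="measure P UNIV"])
    (auto intro!: finite_borel_mono[OF assms] borel_measurable_Ioc_measure[OF assms])

lemma integrable_mult_deriv_test_function:
  assumes "integrable (lebesgue_on {a<..<b}) u" "test_function a b \<phi>"
  shows "integrable (lebesgue_on {a<..<b}) (\<lambda>x. u x * deriv \<phi> x)"
proof -
  obtain B where B: "\<And>x. x \<in> {a<..<b} \<Longrightarrow> \<bar>deriv \<phi> x\<bar> \<le> B"
    using test_function_bounded[OF assms(2)] by blast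
  have "deriv \<phi> \<in> borel_measurable (lebesgue_on {a<..<b})"
    by (intro continuous_imp_measurable_on_sets_lebesgue test_functionD(2)[OF assms(2)]) simp
  moreover have "AE x in lebesgue_on {a<..<b}. norm (u x * deriv \<phi> x) \<le> norm (B * u x)"
  proof (rule AE_I2)
    fix x assume "x \<in> space (lebesgue_on {a<..<b})"
    then have "\<bar>deriv \<phi> x\<bar> \<le> \<bar>B\<bar>" using B[of x] by simp
    then show "norm (u x * deriv \<phi> x) \<le> norm (B * u x)"
      by (simp add: abs_mult mult.commute[of "\<bar>u x\<bar>"] mult_right_mono)
  qed
  ultimately show ?thesis
    using assms(1) by (intro Bochner_Integration.integrable_bound[OF integrable_mult_right[OF assms(1), of B]]) auto
qed

lemma integral_primitive_deriv:
  assumes "a < b" and P: "finite_borel_measure P" and N: "finite_borel_measure N"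
    and u: "integrable (lebesgue_on {a<..<b}) u"
    and eq: "AE x in lebesgue_on {a<..<b}. u x = c + measure P {a<..x} - measure N {a<..x}"
    and \<phi>: "test_function a b \<phi>"
  shows "(LINT x|lebesgue_on {a<..<b}. u x * deriv \<phi> x)
    = - ((LINT t|restrict_space P {a<..<b}. \<phi> t) - (LINT t|restrict_space N {a<..<b}. \<phi> t))"
proof -
  let ?M = "lebesgue_on {a<..<b}"
  have one: "integrable ?M (\<lambda>x. 1 :: real)"
    by (rule integrable_lebesgue_on_bounded[where B=1]) auto
  note i = integrable_mult_deriv_test_function[OF one \<phi>]
    integrable_mult_deriv_test_function[OF integrable_Ioc_measure[OF P] \<phi>]
    integrable_mult_deriv_test_function[OF integrable_Ioc_measure[OF N] \<phi>]
  have "(LINT x|?M. u x * deriv \<phi> x)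
    = (LINT x|?M. c * (1 * deriv \<phi> x) + measure P {a<..x} * deriv \<phi> x - measure N {a<..x} * deriv \<phi> x)"
  proof (rule integral_cong_AE)
    show "(\<lambda>x. u x * deriv \<phi> x) \<in> borel_measurable ?M"
      using integrable_mult_deriv_test_function[OF u \<phi>] by auto
    show "(\<lambda>x. c * (1 * deriv \<phi> x) + measure P {a<..x} * deriv \<phi> x - measure N {a<..x} * deriv \<phi> x)
        \<in> borel_measurable ?M"
      using i by (intro borel_measurable_diff borel_measurable_add borel_measurable_times[OF borel_measurable_const]) auto
    show "AE x in ?M. u x * deriv \<phi> x
        = c * (1 * deriv \<phi> x) + measure P {a<..x} * deriv \<phi> x - measure N {a<..x} * deriv \<phi> x"
      using eq by eventually_elim (simp add: distrib_right left_diff_distrib)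
  qed
  also have "\<dots> = c * (LINT x|?M. 1 * deriv \<phi> x)
      + (LINT x|?M. measure P {a<..x} * deriv \<phi> x) - (LINT x|?M. measure N {a<..x} * deriv \<phi> x)"
    using i by simp
  \<comment> \<open>The constant drops out because a test function vanishes at both ends.\<close>
  also have "(LINT x|?M. 1 * deriv \<phi> x) = 0"
  proof -
    have [measurable]: "deriv \<phi> \<in> borel_measurable borel"
      by (intro borel_measurable_continuous_onI test_functionD[OF \<phi>])
    have "(LINT x|?M. 1 * deriv \<phi> x) = (LINT x|lborel. indicator {a<..<b} x * deriv \<phi> x)"
      by (simp add: lebesgue_on_integral_eq_lborel)
    also have "\<dots> = (LINT x|lborel. indicator {a..b} x * deriv \<phi> x)"
    proof (rule integral_cong_AE)
      show "AE x in lborel. indicator {a<..<b} x * deriv \<phi> x = indicator {a..b} x * deriv \<phi> x"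
        using AE_lborel_singleton[of b] AE_lborel_singleton[of a]
        by eventually_elim (auto simp: indicator_def)
    qed auto
    also have "\<dots> = 0"
      using assms(1) test_functionD(4)[OF \<phi>, of a] by (simp add: integral_deriv_test_function[OF \<phi>])
    finally show ?thesis .
  qed
  finally show ?thesis
    by (simp add: integral_Ioc_measure_deriv[OF assms(1) P \<phi>] integral_Ioc_measure_deriv[OF assms(1) N \<phi>])
qed

lemma has_distr_deriv_signed:
  assumes "a < b" and P: "finite_borel_measure P" and N: "finite_borel_measure N"
    and u: "integrable (lebesgue_on {a<..<b}) u"
    and eq: "AE x in lebesgue_on {a<..<b}. u x = c + measure P {a<..x} - measure N {a<..x}"
  shows "has_distr_deriv a b u (signed_on a b P N)"
  unfolding has_distr_deriv_def
proof (intro exI conjI allI impI)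
  show "finite_measure (restrict_space P {a<..<b})" "finite_measure (restrict_space N {a<..<b})"
    using P N by (auto intro!: finite_measure_restrict_space simp: finite_borelD)
  show "sets (restrict_space P {a<..<b}) = sets (restrict_space borel {a<..<b})"
    "sets (restrict_space N {a<..<b}) = sets (restrict_space borel {a<..<b})"
    using P N by (auto intro!: sets_restrict_space_cong simp: finite_borelD)
  show "signed_on a b P N = (\<lambda>E. measure (restrict_space P {a<..<b}) E - measure (restrict_space N {a<..<b}) E)"
    by (simp add: signed_on_def fun_eq_iff)
qed (use integral_primitive_deriv[OF assms] in auto)

text \<open>The measures in \<open>has_distr_deriv\<close> have \<open>(a,b)\<close> as their space.
  Their push-forward under the inclusion is a Borel measure on the line, where distribution
  functions are at hand.\<close>

lemma finite_borel_extend: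
  assumes "finite_measure P" and sets: "sets P = sets (restrict_space borel {a<..<b})"
  obtains Q where "finite_borel_measure Q" "restrict_space Q {a<..<b} = P"
proof
  let ?Q = "distr P borel (\<lambda>x. x)"
  have id: "(\<lambda>x. x) \<in> measurable P borel"
  proof -
    have "(\<lambda>x. x) \<in> measurable (restrict_space borel {a<..<b}) borel"
      by (intro measurable_restrict_space1 measurable_ident_sets refl)
    then show ?thesis using measurable_cong_sets[OF sets refl] by blast
  qed
  show fQ: "finite_borel_measure ?Q"
    using finite_measure.finite_measure_distr[OF assms(1) id] by (simp add: finite_borel_measure_iff)
  show "restrict_space ?Q {a<..<b} = P"
  proof (rule measure_eqI)
    show "sets (restrict_space ?Q {a<..<b}) = sets P"
      unfolding sets by (intro sets_restrict_space_cong) simp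
    fix E assume "E \<in> sets (restrict_space ?Q {a<..<b})"
    then have E: "E \<in> sets borel" "E \<subseteq> {a<..<b}" by (auto simp: sets_restrict_space_iff)
    have "space P = {a<..<b}"
      using sets_eq_imp_space_eq[OF sets] by (simp add: space_restrict_space)
    then show "emeasure (restrict_space ?Q {a<..<b}) E = emeasure P E"
      using E id by (auto simp: emeasure_restrict_space emeasure_distr Int_absorb2)
  qed
qed

text \<open>The function \<open>u\<close> minus the primitive of its derivative is orthogonal to
  every \<open>deriv \<phi>\<close>, so du Bois-Reymond makes it a constant.\<close>

lemma has_distr_deriv_imp_primitive:
  assumes "a < b" and u: "integrable (lebesgue_on {a<..<b}) u" and d: "has_distr_deriv a b u \<nu>"
  obtains c P N where "finite_borel_measure P" "finite_borel_measure N" "\<nu> = signed_on a b P N"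
    "AE x in lebesgue_on {a<..<b}. u x = c + measure P {a<..x} - measure N {a<..x}"
proof -
  let ?M = "lebesgue_on {a<..<b}"
  obtain P' N' where fin: "finite_measure P'" "finite_measure N'"
    and sets: "sets P' = sets (restrict_space borel {a<..<b})" "sets N' = sets (restrict_space borel {a<..<b})"
    and \<nu>: "\<nu> = (\<lambda>E. measure P' E - measure N' E)"
    and int: "\<And>\<phi>. test_function a b \<phi> \<Longrightarrow>
           (LINT x|?M. u x * deriv \<phi> x) = - ((LINT x|P'. \<phi> x) - (LINT x|N'. \<phi> x))"
    using d unfolding has_distr_deriv_def by blast
  obtain P where P: "finite_borel_measure P" "restrict_space P {a<..<b} = P'"
    using finite_borel_extend[OF fin(1) sets(1)] by blast
  obtain N where N: "finite_borel_measure N" "restrict_space N {a<..<b} = N'"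
    using finite_borel_extend[OF fin(2) sets(2)] by blast
  define v where "v x = measure P {a<..x} - measure N {a<..x}" for x
  have v: "integrable ?M v"
    unfolding v_def using integrable_Ioc_measure P(1) N(1) by (intro Bochner_Integration.integrable_diff)
  have "\<exists>c. AE x in ?M. u x - v x = c"
  proof (rule du_Bois_Reymond[OF assms(1)])
    show "integrable ?M (\<lambda>x. u x - v x)" using u v by simp
    fix \<phi> assume \<phi>: "test_function a b \<phi>"
    have "(LINT x|?M. (u x - v x) * deriv \<phi> x) = (LINT x|?M. u x * deriv \<phi> x) - (LINT x|?M. v x * deriv \<phi> x)"
      using integrable_mult_deriv_test_function[OF u \<phi>] integrable_mult_deriv_test_function[OF v \<phi>]
      by (simp add: left_diff_distrib)
    also have "\<dots> = 0"
      using int[OF \<phi>] integral_primitive_deriv[OF assms(1) P(1) N(1) v _ \<phi>, of 0] P(2) N(2)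
      by (simp add: v_def)
    finally show "(LINT x|?M. (u x - v x) * deriv \<phi> x) = 0" .
  qed
  then obtain c where "AE x in ?M. u x - v x = c" by blast
  then have "AE x in ?M. u x = c + measure P {a<..x} - measure N {a<..x}"
    by eventually_elim (auto simp: v_def)
  moreover have "\<nu> = signed_on a b P N"
    using \<nu> P(2) N(2) by (simp add: signed_on_def fun_eq_iff)
  ultimately show thesis using that P(1) N(1) by blast
qed

section \<open>The energy of a BV function\<close>

text \<open>Functions with different limits stay apart on \<open>A\<close> near \<open>x\<close>.
  The condition on \<open>A\<close> puts a whole interval, which has positive measure, into that
  region. It is met by each of the two sides of \<open>x\<close>.\<close>

lemma AE_lebesgue_on_tendsto_unique:
  fixes f g :: "real \<Rightarrow> real"
  assumes ae: "AE x in lebesgue_on {a<..<b}. f x = g x"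
    and A: "\<And>d. d > 0 \<Longrightarrow> \<exists>s t. a \<le> s \<and> s < t \<and> t \<le> b \<and> {s<..<t} \<subseteq> A \<inter> ball x d - {x}"
    and f: "(f \<longlongrightarrow> l) (at x within A)" and g: "(g \<longlongrightarrow> m) (at x within A)"
  shows "l = m"
proof (rule ccontr)
  assume "l \<noteq> m"
  then have "\<forall>\<^sub>F y in at x within A. dist (f y) l < dist l m / 2 \<and> dist (g y) m < dist l m / 2"
    using f g by (intro eventually_conj tendstoD) auto
  then have "\<forall>\<^sub>F y in at x within A. f y \<noteq> g y"
    by eventually_elim (metis dist_commute dist_triangle_half_r less_irrefl)
  then obtain d where "d > 0" and d: "\<And>y. y \<in> A \<Longrightarrow> y \<noteq> x \<Longrightarrow> dist y x < d \<Longrightarrow> f y \<noteq> g y"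
    unfolding eventually_at by blast
  obtain s t where st: "a \<le> s" "s < t" "t \<le> b" "{s<..<t} \<subseteq> A \<inter> ball x d - {x}"
    using A[OF \<open>d > 0\<close>] by blast
  have "f y \<noteq> g y" if "y \<in> {s<..<t}" for y
  proof -
    have "y \<in> A \<inter> ball x d - {x}" using st(4) that by blast
    then show ?thesis using d[of y] by (auto simp: dist_commute)
  qed
  then have "AE y in lebesgue_on {a<..<b}. y \<notin> {s<..<t}"
    using ae by (auto elim!: eventually_mono)
  from AE_notin_interval[OF this] show False using st by simp
qed

lemma AE_lebesgue_on_tendsto_unique_right:
  fixes f g :: "real \<Rightarrow> real"
  assumes "AE x in lebesgue_on {a<..<b}. f x = g x" "a \<le> x" "x < b"
    and "(f \<longlongrightarrow> l) (at_right x)" "(g \<longlongrightarrow> m) (at_right x)"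
  shows "l = m"
proof (rule AE_lebesgue_on_tendsto_unique[OF assms(1) _ assms(4,5)])
  fix d :: real assume "d > 0"
  then show "\<exists>s t. a \<le> s \<and> s < t \<and> t \<le> b \<and> {s<..<t} \<subseteq> {x<..} \<inter> ball x d - {x}"
    using assms by (intro exI[of _ x] exI[of _ "min b (x + d)"]) (auto simp: dist_real_def)
qed

lemma AE_lebesgue_on_tendsto_unique_left:
  fixes f g :: "real \<Rightarrow> real"
  assumes "AE x in lebesgue_on {a<..<b}. f x = g x" "a < x" "x \<le> b"
    and "(f \<longlongrightarrow> l) (at_left x)" "(g \<longlongrightarrow> m) (at_left x)"
  shows "l = m"
proof (rule AE_lebesgue_on_tendsto_unique[OF assms(1) _ assms(4,5)])
  fix d :: real assume "d > 0"
  then show "\<exists>s t. a \<le> s \<and> s < t \<and> t \<le> b \<and> {s<..<t} \<subseteq> {..<x} \<inter> ball x d - {x}"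
    using assms by (intro exI[of _ "max a (x - d)"] exI[of _ x]) (auto simp: dist_real_def)
qed

lemma ae_eq_sym: "ae_eq a b u v \<Longrightarrow> ae_eq a b v u"
  unfolding ae_eq_def by (auto elim: eventually_mono)

lemma ae_eq_trans: "ae_eq a b u v \<Longrightarrow> ae_eq a b v w \<Longrightarrow> ae_eq a b u w"
  unfolding ae_eq_def by (elim AE_mp) (auto elim: eventually_mono)

definition primitive :: "real \<Rightarrow> real \<Rightarrow> real measure \<Rightarrow> real measure \<Rightarrow> real \<Rightarrow> real" where
  "primitive a c P N x = c + measure P {a<..x} - measure N {a<..x}"

lemma primitive_at_right:
  assumes "finite_borel_measure P" "finite_borel_measure N" "a \<le> x"
  shows "(primitive a c P N \<longlongrightarrow> primitive a c P N x) (at_right x)"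
  unfolding primitive_def using assms by (intro tendsto_intros Ioc_measure_at_right)

lemma primitive_at_left:
  assumes "finite_borel_measure P" "finite_borel_measure N" "a < x"
  shows "(primitive a c P N \<longlongrightarrow> primitive a c P N x - (measure P {x} - measure N {x})) (at_left x)"
proof -
  have "(primitive a c P N \<longlongrightarrow> c + (measure P {a<..x} - measure P {x}) - (measure N {a<..x} - measure N {x})) (at_left x)"
    unfolding primitive_def using assms by (intro tendsto_intros Ioc_measure_at_left)
  then show ?thesis by (simp add: primitive_def algebra_simps)
qed

text \<open>Primitives are right-continuous, so equality almost everywhere becomes equality at every
  point of \<open>[a,b)\<close>; at \<open>a\<close> it identifies the constants.\<close>

lemma signed_unique:
  assumes "a < b" and fin: "finite_borel_measure P" "finite_borel_measure N"
      "finite_borel_measure P'" "finite_borel_measure N'"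
    and eq: "AE x in lebesgue_on {a<..<b}. primitive a c P N x = primitive a c' P' N' x"
  shows "signed_on a b P N = signed_on a b P' N'"
proof
  fix E
  have val: "primitive a c P N x = primitive a c' P' N' x" if "a \<le> x" "x < b" for x
    using AE_lebesgue_on_tendsto_unique_right[OF eq that primitive_at_right primitive_at_right] fin that by blast
  from val[of a] have "c = c'" using assms(1) by (simp add: primitive_def)
  then have Ioc: "measure P {a<..x} + measure N' {a<..x} = measure P' {a<..x} + measure N {a<..x}"
    if "x \<in> {a<..<b}" for x
    using val[of x] that by (simp add: primitive_def)
  show "signed_on a b P N E = signed_on a b P' N' E"
  proof (cases "E \<in> sets borel \<and> E \<subseteq> {a<..<b}")
    case True
    then have "measure P E + measure N' E = measure P' E + measure N E"
      using finite_borel_cong_sum[OF assms(1) fin(1,4,3,2) Ioc] by blast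
    then show ?thesis using True fin by (simp add: signed_eq)
  qed (simp add: signed_eq_0 fin)
qed

lemma distr_deriv_eq_signed:
  assumes "a < b" "finite_borel_measure P" "finite_borel_measure N"
    and u: "integrable (lebesgue_on {a<..<b}) u" and eq: "ae_eq a b u (primitive a c P N)"
  shows "distr_deriv a b u = signed_on a b P N"
  unfolding distr_deriv_def
proof (rule the_equality)
  show "has_distr_deriv a b u (signed_on a b P N)"
    using has_distr_deriv_signed[OF assms(1-4)] eq by (simp add: ae_eq_def primitive_def)
  fix \<nu> assume "has_distr_deriv a b u \<nu>"
  then obtain c' P' N' where *: "finite_borel_measure P'" "finite_borel_measure N'" "\<nu> = signed_on a b P' N'"
    "AE x in lebesgue_on {a<..<b}. u x = c' + measure P' {a<..x} - measure N' {a<..x}"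
    using has_distr_deriv_imp_primitive[OF assms(1) u] by metis
  have "AE x in lebesgue_on {a<..<b}. primitive a c' P' N' x = primitive a c P N x"
    using *(4) eq unfolding ae_eq_def by eventually_elim (simp add: primitive_def)
  then show "\<nu> = signed_on a b P N"
    using signed_unique assms * by blast
qed

section \<open>One-sided limits, jump set and energy of a primitive\<close>

context
  fixes a b c u P N
  assumes ab: "a < b" and P: "finite_borel_measure P" and N: "finite_borel_measure N"
    and eq: "ae_eq a b u (primitive a c P N)"
begin

lemma has_right_lim_primitive:
  assumes "x \<in> {a<..<b}"
  shows "has_right_lim a b u x r \<longleftrightarrow> r = primitive a c P N x"
proof
  assume "has_right_lim a b u x r"
  then obtain v where v: "ae_eq a b v u" "(v \<longlongrightarrow> r) (at_right x)" by (auto simp: has_right_lim_def)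
  have "ae_eq a b v (primitive a c P N)" using v(1) eq by (rule ae_eq_trans)
  then show "r = primitive a c P N x"
    unfolding ae_eq_def
    using AE_lebesgue_on_tendsto_unique_right v(2) primitive_at_right[OF P N] assms by (metis greaterThanLessThan_iff less_imp_le)
next
  assume "r = primitive a c P N x"
  then show "has_right_lim a b u x r"
    unfolding has_right_lim_def using primitive_at_right[OF P N] assms ae_eq_sym[OF eq]
    by (intro exI[of _ "primitive a c P N"]) auto
qed

lemma has_left_lim_primitive:
  assumes "x \<in> {a<..<b}"
  shows "has_left_lim a b u x l \<longleftrightarrow> l = primitive a c P N x - (measure P {x} - measure N {x})"
proof
  assume "has_left_lim a b u x l"
  then obtain v where v: "ae_eq a b v u" "(v \<longlongrightarrow> l) (at_left x)" by (auto simp: has_left_lim_def)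
  have "ae_eq a b v (primitive a c P N)" using v(1) eq by (rule ae_eq_trans)
  then show "l = primitive a c P N x - (measure P {x} - measure N {x})"
    unfolding ae_eq_def
    using AE_lebesgue_on_tendsto_unique_left v(2) primitive_at_left[OF P N] assms by (metis greaterThanLessThan_iff less_imp_le)
next
  assume "l = primitive a c P N x - (measure P {x} - measure N {x})"
  then show "has_left_lim a b u x l"
    unfolding has_left_lim_def using primitive_at_left[OF P N] assms ae_eq_sym[OF eq]
    by (intro exI[of _ "primitive a c P N"]) auto
qed

lemma jump_set_primitive: "jump_set a b u = {x \<in> {a<..<b}. measure P {x} \<noteq> measure N {x}}"
  unfolding jump_set_def by (auto simp: has_right_lim_primitive has_left_lim_primitive)

lemma TV_K_primitive:
  assumes u: "integrable (lebesgue_on {a<..<b}) u"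
  shows "TV_K K a b u =
    total_variation (\<lambda>E. measure P E - measure N E) ({a<..<b} - jump_set a b u)
    + (\<Sum>\<^sub>\<infinity>x\<in>jump_set a b u. ennreal (K \<bar>measure P {x} - measure N {x}\<bar>))"
proof -
  have "right_lim a b u x - left_lim a b u x = measure P {x} - measure N {x}" if "x \<in> jump_set a b u" for x
  proof -
    have "x \<in> {a<..<b}" using that by (simp add: jump_set_def)
    then show ?thesis
      by (simp add: right_lim_def left_lim_def has_right_lim_primitive has_left_lim_primitive)
  qed
  then have "(\<Sum>\<^sub>\<infinity>x\<in>jump_set a b u. ennreal (K \<bar>right_lim a b u x - left_lim a b u x\<bar>))
     = (\<Sum>\<^sub>\<infinity>x\<in>jump_set a b u. ennreal (K \<bar>measure P {x} - measure N {x}\<bar>))"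
    by (intro infsum_cong) simp
  moreover have "total_variation (signed_on a b P N) B = total_variation (\<lambda>E. measure P E - measure N E) B"
    if B: "B \<subseteq> {a<..<b}" for B
    unfolding total_variation_def
  proof (rule SUP_cong[OF refl])
    fix E :: "nat \<Rightarrow> real set"
    assume "E \<in> {E. range E \<subseteq> sets borel \<and> disjoint_family E \<and> \<Union> (range E) = B}"
    then have "E n \<in> sets borel" "E n \<subseteq> {a<..<b}" for n using B by auto
    then show "(\<Sum>n. ennreal \<bar>signed_on a b P N (E n)\<bar>) = (\<Sum>n. ennreal \<bar>measure P (E n) - measure N (E n)\<bar>)"
      by (simp add: signed_eq P N)
  qed
  moreover have "distr_deriv a b u = signed_on a b P N"
    using distr_deriv_eq_signed[OF ab P N u eq] .
  ultimately show ?thesis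
    by (simp add: TV_K_def)
qed

end

text \<open>For the variation \<open>\<mu>\<close> of a derivative this is \<open>TV_K\<close>
  localized to \<open>E\<close>. Because \<open>K 0 = 0\<close>, summing over all points of
  \<open>E\<close> counts only the atoms; no jump set is mentioned, and the expression is additive
  over disjoint Borel sets.\<close>

definition jump_energy :: "(real \<Rightarrow> real) \<Rightarrow> real measure \<Rightarrow> real set \<Rightarrow> ennreal" where
  "jump_energy K \<mu> E = emeasure \<mu> {x \<in> E. measure \<mu> {x} = 0} + (\<Sum>\<^sub>\<infinity>x\<in>E. ennreal (K (measure \<mu> {x})))"

lemma nonatoms_borel:
  assumes "finite_borel_measure \<mu>" "E \<in> sets borel"
  shows "{x \<in> E. measure \<mu> {x} = 0} \<in> sets borel"
proof -
  have "{x \<in> E. measure \<mu> {x} = 0} = E - {x. measure \<mu> {x} \<noteq> 0}" by auto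
  moreover have "{x. measure \<mu> {x} \<noteq> 0} \<in> sets borel"
    by (rule sets.countable[OF _ countable_atoms[OF assms(1)]]) simp
  ultimately show ?thesis using assms(2) by auto
qed

lemma jump_energy_le_TV_K:
  assumes "a < b" and P: "finite_borel_measure P" and N: "finite_borel_measure N"
    and u: "integrable (lebesgue_on {a<..<b}) u"
    and eq: "ae_eq a b u (primitive a c P N)"
    and \<mu>: "finite_borel_measure \<mu>" and "K 0 = 0"
    and atoms: "\<And>x. measure \<mu> {x} = \<bar>measure P {x} - measure N {x}\<bar>"
    and le: "\<And>B. B \<in> sets borel \<Longrightarrow> ennreal (measure \<mu> B) \<le> total_variation (\<lambda>E. measure P E - measure N E) B"
  shows "jump_energy K \<mu> {a<..<b} \<le> TV_K K a b u"
proof -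
  note J = jump_set_primitive[OF assms(1) P N eq]
  have *: "{x \<in> {a<..<b}. measure \<mu> {x} = 0} = {a<..<b} - jump_set a b u"
    unfolding J atoms by auto
  have "(\<Sum>\<^sub>\<infinity>x\<in>{a<..<b}. ennreal (K (measure \<mu> {x})))
      = (\<Sum>\<^sub>\<infinity>x\<in>jump_set a b u. ennreal (K \<bar>measure P {x} - measure N {x}\<bar>))"
    unfolding J atoms using \<open>K 0 = 0\<close> by (intro infsum_cong_neutral) auto
  then show ?thesis
    unfolding TV_K_primitive[OF assms(1) P N eq u] jump_energy_def *
    using le[OF nonatoms_borel[OF \<mu>, of "{a<..<b}"]] unfolding *
    by (intro add_mono) (auto simp: finite_borel_emeasure[OF \<mu>])
qed

lemma BV_primitive:
  assumes "a < b" "u \<in> BV a b"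
  obtains c P N \<mu> where "finite_borel_measure P" "finite_borel_measure N" "finite_borel_measure \<mu>"
    "ae_eq a b (primitive a c P N) u"
    "\<And>E. \<bar>measure P E - measure N E\<bar> \<le> measure \<mu> E"
    "\<And>K. K 0 = 0 \<Longrightarrow> jump_energy K \<mu> {a<..<b} \<le> TV_K K a b u"
proof -
  have u: "integrable (lebesgue_on {a<..<b}) u" using assms by (simp add: BV_def)
  obtain \<nu> where "has_distr_deriv a b u \<nu>" using assms by (auto simp: BV_def)
  then obtain c P N where P: "finite_borel_measure P" and N: "finite_borel_measure N"
    and "AE x in lebesgue_on {a<..<b}. u x = c + measure P {a<..x} - measure N {a<..x}"
    using has_distr_deriv_imp_primitive[OF assms(1) u] by metis
  then have eq: "ae_eq a b u (primitive a c P N)" by (simp add: ae_eq_def primitive_def)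
  obtain \<mu> where \<mu>: "finite_borel_measure \<mu>"
    "\<And>E. \<bar>measure P E - measure N E\<bar> \<le> measure \<mu> E"
    "\<And>x. measure \<mu> {x} = \<bar>measure P {x} - measure N {x}\<bar>"
    "\<And>B. B \<in> sets borel \<Longrightarrow> ennreal (measure \<mu> B) \<le> total_variation (\<lambda>E. measure P E - measure N E) B"
    using Hahn_variation[OF P N] by blast
  have "jump_energy K \<mu> {a<..<b} \<le> TV_K K a b u" if "K 0 = 0" for K
    by (rule jump_energy_le_TV_K[where K=K, OF assms(1) P N u eq \<mu>(1) that \<mu>(3)]) (rule \<mu>(4))
  then show thesis
    using that[OF P N \<mu>(1) ae_eq_sym[OF eq] \<mu>(2)] by blast
qed

section \<open>Functions whose increments are dominated by a measure\<close>

lemma Stieltjes_measure: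
  fixes f :: "real \<Rightarrow> real"
  assumes "a < b" and mono: "mono_on {a<..<b} f"
    and right: "\<And>x. x \<in> {a<..<b} \<Longrightarrow> (f \<longlongrightarrow> f x) (at_right x)"
    and bdd: "\<And>x. x \<in> {a<..<b} \<Longrightarrow> \<bar>f x\<bar> \<le> B"
  obtains c P where "finite_borel_measure P" "\<And>x. x \<in> {a<..<b} \<Longrightarrow> f x = c + measure P {a<..x}"
proof -
  define L where "L = Inf (f ` {a<..<b})"
  define R where "R = Sup (f ` {a<..<b})"
  \<comment> \<open>Extension by infimum and supremum keeps \<open>F\<close> monotone on the whole
    line, and right-continuous at \<open>a\<close>, where the infimum is the right limit of
    \<open>f\<close>.\<close>
  define F where "F x = (if x \<le> a then L else if x < b then f x else R)" for x
  have "bdd_below (f ` {a<..<b})" "bdd_above (f ` {a<..<b})"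
    using bdd by (auto intro!: bdd_belowI[where m="-B"] bdd_aboveI[where M=B] simp: abs_le_iff minus_le_iff)
  then have L: "L \<le> f x" and R: "f x \<le> R" if "x \<in> {a<..<b}" for x
    unfolding L_def R_def using that by (auto intro: cInf_lower cSup_upper)
  have "L \<le> R"
    using L R assms(1) by (meson dense greaterThanLessThan_iff order_trans)
  have monoF: "F x \<le> F y" if "x \<le> y" for x y
    using that L R mono_onD[OF mono, of x y] \<open>L \<le> R\<close> by (auto simp: F_def)
  have rightF: "continuous (at_right x) F" for x
    unfolding continuous_within
  proof -
    consider "x < a" | "x = a" | "x \<in> {a<..<b}" | "b \<le> x" by force
    then show "(F \<longlongrightarrow> F x) (at_right x)"
    proof cases
      case 1
      then have "\<forall>\<^sub>F y in at_right x. F y = F x"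
        by (auto simp: eventually_at_right F_def)
      then show ?thesis by (rule tendsto_eventually)
    next
      case 2
      have "(F \<longlongrightarrow> L) (at_right a)"
      proof (rule order_tendstoI)
        fix l assume "l < L"
        show "\<forall>\<^sub>F y in at_right a. l < F y"
        proof (rule eventually_mono[OF eventually_at_right_less[of a]])
          fix y assume "a < y"
          then have "F a \<le> F y" using monoF[of a y] by simp
          moreover have "F a = L" by (simp add: F_def)
          ultimately show "l < F y" using \<open>l < L\<close> by linarith
        qed
      next
        fix l assume "L < l"
        then obtain y where y: "y \<in> {a<..<b}" "f y < l"
          unfolding L_def using cInf_lessD[of "f ` {a<..<b}" l] assms(1) by (auto simp: image_iff)
        have "F z < l" if "a < z" "z < y" for z
          using mono_onD[OF mono, of z y] y that by (auto simp: F_def)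
        then show "\<forall>\<^sub>F z in at_right a. F z < l"
          using y(1) by (auto simp: eventually_at_right_field)
      qed
      with 2 show ?thesis by (simp add: F_def)
    next
      case 3
      then have "\<forall>\<^sub>F y in at_right x. f y = F y"
        by (auto simp: eventually_at_right_field F_def intro!: exI[of _ b])
      with right[OF 3] have "(F \<longlongrightarrow> f x) (at_right x)"
        by (rule Lim_transform_eventually)
      moreover have "F x = f x" using 3 by (simp add: F_def)
      ultimately show ?thesis by simp
    next
      case 4
      then have "\<forall>\<^sub>F y in at_right x. F y = F x"
        using assms(1) by (auto simp: eventually_at_right_field F_def intro!: exI[of _ "x + 1"])
      then show ?thesis by (rule tendsto_eventually)
    qed
  qed
  let ?I = "interval_measure F"
  \<comment> \<open>Cutting down to \<open>(a,b]\<close> reduces finiteness to the single value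
    \<open>F b - F a\<close>.\<close>
  define P where "P = density ?I (indicator {a<..b})"
  have e: "emeasure P E = emeasure ?I ({a<..b} \<inter> E)" if "E \<in> sets borel" for E
    unfolding P_def using that by (subst emeasure_restricted) auto
  have I: "emeasure ?I {a<..x} = ennreal (F x - F a)" if "a \<le> x" for x
    using emeasure_interval_measure_Ioc[OF that monoF rightF] .
  have "emeasure P UNIV \<noteq> \<infinity>"
    using e[of UNIV] I[of b] assms(1) by simp
  then have "finite_borel_measure P"
    by (auto simp: finite_borel_measure_iff P_def intro!: finite_measureI)
  moreover have "f x = L + measure P {a<..x}" if "x \<in> {a<..<b}" for x
  proof -
    have "{a<..b} \<inter> {a<..x} = {a<..x}" using that by auto
    then have "emeasure P {a<..x} = ennreal (F x - F a)"
      using e[of "{a<..x}"] I[of x] that by simp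
    then show ?thesis
      using that L[OF that] by (simp add: measure_def F_def)
  qed
  ultimately show thesis by (rule that)
qed

lemma measure_countable_cong:
  assumes "finite_borel_measure M" "finite_borel_measure N" "countable X"
    and "\<And>x. x \<in> X \<Longrightarrow> measure M {x} = measure N {x}"
  shows "measure M X = measure N X"
proof -
  have "emeasure M X = (\<integral>\<^sup>+x. emeasure M {x} \<partial>count_space X)"
    using assms by (intro emeasure_countable_singleton) (auto simp: finite_borelD(1))
  also have "\<dots> = (\<integral>\<^sup>+x. emeasure N {x} \<partial>count_space X)"
    using assms by (intro nn_integral_cong) (simp add: finite_borel_emeasure)
  also have "\<dots> = emeasure N X"
    using assms by (intro emeasure_countable_singleton[symmetric]) (auto simp: finite_borelD(1))
  finally show ?thesis by (simp add: measure_def)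
qed

lemma dominated_at_right:
  fixes w :: "real \<Rightarrow> real"
  assumes \<mu>: "finite_borel_measure \<mu>" and x: "a < x" "x < b"
    and dom: "\<And>x y. a < x \<Longrightarrow> x \<le> y \<Longrightarrow> y < b \<Longrightarrow> \<bar>w y - w x\<bar> \<le> measure \<mu> {x<..y}"
  shows "(w \<longlongrightarrow> w x) (at_right x)"
proof (rule LIM_zero_cancel)
  have "((\<lambda>y. measure \<mu> {x<..y}) \<longlongrightarrow> 0) (at_right x)"
    using Ioc_measure_at_right[OF \<mu> order_refl, of x] by simp
  moreover have "\<forall>\<^sub>F y in at_right x. norm (w y - w x) \<le> measure \<mu> {x<..y}"
    using dom[of x] x by (auto simp: eventually_at_right_field intro!: exI[of _ b])
  ultimately show "((\<lambda>y. w y - w x) \<longlongrightarrow> 0) (at_right x)"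
    by (rule Lim_null_comparison[rotated])
qed

text \<open>Jordan decomposition against a prescribed measure: with \<open>T\<close> the
  distribution function of \<open>\<mu>\<close>, domination makes \<open>(T + w) / 2\<close> and
  \<open>(T - w) / 2\<close> non-decreasing, and their measures add up to \<open>\<mu>\<close> on
  the interval.\<close>

lemma dominated_primitive:
  assumes "a < b" and \<mu>: "finite_borel_measure \<mu>"
    and dom: "\<And>x y. a < x \<Longrightarrow> x \<le> y \<Longrightarrow> y < b \<Longrightarrow> \<bar>w y - w x\<bar> \<le> measure \<mu> {x<..y}"
  shows "\<exists>c P N. finite_borel_measure P \<and> finite_borel_measure N \<and>
    (\<forall>x\<in>{a<..<b}. w x = primitive a c P N x) \<and>
    (\<forall>E\<in>sets borel. E \<subseteq> {a<..<b} \<longrightarrow> measure P E + measure N E = measure \<mu> E)"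
proof -
  define T where "T x = measure \<mu> {a<..x}" for x
  have T: "measure \<mu> {x<..y} = T y - T x" if "a < x" "x \<le> y" for x y
    using finite_borel_Ioc[OF \<mu>, of a x y] that by (simp add: T_def)
  have Tlim: "(T \<longlongrightarrow> T x) (at_right x)" if "a \<le> x" for x
    unfolding T_def using Ioc_measure_at_right[OF \<mu> that] .
  have wright: "(w \<longlongrightarrow> w x) (at_right x)" if x: "x \<in> {a<..<b}" for x
    by (rule dominated_at_right[OF \<mu>, of a x b]) (use x dom in auto)
  define m where "m = (a + b) / 2"
  have m: "m \<in> {a<..<b}" using assms(1) by (auto simp: m_def)
  define B where "B = \<bar>w m\<bar> + 2 * measure \<mu> UNIV"
  have bddT: "0 \<le> T x" "T x \<le> measure \<mu> UNIV" for x
    unfolding T_def using finite_borel_mono[OF \<mu>] by auto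
  have bdd: "\<bar>w x\<bar> + T x \<le> B" if x: "x \<in> {a<..<b}" for x
  proof -
    have "\<bar>w x - w m\<bar> \<le> measure \<mu> UNIV"
    proof (cases "x \<le> m")
      case True
      then show ?thesis
        using dom[of x m] x m finite_borel_mono[OF \<mu>, of "{x<..m}" UNIV] by auto
    next
      case False
      then show ?thesis
        using dom[of m x] x m finite_borel_mono[OF \<mu>, of "{m<..x}" UNIV] by auto
    qed
    then show ?thesis using bddT(2)[of x] by (auto simp: B_def)
  qed
  obtain c1 P where P: "finite_borel_measure P" "\<And>x. x \<in> {a<..<b} \<Longrightarrow> (T x + w x) / 2 = c1 + measure P {a<..x}"
  proof (rule Stieltjes_measure[OF assms(1), of "\<lambda>x. (T x + w x) / 2" B])
    show "mono_on {a<..<b} (\<lambda>x. (T x + w x) / 2)"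
    proof (rule mono_onI)
      fix x y assume "x \<in> {a<..<b}" "y \<in> {a<..<b}" "x \<le> y"
      then show "(T x + w x) / 2 \<le> (T y + w y) / 2" using dom[of x y] T[of x y] by auto
    qed
    show "((\<lambda>x. (T x + w x) / 2) \<longlongrightarrow> (T x + w x) / 2) (at_right x)" if "x \<in> {a<..<b}" for x
      using that by (intro tendsto_intros Tlim wright) auto
    show "\<bar>(T x + w x) / 2\<bar> \<le> B" if "x \<in> {a<..<b}" for x
      using bdd[OF that] bddT[of x] by auto
  qed (use that in auto)
  obtain c2 N where N: "finite_borel_measure N" "\<And>x. x \<in> {a<..<b} \<Longrightarrow> (T x - w x) / 2 = c2 + measure N {a<..x}"
  proof (rule Stieltjes_measure[OF assms(1), of "\<lambda>x. (T x - w x) / 2" B])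
    show "mono_on {a<..<b} (\<lambda>x. (T x - w x) / 2)"
    proof (rule mono_onI)
      fix x y assume "x \<in> {a<..<b}" "y \<in> {a<..<b}" "x \<le> y"
      then show "(T x - w x) / 2 \<le> (T y - w y) / 2" using dom[of x y] T[of x y] by auto
    qed
    show "((\<lambda>x. (T x - w x) / 2) \<longlongrightarrow> (T x - w x) / 2) (at_right x)" if "x \<in> {a<..<b}" for x
      using that by (intro tendsto_intros Tlim wright) auto
    show "\<bar>(T x - w x) / 2\<bar> \<le> B" if "x \<in> {a<..<b}" for x
      using bdd[OF that] bddT[of x] by auto
  qed (use that in auto)
  have sum: "T x = (c1 + c2) + (measure P {a<..x} + measure N {a<..x})" if "x \<in> {a<..<b}" for x
    using P(2)[OF that] N(2)[OF that] by (simp add: field_simps)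
  \<comment> \<open>Letting \<open>x\<close> tend to \<open>a\<close> in \<open>sum\<close> leaves
    \<open>c1 + c2 = T a = 0\<close>.\<close>
  have "((\<lambda>x. T x - (measure P {a<..x} + measure N {a<..x})) \<longlongrightarrow> T a - (measure P {a<..a} + measure N {a<..a})) (at_right a)"
    by (intro tendsto_intros Tlim Ioc_measure_at_right P N) auto
  moreover have "\<forall>\<^sub>F x in at_right a. T x - (measure P {a<..x} + measure N {a<..x}) = c1 + c2"
    using sum assms(1) by (auto simp: eventually_at_right_field intro!: exI[of _ b])
  ultimately have "((\<lambda>x. c1 + c2) \<longlongrightarrow> T a - (measure P {a<..a} + measure N {a<..a})) (at_right a)"
    by (rule Lim_transform_eventually)
  then have c: "c1 + c2 = 0"
    by (simp add: tendsto_const_iff T_def)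
  show ?thesis
  proof (intro exI conjI ballI impI)
    show "finite_borel_measure P" "finite_borel_measure N" using P N by auto
    show "w x = primitive a (c1 - c2) P N x" if "x \<in> {a<..<b}" for x
      using P(2)[OF that] N(2)[OF that] by (simp add: primitive_def field_simps)
    obtain S where S: "finite_borel_measure S" "\<And>E. measure S E = measure P E + measure N E"
      using finite_borel_sum[OF P(1) N(1)] by blast
    show "measure P E + measure N E = measure \<mu> E" if "E \<in> sets borel" "E \<subseteq> {a<..<b}" for E
      using finite_borel_cong[OF assms(1) S(1) \<mu> _ that] sum c unfolding S(2) T_def by auto
  qed
qed

lemma borel_measurable_primitive:
  assumes "finite_borel_measure P" "finite_borel_measure N"
  shows "primitive a c P N \<in> borel_measurable borel"
  unfolding primitive_def
  using borel_measurable_Ioc_measure[OF assms(1)] borel_measurable_Ioc_measure[OF assms(2)] by auto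

lemma integrable_primitive:
  assumes P: "finite_borel_measure P" and N: "finite_borel_measure N"
  shows "integrable (lebesgue_on {a<..<b}) (primitive a c P N)"
proof (rule integrable_lebesgue_on_bounded)
  show "\<bar>primitive a c P N x\<bar> \<le> \<bar>c\<bar> + measure P UNIV + measure N UNIV" for x
    unfolding primitive_def
    using finite_borel_mono[OF P, of "{a<..x}" UNIV, simplified] finite_borel_mono[OF N, of "{a<..x}" UNIV, simplified]
      measure_nonneg[of P "{a<..x}"] measure_nonneg[of N "{a<..x}"] by linarith
qed (rule borel_measurable_primitive[OF assms])

text \<open>At an atom of \<open>\<mu>\<close> that is no jump of \<open>w\<close>, \<open>P\<close>
  and \<open>N\<close> have equal mass and cancel in the derivative. Away from the atoms the
  derivative is at most \<open>\<mu>\<close>, and each jump is at most the atom of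
  \<open>\<mu>\<close> there, so monotonicity of \<open>K\<close> applies.\<close>

lemma dominated_BV:
  assumes "a < b" and \<mu>: "finite_borel_measure \<mu>"
    and dom: "\<And>x y. a < x \<Longrightarrow> x \<le> y \<Longrightarrow> y < b \<Longrightarrow> \<bar>w y - w x\<bar> \<le> measure \<mu> {x<..y}"
    and K: "mono_on {0..} K" "\<And>r. 0 \<le> r \<Longrightarrow> 0 \<le> K r"
  shows "w \<in> BV a b" and "TV_K K a b w \<le> jump_energy K \<mu> {a<..<b}"
proof -
  obtain c P N where P: "finite_borel_measure P" and N: "finite_borel_measure N"
    and w: "\<And>x. x \<in> {a<..<b} \<Longrightarrow> w x = primitive a c P N x"
    and sum: "\<And>E. E \<in> sets borel \<Longrightarrow> E \<subseteq> {a<..<b} \<Longrightarrow> measure P E + measure N E = measure \<mu> E"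
    using dominated_primitive[where w=w, OF assms(1) \<mu> dom] by auto
  have int: "integrable (lebesgue_on {a<..<b}) w"
    using integrable_primitive[OF P N] by (rule Bochner_Integration.integrable_cong[THEN iffD1, rotated 2])
      (auto simp: w)
  have eq: "ae_eq a b w (primitive a c P N)"
    unfolding ae_eq_def using w by (intro AE_I2) auto
  show "w \<in> BV a b"
  proof -
    have "has_distr_deriv a b w (signed_on a b P N)"
      using has_distr_deriv_signed[OF assms(1) P N int, of c] eq by (simp add: ae_eq_def primitive_def)
    with int show ?thesis unfolding BV_def by blast
  qed
  note J = jump_set_primitive[OF assms(1) P N eq]
  define A where "A = {x. measure \<mu> {x} \<noteq> 0}"
  have "countable A" unfolding A_def by (rule countable_atoms[OF \<mu>])
  then have A: "A \<in> sets borel" by (rule sets.countable[rotated]) simp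
  have JA: "jump_set a b w \<subseteq> A"
  proof
    fix x assume "x \<in> jump_set a b w"
    then have "x \<in> {a<..<b}" "measure P {x} \<noteq> measure N {x}" by (auto simp: J)
    moreover from this have "measure P {x} + measure N {x} = measure \<mu> {x}"
      by (intro sum) auto
    ultimately have "measure \<mu> {x} \<noteq> 0"
      using measure_nonneg[of P "{x}"] measure_nonneg[of N "{x}"] by linarith
    then show "x \<in> A" by (simp add: A_def)
  qed
  have JB: "jump_set a b w \<in> sets borel"
    using countable_subset[OF JA \<open>countable A\<close>] by (rule sets.countable[rotated]) simp
  obtain \<mu>' where \<mu>': "finite_borel_measure \<mu>'" "\<And>E. E \<in> sets borel \<Longrightarrow> measure \<mu>' E = measure \<mu> (E \<inter> - A)"
    using finite_borel_restrict[OF \<mu>, of "- A"] A by auto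
  have "total_variation (\<lambda>E. measure P E - measure N E) ({a<..<b} - jump_set a b w)
    \<le> ennreal (measure \<mu>' ({a<..<b} - jump_set a b w))"
  proof (rule total_variation_le[OF \<mu>'(1)])
    show "{a<..<b} - jump_set a b w \<in> sets borel" using JB by auto
    fix E :: "real set" assume E: "E \<in> sets borel" "E \<subseteq> {a<..<b} - jump_set a b w"
    have "measure P (E \<inter> A) = measure N (E \<inter> A)"
    proof (rule measure_countable_cong[OF P N])
      show "countable (E \<inter> A)" using \<open>countable A\<close> by (rule countable_subset[rotated]) auto
      show "measure P {x} = measure N {x}" if "x \<in> E \<inter> A" for x
        using that E(2) by (auto simp: J)
    qed
    moreover have "measure P E = measure P (E \<inter> A) + measure P (E \<inter> - A)"
      "measure N E = measure N (E \<inter> A) + measure N (E \<inter> - A)"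
      using E(1) A finite_borel_Un[OF P, of "E \<inter> A" "E \<inter> - A"] finite_borel_Un[OF N, of "E \<inter> A" "E \<inter> - A"]
      by (auto simp: Int_Un_distrib[symmetric])
    moreover have "measure P (E \<inter> - A) + measure N (E \<inter> - A) = measure \<mu>' E"
      using sum[of "E \<inter> - A"] E A by (auto simp: \<mu>'(2))
    ultimately show "\<bar>measure P E - measure N E\<bar> \<le> measure \<mu>' E"
      using measure_nonneg[of P "E \<inter> - A"] measure_nonneg[of N "E \<inter> - A"] by linarith
  qed
  also have "measure \<mu>' ({a<..<b} - jump_set a b w) = measure \<mu> {x \<in> {a<..<b}. measure \<mu> {x} = 0}"
  proof -
    have "({a<..<b} - jump_set a b w) \<inter> - A = {x \<in> {a<..<b}. measure \<mu> {x} = 0}"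
      using JA by (auto simp: A_def)
    then show ?thesis using JB by (subst \<mu>'(2)) auto
  qed
  finally have 1: "total_variation (\<lambda>E. measure P E - measure N E) ({a<..<b} - jump_set a b w)
    \<le> emeasure \<mu> {x \<in> {a<..<b}. measure \<mu> {x} = 0}"
    by (simp add: finite_borel_emeasure[OF \<mu>])
  have 2: "(\<Sum>\<^sub>\<infinity>x\<in>jump_set a b w. ennreal (K \<bar>measure P {x} - measure N {x}\<bar>))
    \<le> (\<Sum>\<^sub>\<infinity>x\<in>{a<..<b}. ennreal (K (measure \<mu> {x})))"
  proof (rule infsum_mono_neutral)
    fix x assume "x \<in> jump_set a b w \<inter> {a<..<b}"
    then have "measure P {x} + measure N {x} = measure \<mu> {x}"
      by (intro sum) auto
    then have "\<bar>measure P {x} - measure N {x}\<bar> \<le> measure \<mu> {x}"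
      using measure_nonneg[of P "{x}"] measure_nonneg[of N "{x}"] by linarith
    then show "ennreal (K \<bar>measure P {x} - measure N {x}\<bar>) \<le> ennreal (K (measure \<mu> {x}))"
      by (intro ennreal_leI mono_onD[OF K(1)]) auto
  qed (auto simp: J intro!: nonneg_summable_on_complete)
  show "TV_K K a b w \<le> jump_energy K \<mu> {a<..<b}"
    unfolding TV_K_primitive[OF assms(1) P N eq int] jump_energy_def using add_mono[OF 1 2] .
qed

section \<open>Consequences of (K2) and (K3) for the cost\<close>

lemma K_subadditive:
  assumes "K2 K" "0 \<le> r" "0 \<le> s"
  shows "K (r + s) \<le> K r + K s"
proof -
  \<comment> \<open>The bound in (K2) has to be positive, also when \<open>r\<close> and
    \<open>s\<close> both vanish; hence the added 1.\<close>
  have "0 < r + s + 1" using assms(2,3) by simp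
  with assms(1) obtain C where "K2_const K (r + s + 1) C" unfolding K2_def by blast
  then have "C > 0" "K (r + s) + C * r * s \<le> K r + K s"
    using assms(2,3) by (auto simp: K2_const_def)
  moreover have "0 \<le> C * r * s" using \<open>C > 0\<close> assms(2,3) by simp
  ultimately show ?thesis by linarith
qed

lemma K_multiple_le:
  assumes "K1 K" "K2 K" "0 \<le> r"
  shows "K (real n * r) \<le> real n * K r"
proof (induction n)
  case 0
  then show ?case using assms(1) by (simp add: K1_def)
next
  case (Suc n)
  have "K (real n * r + r) \<le> K (real n * r) + K r"
    using assms by (intro K_subadditive) auto
  then show ?case using Suc by (simp add: algebra_simps)
qed

text \<open>Subdividing a jump \<open>r\<close> into \<open>n + 1\<close> equal ones costs at least
  \<open>K r\<close> by subadditivity, and by (K3) the total cost tends to \<open>r\<close>.\<close>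

lemma K_le_id:
  assumes "K1 K" "K2 K" "K3 K" "0 \<le> r"
  shows "K r \<le> r"
proof (cases "r = 0")
  case True
  then show ?thesis using assms(1) by (simp add: K1_def)
next
  case False
  then have r: "r > 0" using assms by simp
  define x where "x n = r * inverse (real (Suc n))" for n
  have "x \<longlonglongrightarrow> r * 0"
    unfolding x_def by (intro tendsto_intros LIMSEQ_inverse_real_of_nat)
  moreover have "x n > 0" for n using r by (simp add: x_def)
  ultimately have "filterlim x (at_right 0) sequentially"
    by (intro tendsto_imp_filterlim_at_right) auto
  then have "(\<lambda>n. K (x n) / x n) \<longlonglongrightarrow> 1"
    using assms(3) filterlim_compose unfolding K3_def by blast
  then have "(\<lambda>n. r * (K (x n) / x n)) \<longlonglongrightarrow> r * 1"
    by (intro tendsto_intros)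
  moreover have "K r \<le> r * (K (x n) / x n)" for n
  proof -
    have "K (real (Suc n) * x n) \<le> real (Suc n) * K (x n)"
      using assms \<open>x n > 0\<close> by (intro K_multiple_le) auto
    moreover have "real (Suc n) * x n = r" by (simp add: x_def del: of_nat_Suc)
    moreover have "real (Suc n) * K (x n) = r * (K (x n) / x n)"
      using r by (simp add: x_def field_simps del: of_nat_Suc)
    ultimately show ?thesis by simp
  qed
  ultimately show ?thesis
    by (intro LIMSEQ_le_const[of "\<lambda>n. r * (K (x n) / x n)"]) auto
qed

section \<open>The jump energy of a measure\<close>

lemma jump_energy_Un:
  assumes \<mu>: "finite_borel_measure \<mu>" and E: "E \<in> sets borel" and F: "F \<in> sets borel" and disj: "E \<inter> F = {}"
  shows "jump_energy K \<mu> (E \<union> F) = jump_energy K \<mu> E + jump_energy K \<mu> F"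
proof -
  have "emeasure \<mu> {x \<in> E \<union> F. measure \<mu> {x} = 0}
      = emeasure \<mu> {x \<in> E. measure \<mu> {x} = 0} + emeasure \<mu> {x \<in> F. measure \<mu> {x} = 0}"
    using nonatoms_borel[OF \<mu> E] nonatoms_borel[OF \<mu> F] disj
    by (subst plus_emeasure) (auto simp: finite_borelD(1)[OF \<mu>] intro!: arg_cong[where f="emeasure \<mu>"])
  then show ?thesis
    unfolding jump_energy_def
    by (subst infsum_Un_disjoint[OF _ _ disj]) (auto intro: nonneg_summable_on_complete simp: add_ac)
qed

lemma jump_energy_restrict:
  assumes "finite_borel_measure \<mu>" and \<nu>: "finite_borel_measure \<nu>"
    and \<nu>_eq: "\<And>E. E \<in> sets borel \<Longrightarrow> measure \<nu> E = measure \<mu> (E \<inter> A)"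
    and A: "A \<in> sets borel" and B: "B \<in> sets borel" and "K 0 = 0"
  shows "jump_energy K \<nu> B = jump_energy K \<mu> (B \<inter> A)"
proof -
  have at: "measure \<nu> {x} = (if x \<in> A then measure \<mu> {x} else 0)" for x
    by (simp add: \<nu>_eq)
  have "emeasure \<nu> {x \<in> B. measure \<nu> {x} = 0} = emeasure \<mu> ({x \<in> B. measure \<nu> {x} = 0} \<inter> A)"
    using \<nu>_eq[OF nonatoms_borel[OF \<nu> B]] assms by (simp add: finite_borel_emeasure)
  also have "{x \<in> B. measure \<nu> {x} = 0} \<inter> A = {x \<in> B \<inter> A. measure \<mu> {x} = 0}"
    by (auto simp: at)
  finally have "emeasure \<nu> {x \<in> B. measure \<nu> {x} = 0} = emeasure \<mu> {x \<in> B \<inter> A. measure \<mu> {x} = 0}" .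
  moreover have "(\<Sum>\<^sub>\<infinity>x\<in>B. ennreal (K (measure \<nu> {x}))) = (\<Sum>\<^sub>\<infinity>x\<in>B \<inter> A. ennreal (K (measure \<mu> {x})))"
    using \<open>K 0 = 0\<close> by (intro infsum_cong_neutral) (auto simp: at)
  ultimately show ?thesis by (simp add: jump_energy_def)
qed

lemma jump_energy_dirac:
  assumes \<nu>: "finite_borel_measure \<nu>" and \<nu>_eq: "\<And>E. E \<in> sets borel \<Longrightarrow> measure \<nu> E = r * indicator E \<theta>"
    and B: "B \<in> sets borel" and "K 0 = 0"
  shows "jump_energy K \<nu> B \<le> ennreal (K r)"
proof -
  have at: "measure \<nu> {x} = (if x = \<theta> then r else 0)" for x
    by (simp add: \<nu>_eq indicator_def)
  have "measure \<nu> {x \<in> B. measure \<nu> {x} = 0} = 0"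
    using \<nu>_eq[OF nonatoms_borel[OF \<nu> B]] by (auto simp: at indicator_def)
  moreover have "(\<Sum>\<^sub>\<infinity>x\<in>B. ennreal (K (measure \<nu> {x}))) = (\<Sum>\<^sub>\<infinity>x\<in>{\<theta>} \<inter> B. ennreal (K r))"
    using \<open>K 0 = 0\<close> by (intro infsum_cong_neutral) (auto simp: at)
  ultimately show ?thesis
    unfolding jump_energy_def by (cases "\<theta> \<in> B") (auto simp: finite_borel_emeasure[OF \<nu>])
qed

text \<open>A point that is no atom of the sum is no atom of either summand, which settles the
  diffuse part; at the atoms \<open>K\<close> is subadditive.\<close>

lemma jump_energy_sum:
  assumes M: "finite_borel_measure M" and N: "finite_borel_measure N" and S: "finite_borel_measure S"
    and S_eq: "\<And>E. measure S E = measure M E + measure N E"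
    and B: "B \<in> sets borel" and "K2 K" and K: "\<And>r. 0 \<le> r \<Longrightarrow> 0 \<le> K r"
  shows "jump_energy K S B \<le> jump_energy K M B + jump_energy K N B"
proof -
  let ?Z = "{x \<in> B. measure S {x} = 0}"
  have sub: "?Z \<subseteq> {x \<in> B. measure M {x} = 0}" "?Z \<subseteq> {x \<in> B. measure N {x} = 0}"
  proof -
    have "measure M {x} = 0 \<and> measure N {x} = 0" if "measure S {x} = 0" for x
      using that S_eq[of "{x}"] measure_nonneg[of M "{x}"] measure_nonneg[of N "{x}"] by linarith
    then show "?Z \<subseteq> {x \<in> B. measure M {x} = 0}" "?Z \<subseteq> {x \<in> B. measure N {x} = 0}" by auto
  qed
  have "emeasure S ?Z = emeasure M ?Z + emeasure N ?Z"
    by (simp add: finite_borel_emeasure M N S S_eq)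
  also have "\<dots> \<le> emeasure M {x \<in> B. measure M {x} = 0} + emeasure N {x \<in> B. measure N {x} = 0}"
    using nonatoms_borel[OF M B] nonatoms_borel[OF N B]
    by (intro add_mono emeasure_mono sub) (auto simp: finite_borelD(1)[OF M] finite_borelD(1)[OF N])
  finally have 1: "emeasure S ?Z
      \<le> emeasure M {x \<in> B. measure M {x} = 0} + emeasure N {x \<in> B. measure N {x} = 0}" .
  have "(\<Sum>\<^sub>\<infinity>x\<in>B. ennreal (K (measure S {x})))
      \<le> (\<Sum>\<^sub>\<infinity>x\<in>B. ennreal (K (measure M {x})) + ennreal (K (measure N {x})))"
  proof (rule infsum_mono)
    fix x
    have "ennreal (K (measure S {x})) \<le> ennreal (K (measure M {x}) + K (measure N {x}))"
      unfolding S_eq by (intro ennreal_leI K_subadditive \<open>K2 K\<close>) auto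
    also have "\<dots> = ennreal (K (measure M {x})) + ennreal (K (measure N {x}))"
      by (intro ennreal_plus K) auto
    finally show "ennreal (K (measure S {x})) \<le> ennreal (K (measure M {x})) + ennreal (K (measure N {x}))" .
  qed (auto intro: nonneg_summable_on_complete)
  also have "\<dots> = (\<Sum>\<^sub>\<infinity>x\<in>B. ennreal (K (measure M {x}))) + (\<Sum>\<^sub>\<infinity>x\<in>B. ennreal (K (measure N {x})))"
    by (rule infsum_add) (auto intro: nonneg_summable_on_complete)
  finally have 2: "(\<Sum>\<^sub>\<infinity>x\<in>B. ennreal (K (measure S {x})))
      \<le> (\<Sum>\<^sub>\<infinity>x\<in>B. ennreal (K (measure M {x}))) + (\<Sum>\<^sub>\<infinity>x\<in>B. ennreal (K (measure N {x})))" .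
  show ?thesis
    using add_mono[OF 1 2] unfolding jump_energy_def by (simp add: ac_simps)
qed

text \<open>An enumeration exhausts \<open>A\<close>, and continuity from above of a finite measure
  makes the remainders small.\<close>

lemma finite_atoms_approx:
  assumes \<mu>: "finite_borel_measure \<mu>" and A: "countable A" and "\<epsilon> > 0"
  obtains F where "finite F" "F \<subseteq> A" "measure \<mu> (A - F) < \<epsilon>"
proof (cases "A = {}")
  case True
  then show ?thesis using that[of "{}"] \<open>\<epsilon> > 0\<close> by simp
next
  case False
  interpret finite_borel_measure \<mu> by fact
  have borel: "B \<in> sets borel" if "B \<subseteq> A" for B
    using countable_subset[OF that A] by (rule sets.countable[rotated]) simp
  define F where "F n = from_nat_into A ` {..n}" for n
  have "(\<lambda>n. measure \<mu> (A - F n)) \<longlonglongrightarrow> measure \<mu> (\<Inter>n. A - F n)"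
  proof (rule finite_Lim_measure_decseq)
    show "range (\<lambda>n. A - F n) \<subseteq> sets \<mu>" using borel M_is_borel by auto
    show "decseq (\<lambda>n. A - F n)" by (force simp: decseq_def F_def)
  qed
  moreover have "(\<Inter>n. A - F n) = {}"
  proof -
    have "x \<in> F (to_nat_on A x)" if "x \<in> A" for x
      using that A by (auto simp: F_def image_iff intro!: bexI[of _ "to_nat_on A x"])
    then show ?thesis by auto
  qed
  ultimately have "(\<lambda>n. measure \<mu> (A - F n)) \<longlonglongrightarrow> 0"
    by (simp only: measure_empty)
  then have "\<forall>\<^sub>F n in sequentially. measure \<mu> (A - F n) < \<epsilon>"
    using \<open>\<epsilon> > 0\<close> by (rule order_tendstoD(2))
  then obtain n where "measure \<mu> (A - F n) < \<epsilon>"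
    using eventually_happens'[of sequentially] by auto
  then show thesis
    using that[of "F n"] from_nat_into[OF False] by (auto simp: F_def)
qed

lemma K_sum_le:
  assumes "K1 K" "K2 K" "finite F" "\<And>x. x \<in> F \<Longrightarrow> 0 \<le> r x"
  shows "K (\<Sum>x\<in>F. r x) \<le> (\<Sum>x\<in>F. K (r x))"
  using assms(3,4)
proof (induction F)
  case empty
  then show ?case using assms(1) by (simp add: K1_def)
next
  case (insert x F)
  have "K (r x + (\<Sum>x\<in>F. r x)) \<le> K (r x) + K (\<Sum>x\<in>F. r x)"
    using insert.prems by (intro K_subadditive[OF assms(2)] sum_nonneg) auto
  then show ?case using insert by auto
qed

text \<open>A finite set \<open>F\<close> of atoms carries almost all of the atomic part of \<open>\<mu>\<close>; what remains
  is estimated by \<open>K r \<le> r\<close>.\<close>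

lemma K_measure_le_jump_energy:
  assumes K: "K1 K" "K2 K" "K3 K" "\<And>r. 0 \<le> r \<Longrightarrow> 0 \<le> K r"
    and \<mu>: "finite_borel_measure \<mu>" and E: "E \<in> sets borel"
  shows "ennreal (K (measure \<mu> E)) \<le> jump_energy K \<mu> E"
proof (rule ennreal_le_epsilon)
  fix \<epsilon> :: real assume "\<epsilon> > 0"
  define Z where "Z = {x \<in> E. measure \<mu> {x} = 0}"
  define A where "A = {x \<in> E. measure \<mu> {x} \<noteq> 0}"
  have "countable A"
    using countable_atoms[OF \<mu>] by (rule countable_subset[rotated]) (auto simp: A_def)
  then obtain F where F: "finite F" "F \<subseteq> A" "measure \<mu> (A - F) < \<epsilon>"
    using finite_atoms_approx[OF \<mu> _ \<open>\<epsilon> > 0\<close>] by blast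
  have Z: "Z \<in> sets borel" unfolding Z_def by (rule nonatoms_borel[OF \<mu> E])
  have "A - F \<in> sets borel"
    using countable_Diff[OF \<open>countable A\<close>, of F] by (rule sets.countable[rotated]) simp
  moreover have "F \<in> sets borel"
    using countable_finite[OF F(1)] by (rule sets.countable[rotated]) simp
  ultimately have AF: "A - F \<in> sets borel" "F \<in> sets borel" .
  have "E = (Z \<union> (A - F)) \<union> F" using F(2) by (auto simp: Z_def A_def)
  then have "measure \<mu> E = measure \<mu> (Z \<union> (A - F)) + measure \<mu> F"
    using finite_borel_Un[OF \<mu>, of "Z \<union> (A - F)" F] Z AF F(2) by (auto simp: Z_def A_def)
  also have "measure \<mu> (Z \<union> (A - F)) = measure \<mu> Z + measure \<mu> (A - F)"
    using Z AF by (intro finite_borel_Un[OF \<mu>]) (auto simp: Z_def A_def)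
  also have "measure \<mu> F = (\<Sum>x\<in>F. measure \<mu> {x})"
    using F(1) finite_borelD[OF \<mu>]
    by (intro finite_measure.finite_measure_eq_sum_singleton) auto
  finally have "K (measure \<mu> E) = K ((measure \<mu> Z + measure \<mu> (A - F)) + (\<Sum>x\<in>F. measure \<mu> {x}))" by simp
  also have "\<dots> \<le> K (measure \<mu> Z + measure \<mu> (A - F)) + K (\<Sum>x\<in>F. measure \<mu> {x})"
    by (intro K_subadditive[OF K(2)] add_nonneg_nonneg sum_nonneg) auto
  also have "\<dots> \<le> (measure \<mu> Z + measure \<mu> (A - F)) + (\<Sum>x\<in>F. K (measure \<mu> {x}))"
    using F(1) by (intro add_mono K_le_id[OF K(1-3)] K_sum_le[OF K(1,2)]) auto
  finally have "K (measure \<mu> E) \<le> measure \<mu> Z + (\<Sum>x\<in>F. K (measure \<mu> {x})) + \<epsilon>"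
    using F(3) by simp
  then have "ennreal (K (measure \<mu> E)) \<le> ennreal (measure \<mu> Z + (\<Sum>x\<in>F. K (measure \<mu> {x})) + \<epsilon>)"
    by (rule ennreal_leI)
  also have "\<dots> = emeasure \<mu> Z + (\<Sum>x\<in>F. ennreal (K (measure \<mu> {x}))) + ennreal \<epsilon>"
    using \<open>\<epsilon> > 0\<close> by (simp add: K sum_nonneg sum_ennreal finite_borel_emeasure[OF \<mu>])
  also have "(\<Sum>x\<in>F. ennreal (K (measure \<mu> {x}))) = (\<Sum>\<^sub>\<infinity>x\<in>F. ennreal (K (measure \<mu> {x})))"
    using F(1) by simp
  also have "\<dots> \<le> (\<Sum>\<^sub>\<infinity>x\<in>E. ennreal (K (measure \<mu> {x})))"
    using F(2) by (intro infsum_mono_neutral) (auto simp: A_def intro: nonneg_summable_on_complete)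
  finally show "ennreal (K (measure \<mu> E)) \<le> jump_energy K \<mu> E + ennreal \<epsilon>"
    by (simp add: jump_energy_def Z_def add_mono)
qed

section \<open>Minimizers\<close>

locale segmentation_minimizer =
  fixes a b lam :: real and K g U :: "real \<Rightarrow> real"
  assumes ab: "a < b" and lam: "lam > 0"
    and K_nonneg: "\<And>r. 0 \<le> r \<Longrightarrow> 0 \<le> K r"
    and K1: "K1 K" and K2: "K2 K" and K3: "K3 K"
    and g: "g \<in> Linfty a b"
    and minimizer: "is_minimizer_on (TV_Kg K lam g a b) (BV a b) U"
begin

abbreviation fidelity :: "(real \<Rightarrow> real) \<Rightarrow> ennreal" where
  "fidelity v \<equiv> \<integral>\<^sup>+x. ennreal (\<bar>v x - g x\<bar>\<^sup>2) \<partial>lebesgue_on {a<..<b}"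

lemma K_mono: "mono_on {0..} K" and K_0: "K 0 = 0"
  using K1 by (auto simp: K1_def)

lemma g_measurable: "g \<in> borel_measurable (lebesgue_on {a<..<b})"
  using g by (simp add: Linfty_def)

lemma competitor:
  assumes "finite_borel_measure \<nu>"
    and "\<And>x y. a < x \<Longrightarrow> x \<le> y \<Longrightarrow> y < b \<Longrightarrow> \<bar>w y - w x\<bar> \<le> measure \<nu> {x<..y}"
  shows "TV_K K a b U + ennreal (lam / 2) * fidelity U
    \<le> jump_energy K \<nu> {a<..<b} + ennreal (lam / 2) * fidelity w"
proof -
  have "w \<in> BV a b" "TV_K K a b w \<le> jump_energy K \<nu> {a<..<b}"
    using dominated_BV[OF ab assms K_mono K_nonneg] by auto
  moreover have "TV_Kg K lam g a b U \<le> TV_Kg K lam g a b w"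
    using minimizer \<open>w \<in> BV a b\<close> by (simp add: is_minimizer_on_def)
  ultimately show ?thesis
    unfolding TV_Kg_def by (meson add_right_mono order_trans)
qed

text \<open>Energies are extended reals, where common summands cancel only if finite. Comparison
  with the zero function, dominated by the zero measure, gives this because \<open>g\<close> is
  bounded.\<close>

lemma finite_energy: "TV_K K a b U < \<infinity>" "fidelity U < \<infinity>"
proof -
  obtain \<nu> where \<nu>: "finite_borel_measure \<nu>" "\<And>E. E \<in> sets borel \<Longrightarrow> measure \<nu> E = 0 * indicator E (0::real)"
    using finite_borel_dirac[of 0 0] by auto
  have "jump_energy K \<nu> {a<..<b} \<le> ennreal (K 0)"
    by (rule jump_energy_dirac[OF \<nu>]) (auto simp: K_0)
  then have "jump_energy K \<nu> {a<..<b} = 0" by (simp add: K_0)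
  then have *: "TV_K K a b U + ennreal (lam / 2) * fidelity U \<le> ennreal (lam / 2) * fidelity (\<lambda>_. 0)"
    using competitor[OF \<nu>(1), of "\<lambda>_. 0"] by simp
  obtain B where B: "AE x in lebesgue_on {a<..<b}. \<bar>g x\<bar> \<le> B"
    using g by (auto simp: Linfty_def)
  have "fidelity (\<lambda>_. 0) \<le> (\<integral>\<^sup>+x. ennreal (B\<^sup>2) \<partial>lebesgue_on {a<..<b})"
  proof (rule nn_integral_mono_AE)
    show "AE x in lebesgue_on {a<..<b}. ennreal (\<bar>0 - g x\<bar>\<^sup>2) \<le> ennreal (B\<^sup>2)"
      using B by eventually_elim (intro ennreal_leI power_mono, auto)
  qed
  also have "\<dots> < \<infinity>"
    using ab by (simp add: emeasure_restrict_space ennreal_mult_less_top)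
  finally have "ennreal (lam / 2) * fidelity (\<lambda>_. 0) < \<infinity>"
    by (simp add: ennreal_mult_less_top)
  with * have "TV_K K a b U + ennreal (lam / 2) * fidelity U < \<infinity>" by (rule order_le_less_trans)
  then show "TV_K K a b U < \<infinity>" "fidelity U < \<infinity>"
    using lam by (auto simp: ennreal_mult_less_top)
qed

end

section \<open>Truncations of a minimizer: bounds and monotonicity\<close>

locale minimizer_representative = segmentation_minimizer +
  fixes V :: "real \<Rightarrow> real" and \<mu> :: "real measure"
  assumes \<mu>: "finite_borel_measure \<mu>"
    and V_eq: "ae_eq a b V U"
    and V_dom: "\<And>x y. a < x \<Longrightarrow> x \<le> y \<Longrightarrow> y < b \<Longrightarrow> \<bar>V y - V x\<bar> \<le> measure \<mu> {x<..y}"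
    and energy: "jump_energy K \<mu> {a<..<b} \<le> TV_K K a b U"
begin

lemma fidelity_V: "fidelity V = fidelity U"
  using V_eq unfolding ae_eq_def by (intro nn_integral_cong_AE) (auto elim!: eventually_mono)

lemma V_gt_near:
  assumes "a < x" "x < b" "c < V x"
  obtains t where "x < t" "t \<le> b" "\<And>y. x \<le> y \<Longrightarrow> y < t \<Longrightarrow> c < V y"
proof -
  have "\<forall>\<^sub>F y in at_right x. c < V y"
    using dominated_at_right[OF \<mu> assms(1,2) V_dom] assms(3) by (rule order_tendstoD(1))
  then obtain t where "x < t" "\<And>y. x < y \<Longrightarrow> y < t \<Longrightarrow> c < V y"
    by (auto simp: eventually_at_right_field)
  then show thesis
    using that[of "min t b"] assms by (metis min.cobounded2 min_less_iff_conj order_le_less)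
qed

lemma V_lt_near:
  assumes "a < x" "x < b" "V x < c"
  obtains t where "x < t" "t \<le> b" "\<And>y. x \<le> y \<Longrightarrow> y < t \<Longrightarrow> V y < c"
proof -
  have "\<forall>\<^sub>F y in at_right x. V y < c"
    using dominated_at_right[OF \<mu> assms(1,2) V_dom] assms(3) by (rule order_tendstoD(2))
  then obtain t where "x < t" "\<And>y. x < y \<Longrightarrow> y < t \<Longrightarrow> V y < c"
    by (auto simp: eventually_at_right_field)
  then show thesis
    using that[of "min t b"] assms by (metis min.cobounded2 min_less_iff_conj order_le_less)
qed

text \<open>Domination by the same \<open>\<mu>\<close> keeps the energy of \<open>w\<close> at or
  below that of \<open>U\<close>, so minimality forbids a smaller fidelity. The conclusion
  \<open>t \<le> s\<close> says that an interval of strict improvement is empty.\<close>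

lemma no_improvement:
  assumes dom: "\<And>x y. a < x \<Longrightarrow> x \<le> y \<Longrightarrow> y < b \<Longrightarrow> \<bar>w y - w x\<bar> \<le> measure \<mu> {x<..y}"
    and le: "AE x in lebesgue_on {a<..<b}. \<bar>w x - g x\<bar> \<le> \<bar>V x - g x\<bar>"
    and less: "AE x in lebesgue_on {a<..<b}. x \<in> {s<..<t} \<longrightarrow> \<bar>w x - g x\<bar> < \<bar>V x - g x\<bar>"
    and st: "a \<le> s" "t \<le> b"
  shows "t \<le> s"
proof (rule ccontr)
  assume "\<not> t \<le> s"
  let ?M = "lebesgue_on {a<..<b}"
  have "TV_K K a b U + ennreal (lam / 2) * fidelity U \<le> TV_K K a b U + ennreal (lam / 2) * fidelity w"
    using competitor[OF \<mu> dom] energy by (meson add_right_mono order_trans)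
  then have "ennreal (lam / 2) * fidelity U \<le> ennreal (lam / 2) * fidelity w"
    using finite_energy(1) by (subst (asm) ennreal_add_left_cancel_le) auto
  then have Uw: "fidelity U \<le> fidelity w"
    using lam by (subst (asm) ennreal_mult_le_mult_iff) auto
  have "w \<in> BV a b" "V \<in> BV a b"
    using dominated_BV[OF ab \<mu> dom K_mono K_nonneg] dominated_BV[OF ab \<mu> V_dom K_mono K_nonneg] by auto
  then have [measurable]: "w \<in> borel_measurable ?M" "V \<in> borel_measurable ?M"
    by (auto simp: BV_def)
  note [measurable] = g_measurable
  have sq: "AE x in ?M. ennreal (\<bar>w x - g x\<bar>\<^sup>2) \<le> ennreal (\<bar>V x - g x\<bar>\<^sup>2)"
    using le by eventually_elim (intro ennreal_leI power_mono, auto)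
  have "fidelity w \<le> fidelity V" by (rule nn_integral_mono_AE[OF sq])
  moreover have "fidelity w < fidelity V"
  proof (rule nn_integral_less[OF _ _ _ sq])
    show "fidelity w \<noteq> \<infinity>"
      using \<open>fidelity w \<le> fidelity V\<close> finite_energy(2) fidelity_V by auto
    show "\<not> (AE x in ?M. ennreal (\<bar>V x - g x\<bar>\<^sup>2) \<le> ennreal (\<bar>w x - g x\<bar>\<^sup>2))"
    proof
      assume "AE x in ?M. ennreal (\<bar>V x - g x\<bar>\<^sup>2) \<le> ennreal (\<bar>w x - g x\<bar>\<^sup>2)"
      with less have "AE x in ?M. x \<notin> {s<..<t}"
      proof eventually_elim
        fix x
        assume 1: "x \<in> {s<..<t} \<longrightarrow> \<bar>w x - g x\<bar> < \<bar>V x - g x\<bar>"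
          and 2: "ennreal (\<bar>V x - g x\<bar>\<^sup>2) \<le> ennreal (\<bar>w x - g x\<bar>\<^sup>2)"
        have "\<bar>V x - g x\<bar>\<^sup>2 \<le> \<bar>w x - g x\<bar>\<^sup>2" using 2 by (subst (asm) ennreal_le_iff) auto
        then have "\<bar>V x - g x\<bar> \<le> \<bar>w x - g x\<bar>" by (rule power2_le_imp_le) simp
        with 1 show "x \<notin> {s<..<t}" by linarith
      qed
      from AE_notin_interval[OF this st] \<open>\<not> t \<le> s\<close> show False by simp
    qed
  qed measurable
  ultimately show False using Uw fidelity_V by (simp add: not_less)
qed

lemma V_le:
  assumes "AE x in lebesgue_on {a<..<b}. g x \<le> G" "a < x" "x < b"
  shows "V x \<le> G"
proof (rule ccontr)
  assume "\<not> V x \<le> G"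
  then obtain t where t: "x < t" "t \<le> b" "\<And>y. x \<le> y \<Longrightarrow> y < t \<Longrightarrow> G < V y"
    using V_gt_near[of x G] assms by auto
  \<comment> \<open>Truncation does not enlarge increments, and where \<open>V\<close> exceeds
    \<open>G\<close> it moves the value towards \<open>g\<close>, which lies below
    \<open>G\<close>.\<close>
  have "t \<le> x"
  proof (rule no_improvement[where w="\<lambda>x. min (V x) G"])
    show "\<bar>min (V y) G - min (V x) G\<bar> \<le> measure \<mu> {x<..y}" if "a < x" "x \<le> y" "y < b" for x y
      using V_dom[OF that] by linarith
    show "AE x in lebesgue_on {a<..<b}. \<bar>min (V x) G - g x\<bar> \<le> \<bar>V x - g x\<bar>"
      using assms(1) by eventually_elim linarith
    show "AE y in lebesgue_on {a<..<b}. y \<in> {x<..<t} \<longrightarrow> \<bar>min (V y) G - g y\<bar> < \<bar>V y - g y\<bar>"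
      using assms(1)
    proof eventually_elim
      fix y assume "g y \<le> G"
      then show "y \<in> {x<..<t} \<longrightarrow> \<bar>min (V y) G - g y\<bar> < \<bar>V y - g y\<bar>"
        using t(3)[of y] by auto
    qed
  qed (use t assms in auto)
  with t show False by simp
qed

lemma V_ge:
  assumes "AE x in lebesgue_on {a<..<b}. G \<le> g x" "a < x" "x < b"
  shows "G \<le> V x"
proof (rule ccontr)
  assume "\<not> G \<le> V x"
  then obtain t where t: "x < t" "t \<le> b" "\<And>y. x \<le> y \<Longrightarrow> y < t \<Longrightarrow> V y < G"
    using V_lt_near[of x G] assms by auto
  have "t \<le> x"
  proof (rule no_improvement[where w="\<lambda>x. max (V x) G"])
    show "\<bar>max (V y) G - max (V x) G\<bar> \<le> measure \<mu> {x<..y}" if "a < x" "x \<le> y" "y < b" for x y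
      using V_dom[OF that] by linarith
    show "AE x in lebesgue_on {a<..<b}. \<bar>max (V x) G - g x\<bar> \<le> \<bar>V x - g x\<bar>"
      using assms(1) by eventually_elim linarith
    show "AE y in lebesgue_on {a<..<b}. y \<in> {x<..<t} \<longrightarrow> \<bar>max (V y) G - g y\<bar> < \<bar>V y - g y\<bar>"
      using assms(1)
    proof eventually_elim
      fix y assume "G \<le> g y"
      then show "y \<in> {x<..<t} \<longrightarrow> \<bar>max (V y) G - g y\<bar> < \<bar>V y - g y\<bar>"
        using t(3)[of y] by auto
    qed
  qed (use t assms in auto)
  with t show False by simp
qed

text \<open>If \<open>V p > c > V q\<close> with \<open>p < q\<close>, let \<open>z\<close> be the first point after \<open>p\<close> at which \<open>V \<le> c\<close>.
  Cutting \<open>V\<close> down to \<open>c\<close> on the left of \<open>z\<close>, or raising it to \<open>c\<close> on the right of \<open>z\<close>, creates no new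
  variation, and for monotone data one of the two strictly improves the fidelity.\<close>

lemma V_mono:
  assumes "nondecreasing_ae a b g"
  shows "mono_on {a<..<b} V"
proof (rule mono_onI, rule ccontr)
  fix p q assume p: "p \<in> {a<..<b}" and q: "q \<in> {a<..<b}" and "p \<le> q" and "\<not> V p \<le> V q"
  obtain h where h: "ae_eq a b h g" "mono_on {a<..<b} h"
    using assms by (auto simp: nondecreasing_ae_def)
  define c where "c = (V p + V q) / 2"
  have c: "V q < c" "c < V p" using \<open>\<not> V p \<le> V q\<close> by (auto simp: c_def)
  define Z where "Z = {x \<in> {p..q}. V x \<le> c}"
  define z where "z = Inf Z"
  have "q \<in> Z" using c \<open>p \<le> q\<close> by (simp add: Z_def)
  have bdd: "bdd_below Z" by (rule bdd_belowI[of _ p]) (auto simp: Z_def)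
  have z: "p \<le> z" "z \<le> q"
    unfolding z_def using \<open>q \<in> Z\<close> bdd by (auto intro!: cInf_greatest cInf_lower simp: Z_def)
  have left: "c < V x" if "p \<le> x" "x < z" for x
    using that cInf_lower[OF _ bdd, of x] z unfolding z_def by (force simp: Z_def)
  \<comment> \<open>Otherwise right-continuity would keep \<open>V\<close> above \<open>c\<close>
    beyond \<open>z\<close>, against the choice of \<open>z\<close> as an infimum.\<close>
  have "V z \<le> c"
  proof (rule ccontr)
    assume "\<not> V z \<le> c"
    then obtain t where t: "z < t" "\<And>y. z \<le> y \<Longrightarrow> y < t \<Longrightarrow> c < V y"
      using V_gt_near[of z c] z p q by auto
    obtain x where "x \<in> Z" "x < t"
      using cInf_lessD[of Z t] \<open>q \<in> Z\<close> t(1) unfolding z_def by auto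
    moreover have "z \<le> x" unfolding z_def using \<open>x \<in> Z\<close> bdd by (rule cInf_lower)
    ultimately show False using t(2)[of x] by (auto simp: Z_def)
  qed
  then have "p < z" using z c by (cases "p = z") auto
  \<comment> \<open>If the first alternative fails, \<open>h\<close> exceeds \<open>c\<close>
    somewhere to the left of \<open>z\<close>, and monotonicity carries this to all points from
    \<open>z\<close> on.\<close>
  consider "\<And>x. a < x \<Longrightarrow> x < z \<Longrightarrow> h x \<le> c" | "\<And>x. z \<le> x \<Longrightarrow> x < b \<Longrightarrow> c \<le> h x"
    using mono_onD[OF h(2)] z p q by (smt (verit) greaterThanLessThan_iff)
  then show False
  proof cases
    case 1
    define w where "w x = (if x < z then min (V x) c else V x)" for x
    have "z \<le> p"
    proof (rule no_improvement[where w=w])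
      fix x y assume xy: "a < x" "x \<le> y" "y < b"
      show "\<bar>w y - w x\<bar> \<le> measure \<mu> {x<..y}"
      \<comment> \<open>The delicate increments cross \<open>z\<close> and start above
        \<open>c\<close>, where \<open>w x = c\<close>. A rise of \<open>w\<close> above
        \<open>c\<close> is at most the rise of \<open>V\<close> from \<open>V z \<le> c\<close>; a
        fall of \<open>w\<close> is shorter than that of \<open>V\<close>.\<close>
      proof (cases "x < z \<and> z \<le> y \<and> c < V x")
        case True
        have "\<bar>V y - V z\<bar> \<le> measure \<mu> {z<..y}" "\<bar>V z - V x\<bar> \<le> measure \<mu> {x<..z}"
          using V_dom[of z y] V_dom[of x z] xy True by auto
        then show ?thesis
          using finite_borel_Ioc[OF \<mu>, of x z y] True \<open>V z \<le> c\<close> unfolding w_def by (smt (verit))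
      next
        case False
        then show ?thesis using V_dom[OF xy] xy(2) unfolding w_def by (smt (verit))
      qed
    next
      show "AE x in lebesgue_on {a<..<b}. \<bar>w x - g x\<bar> \<le> \<bar>V x - g x\<bar>"
        using h(1)[unfolded ae_eq_def] AE_space
      proof eventually_elim
        fix x assume "h x = g x" "x \<in> space (lebesgue_on {a<..<b})"
        then show "\<bar>w x - g x\<bar> \<le> \<bar>V x - g x\<bar>" using 1[of x] by (auto simp: w_def)
      qed
      show "AE x in lebesgue_on {a<..<b}. x \<in> {p<..<z} \<longrightarrow> \<bar>w x - g x\<bar> < \<bar>V x - g x\<bar>"
        using h(1)[unfolded ae_eq_def] AE_space
      proof eventually_elim
        fix x assume "h x = g x" "x \<in> space (lebesgue_on {a<..<b})"
        then show "x \<in> {p<..<z} \<longrightarrow> \<bar>w x - g x\<bar> < \<bar>V x - g x\<bar>" using 1[of x] left[of x] by (auto simp: w_def)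
      qed
    qed (use p q z in auto)
    with \<open>p < z\<close> show False by simp
  next
    case 2
    define w where "w x = (if x < z then V x else max (V x) c)" for x
    obtain t where t: "q < t" "t \<le> b" "\<And>y. q \<le> y \<Longrightarrow> y < t \<Longrightarrow> V y < c"
      using V_lt_near[of q c] q c by auto
    have "t \<le> q"
    proof (rule no_improvement[where w=w])
      fix x y assume xy: "a < x" "x \<le> y" "y < b"
      show "\<bar>w y - w x\<bar> \<le> measure \<mu> {x<..y}"
      \<comment> \<open>Here \<open>w\<close> climbs from \<open>V x\<close> to \<open>c\<close>. As
        \<open>V\<close> exceeds \<open>c\<close> on \<open>[p,z)\<close>, the point
        \<open>x\<close> lies before \<open>p\<close>, and the climb of \<open>V\<close> from
        \<open>V x\<close> to \<open>V p\<close> pays for that of \<open>w\<close>.\<close>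
      proof (cases "x < z \<and> z \<le> y \<and> V x < c \<and> V y < c")
        case True
        then have "x < p" using left[of x] by (cases "p \<le> x") auto
        then have "\<bar>V p - V x\<bar> \<le> measure \<mu> {x<..p}"
          using V_dom[of x p] xy p by auto
        also have "\<dots> \<le> measure \<mu> {x<..y}"
          using True z by (intro finite_borel_mono[OF \<mu>]) auto
        finally show ?thesis
          using True c by (simp add: w_def)
      next
        case False
        then show ?thesis using V_dom[OF xy] xy(2) unfolding w_def by (smt (verit))
      qed
    next
      show "AE x in lebesgue_on {a<..<b}. \<bar>w x - g x\<bar> \<le> \<bar>V x - g x\<bar>"
        using h(1)[unfolded ae_eq_def] AE_space
      proof eventually_elim
        fix x assume "h x = g x" "x \<in> space (lebesgue_on {a<..<b})"
        then show "\<bar>w x - g x\<bar> \<le> \<bar>V x - g x\<bar>" using 2[of x] by (auto simp: w_def)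
      qed
      show "AE x in lebesgue_on {a<..<b}. x \<in> {q<..<t} \<longrightarrow> \<bar>w x - g x\<bar> < \<bar>V x - g x\<bar>"
        using h(1)[unfolded ae_eq_def] AE_space
      proof eventually_elim
        fix x assume "h x = g x" "x \<in> space (lebesgue_on {a<..<b})"
        then show "x \<in> {q<..<t} \<longrightarrow> \<bar>w x - g x\<bar> < \<bar>V x - g x\<bar>" using 2[of x] t(3)[of x] z by (auto simp: w_def)
      qed
    qed (use p q t in auto)
    with t(1) show False by simp
  qed
qed

end

section \<open>Monotone minimizers\<close>

lemma AE_lebesgue_on_neq: "AE y in lebesgue_on {a<..<b}. y \<noteq> (\<theta>::real)"
proof -
  have "AE y in lebesgue. y \<noteq> \<theta>"
    by (rule AE_completion[OF AE_lborel_singleton])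
  then show ?thesis
    by (subst AE_restrict_space_iff) (auto elim: eventually_mono)
qed

text \<open>For a non-decreasing minimizer the derivative is a positive measure
  \<open>\<nu>\<close>, and increments of \<open>V\<close> are masses of intervals. The bound
  \<open>osc\<close> keeps them in the range \<open>M\<close> for which (K2) holds with
  \<open>C\<close>.\<close>

locale monotone_minimizer = segmentation_minimizer +
  fixes c C M :: real and \<nu> :: "real measure"
  assumes \<nu>: "finite_borel_measure \<nu>"
    and V_eq: "ae_eq a b (\<lambda>x. c + measure \<nu> {a<..x}) U"
    and energy: "jump_energy K \<nu> {a<..<b} \<le> TV_K K a b U"
    and g_mono: "nondecreasing_ae a b g"
    and osc: "\<And>s t. a < s \<Longrightarrow> s \<le> t \<Longrightarrow> t < b \<Longrightarrow> measure \<nu> {s<..t} \<le> M"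
    and K2_const: "K2_const K M C"
begin

abbreviation V :: "real \<Rightarrow> real" where
  "V x \<equiv> c + measure \<nu> {a<..x}"

lemma V_diff: "a \<le> x \<Longrightarrow> x \<le> y \<Longrightarrow> V y - V x = measure \<nu> {x<..y}"
  using finite_borel_Ioc[OF \<nu>, of a x y] by simp

lemma crossing_point:
  assumes "a < s" "s < t" "t < b"
  obtains \<theta> where "s \<le> \<theta>" "\<theta> \<le> t"
    "AE y in lebesgue_on {a<..<b}. s < y \<and> y < \<theta> \<longrightarrow> g y \<le> m"
    "AE y in lebesgue_on {a<..<b}. \<theta> \<le> y \<and> y < t \<longrightarrow> m \<le> g y"
proof -
  obtain h where h: "AE y in lebesgue_on {a<..<b}. h y = g y" "mono_on {a<..<b} h"
    using g_mono by (auto simp: nondecreasing_ae_def ae_eq_def)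
  \<comment> \<open>Including \<open>s\<close> keeps \<open>Z\<close> non-empty when
    \<open>h\<close> exceeds \<open>m\<close> throughout; the crossing point is then
    \<open>s\<close>.\<close>
  define Z where "Z = {y \<in> {s..t}. y = s \<or> h y \<le> m}"
  define \<theta> where "\<theta> = Sup Z"
  have "s \<in> Z" using assms by (simp add: Z_def)
  have bdd: "bdd_above Z" by (rule bdd_aboveI[of _ t]) (auto simp: Z_def)
  have 1: "h y \<le> m" if y: "s < y" "y < \<theta>" for y
  proof -
    obtain z where z: "z \<in> Z" "y < z"
      using less_cSupD[of Z y] \<open>s \<in> Z\<close> y(2) unfolding \<theta>_def by auto
    then have "h y \<le> h z" using y assms by (intro mono_onD[OF h(2)]) (auto simp: Z_def)
    then show ?thesis using z y(1) by (auto simp: Z_def)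
  qed
  have 2: "m \<le> h y" if y: "\<theta> < y" "y < t" for y
  proof -
    have "y \<notin> Z" using cSup_upper[OF _ bdd, of y] y(1) unfolding \<theta>_def by auto
    moreover have "s \<le> \<theta>" unfolding \<theta>_def using \<open>s \<in> Z\<close> bdd by (rule cSup_upper)
    ultimately show ?thesis using y by (auto simp: Z_def)
  qed
  \<comment> \<open>At \<open>\<theta>\<close> itself \<open>h\<close> may lie on either side of
    \<open>m\<close>; one point is negligible.\<close>
  have ne: "AE y in lebesgue_on {a<..<b}. y \<noteq> \<theta>"
    by (rule AE_lebesgue_on_neq)
  show thesis
  proof
    show "s \<le> \<theta>" unfolding \<theta>_def using \<open>s \<in> Z\<close> bdd by (rule cSup_upper)
    show "\<theta> \<le> t" unfolding \<theta>_def using \<open>s \<in> Z\<close> by (intro cSup_least) (auto simp: Z_def)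
    show "AE y in lebesgue_on {a<..<b}. s < y \<and> y < \<theta> \<longrightarrow> g y \<le> m"
      using h(1) by eventually_elim (metis 1)
    show "AE y in lebesgue_on {a<..<b}. \<theta> \<le> y \<and> y < t \<longrightarrow> m \<le> g y"
      using h(1) ne by eventually_elim (metis 2 order_le_less)
  qed
qed

text \<open>On \<open>(s,t]\<close> the whole increase of \<open>V\<close> is concentrated in a single jump at the point \<open>\<theta>\<close> where
  \<open>g\<close> crosses the mean value of \<open>V s\<close> and \<open>V t\<close>. There \<open>w\<close> is the better of the two constants, so
  \<open>(w - g)\<^sup>2 \<le> (V - g)\<^sup>2 + (V - V s) (V t - V)\<close> because \<open>V\<close> is a convex combination of \<open>V s\<close> and \<open>V t\<close>.
  The jump energy drops by at least \<open>C (V x - V s) (V t - V x)\<close> for every splitting point \<open>x\<close>.\<close>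

lemma concentration_bound:
  assumes st: "a < s" "s < t" "t < b" and x: "s \<le> x" "x \<le> t"
    and Q: "\<And>y. s \<le> y \<Longrightarrow> y \<le> t \<Longrightarrow> measure \<nu> {s<..y} * measure \<nu> {y<..t} \<le> Q"
  shows "C * (measure \<nu> {s<..x} * measure \<nu> {x<..t}) \<le> lam / 2 * ((t - s) * Q)"
proof -
  let ?M = "lebesgue_on {a<..<b}"
  let ?I = "{s<..t}"
  define r where "r = measure \<nu> ?I"
  have r: "r = measure \<nu> {s<..y} + measure \<nu> {y<..t}" if "s \<le> y" "y \<le> t" for y
    unfolding r_def using finite_borel_Ioc[OF \<nu>] that .
  have "0 \<le> r" by (simp add: r_def)
  have "0 \<le> Q" using Q[of s] st by simp
  define m where "m = V s + r / 2"
  obtain \<theta> where \<theta>: "s \<le> \<theta>" "\<theta> \<le> t"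
    "AE y in ?M. s < y \<and> y < \<theta> \<longrightarrow> g y \<le> m" "AE y in ?M. \<theta> \<le> y \<and> y < t \<longrightarrow> m \<le> g y"
    using crossing_point[OF st] by blast
  \<comment> \<open>The new measure leaves \<open>\<nu>\<close> untouched outside
    \<open>(s,t]\<close> and puts the mass \<open>r\<close> of that interval at
    \<open>\<theta>\<close>. The total is preserved, so \<open>w\<close> agrees with
    \<open>V\<close> again from \<open>t\<close> on.\<close>
  obtain R where R: "finite_borel_measure R" "\<And>E. E \<in> sets borel \<Longrightarrow> measure R E = measure \<nu> (E \<inter> - ?I)"
    using finite_borel_restrict[OF \<nu>, of "- ?I"] by auto
  obtain D where D: "finite_borel_measure D" "\<And>E. E \<in> sets borel \<Longrightarrow> measure D E = r * indicator E \<theta>"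
    using finite_borel_dirac[OF \<open>0 \<le> r\<close>] by blast
  obtain S where S: "finite_borel_measure S" "\<And>E. measure S E = measure R E + measure D E"
    using finite_borel_sum[OF R(1) D(1)] by blast
  define w where "w y = c + measure S {a<..y}" for y
  have S_Ioc: "measure S {a<..y} = measure \<nu> ({a<..y} \<inter> - ?I) + r * indicator {a<..y} \<theta>" for y
    by (simp add: S(2) R(2) D(2))
  have w_outside: "w y = V y" if y: "a < y" "y \<notin> {s..<t}" for y
  proof (cases "y < s")
    case True
    then have "{a<..y} \<inter> - ?I = {a<..y}" by auto
    then show ?thesis using True \<theta> by (simp add: w_def S_Ioc)
  next
    case False
    then have "t \<le> y" using y by auto
    then have "{a<..y} \<inter> - ?I = {a<..s} \<union> {t<..y}" using st by auto
    then have "measure \<nu> ({a<..y} \<inter> - ?I) = measure \<nu> {a<..s} + measure \<nu> {t<..y}"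
      using finite_borel_Un[OF \<nu>, of "{a<..s}" "{t<..y}"] st by auto
    then show ?thesis
      using \<theta> st \<open>t \<le> y\<close> finite_borel_Ioc[OF \<nu>, of a s t] finite_borel_Ioc[OF \<nu>, of a t y]
      by (simp add: w_def S_Ioc r_def)
  qed
  have w_inside: "w y = (if \<theta> \<le> y then V s + r else V s)" if y: "s \<le> y" "y < t" for y
  proof -
    have "{a<..y} \<inter> - ?I = {a<..s}" using y st by auto
    then show ?thesis using \<theta> st by (auto simp: w_def S_Ioc)
  qed
  \<comment> \<open>The point \<open>s\<close> is set aside: if \<open>\<theta> = s\<close>, then
    \<open>w\<close> has already jumped there, whereas the error term lives on the open
    interval.\<close>
  have AE_le: "AE y in ?M. ennreal (\<bar>w y - g y\<bar>\<^sup>2) \<le> ennreal (\<bar>V y - g y\<bar>\<^sup>2) + ennreal Q * indicator {s<..<t} y"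
    using \<theta>(3,4) AE_space AE_lebesgue_on_neq[where a=a and b=b and \<theta>=s]
  proof eventually_elim
    fix y assume g: "s < y \<and> y < \<theta> \<longrightarrow> g y \<le> m" "\<theta> \<le> y \<and> y < t \<longrightarrow> m \<le> g y"
      and "y \<in> space ?M" "y \<noteq> s"
    then have y: "a < y" "y < b" by auto
    show "ennreal (\<bar>w y - g y\<bar>\<^sup>2) \<le> ennreal (\<bar>V y - g y\<bar>\<^sup>2) + ennreal Q * indicator {s<..<t} y"
    proof (cases "y \<in> {s<..<t}")
      case False
      then have "w y = V y" using y \<open>y \<noteq> s\<close> by (intro w_outside) auto
      then show ?thesis using False by simp
    next
      case True
      define p q where "p = measure \<nu> {s<..y}" and "q = measure \<nu> {y<..t}"
      have pq: "0 \<le> p" "0 \<le> q" "r = p + q" "p * q \<le> Q" "V y = V s + p"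
        using r[of y] Q[of y] True V_diff[of s y] st by (auto simp: p_def q_def)
      have "(w y - g y)\<^sup>2 \<le> (V y - g y)\<^sup>2 + p * q"
      proof (cases "\<theta> \<le> y")
        case True
        have "2 * m \<le> 2 * g y" using g True \<open>y \<in> {s<..<t}\<close> by simp
        \<comment> \<open>Raising the value by \<open>q\<close> changes the square by
          \<open>q * (q + 2 * (V y - g y))\<close>. Subtracting this from \<open>p * q\<close>
          leaves exactly the present product, non-negative since \<open>g y \<ge> m\<close>. The
          other case mirrors this with \<open>p\<close>.\<close>
        then have "0 \<le> q * (2 * g y - (2 * V s + (p + q)))"
          using pq(2) unfolding m_def pq(3) by (intro mult_nonneg_nonneg) (auto simp: field_simps)
        moreover have "w y = V s + p + q" using w_inside[of y] True \<open>y \<in> {s<..<t}\<close> pq by simp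
        ultimately show ?thesis
          unfolding pq(5) by (simp add: power2_eq_square algebra_simps)
      next
        case False
        have "2 * g y \<le> 2 * m" using g False \<open>y \<in> {s<..<t}\<close> by simp
        then have "0 \<le> p * ((2 * V s + (p + q)) - 2 * g y)"
          using pq(1) unfolding m_def pq(3) by (intro mult_nonneg_nonneg) (auto simp: field_simps)
        moreover have "w y = V s" using w_inside[of y] False \<open>y \<in> {s<..<t}\<close> by simp
        ultimately show ?thesis
          unfolding pq(5) by (simp add: power2_eq_square algebra_simps)
      qed
      then have "ennreal (\<bar>w y - g y\<bar>\<^sup>2) \<le> ennreal (\<bar>V y - g y\<bar>\<^sup>2 + Q)"
        using pq(4) by (intro ennreal_leI) simp
      then show ?thesis using True \<open>0 \<le> Q\<close> by simp
    qed
  qed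
  have [measurable]: "V \<in> borel_measurable ?M"
    using borel_measurable_Ioc_measure[OF \<nu>]
    by (intro measurable_restrict_space1 measurable_completion) simp
  note [measurable] = g_measurable
  have [measurable]: "{s<..<t} \<in> sets ?M"
    using st by (subst sets_restrict_space_iff) auto
  have fid: "fidelity w \<le> fidelity U + ennreal ((t - s) * Q)"
  proof -
    have "fidelity w \<le> (\<integral>\<^sup>+y. ennreal (\<bar>V y - g y\<bar>\<^sup>2) + ennreal Q * indicator {s<..<t} y \<partial>?M)"
      by (rule nn_integral_mono_AE[OF AE_le])
    also have "\<dots> = fidelity V + ennreal Q * emeasure ?M {s<..<t}"
      by (subst nn_integral_add) (auto simp: nn_integral_cmult_indicator)
    also have "emeasure ?M {s<..<t} = ennreal (t - s)"
      using st by (subst emeasure_restrict_space) auto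
    also have "fidelity V = fidelity U"
      using V_eq unfolding ae_eq_def by (intro nn_integral_cong_AE) (auto elim!: eventually_mono)
    finally show ?thesis
      using \<open>0 \<le> Q\<close> st by (simp add: ennreal_mult[symmetric] mult.commute)
  qed
  let ?O = "{a<..<b} \<inter> - ?I"
  have "jump_energy K S {a<..<b} \<le> jump_energy K R {a<..<b} + jump_energy K D {a<..<b}"
    by (rule jump_energy_sum[OF R(1) D(1) S(1) S(2) _ K2 K_nonneg]) auto
  also have "\<dots> \<le> jump_energy K \<nu> ?O + ennreal (K r)"
    using jump_energy_restrict[OF \<nu> R(1) R(2), of "{a<..<b}" K] jump_energy_dirac[OF D, of "{a<..<b}" K] K_0
    by (intro add_mono) auto
  finally have S_le: "jump_energy K S {a<..<b} \<le> jump_energy K \<nu> ?O + ennreal (K r)" .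
  define p q where "p = measure \<nu> {s<..x}" and "q = measure \<nu> {x<..t}"
  have pq: "0 \<le> p" "0 \<le> q" "r = p + q" using r[OF x] by (auto simp: p_def q_def)
  \<comment> \<open>However the mass of \<open>(s,t]\<close> is spread over atoms and diffuse part,
    the two pieces cut at \<open>x\<close> cost at least \<open>K p\<close> and \<open>K q\<close>.
    The new atom costs at most \<open>K r\<close> with \<open>r = p + q\<close>, which is the
    comparison made in (K2).\<close>
  have \<nu>_ge: "jump_energy K \<nu> ?O + (ennreal (K p) + ennreal (K q)) \<le> TV_K K a b U"
  proof -
    have "{a<..<b} = ?O \<union> ({s<..x} \<union> {x<..t})" using st x by auto
    then have "jump_energy K \<nu> {a<..<b} = jump_energy K \<nu> (?O \<union> ({s<..x} \<union> {x<..t}))" by simp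
    also have "\<dots> = jump_energy K \<nu> ?O + jump_energy K \<nu> ({s<..x} \<union> {x<..t})"
      using st x by (intro jump_energy_Un[OF \<nu>]) auto
    also have "jump_energy K \<nu> ({s<..x} \<union> {x<..t}) = jump_energy K \<nu> {s<..x} + jump_energy K \<nu> {x<..t}"
      by (intro jump_energy_Un[OF \<nu>]) auto
    finally have "jump_energy K \<nu> ?O + (jump_energy K \<nu> {s<..x} + jump_energy K \<nu> {x<..t}) \<le> TV_K K a b U"
      using energy by simp
    moreover have "ennreal (K p) \<le> jump_energy K \<nu> {s<..x}" "ennreal (K q) \<le> jump_energy K \<nu> {x<..t}"
      unfolding p_def q_def by (intro K_measure_le_jump_energy[OF K1 K2 K3 K_nonneg \<nu>]; simp)+
    ultimately show ?thesis by (meson add_left_mono add_mono order_trans)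
  qed
  have "TV_K K a b U + ennreal (lam / 2) * fidelity U
      \<le> jump_energy K S {a<..<b} + ennreal (lam / 2) * fidelity w"
  proof (rule competitor[OF S(1)])
    fix y z assume "a < y" "y \<le> z" "z < b"
    then show "\<bar>w z - w y\<bar> \<le> measure S {y<..z}"
      using finite_borel_Ioc[OF S(1), of a y z] by (simp add: w_def)
  qed
  also have "\<dots> \<le> (jump_energy K \<nu> ?O + ennreal (K r))
      + ennreal (lam / 2) * (fidelity U + ennreal ((t - s) * Q))"
    using S_le fid by (intro add_mono mult_left_mono) auto
  finally have main: "jump_energy K \<nu> ?O + (ennreal (K p) + ennreal (K q)) + ennreal (lam / 2) * fidelity U
      \<le> (jump_energy K \<nu> ?O + ennreal (K r)) + ennreal (lam / 2) * (fidelity U + ennreal ((t - s) * Q))"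
    using \<nu>_ge by (meson add_right_mono order_trans)
  \<comment> \<open>Finiteness moves the inequality to the reals, where the energy outside
    \<open>(s,t]\<close> and the old fidelity cancel.\<close>
  obtain F where F: "fidelity U = ennreal F" "0 \<le> F"
    using finite_energy(2) by (cases "fidelity U") auto
  have "jump_energy K \<nu> ?O \<le> TV_K K a b U"
    using \<nu>_ge by (rule order_trans[rotated]) simp
  then have "jump_energy K \<nu> ?O < \<infinity>"
    using finite_energy(1) by (rule order_le_less_trans)
  then obtain E where E: "jump_energy K \<nu> ?O = ennreal E" "0 \<le> E"
    by (cases "jump_energy K \<nu> ?O") auto
  have "ennreal (E + (K p + K q) + lam / 2 * F) \<le> ennreal (E + K r + lam / 2 * (F + (t - s) * Q))"
    using main lam st F E \<open>0 \<le> Q\<close> K_nonneg pq \<open>0 \<le> r\<close>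
    by (simp add: ennreal_mult'[symmetric] ennreal_plus[symmetric] del: ennreal_plus)
  then have "E + (K p + K q) + lam / 2 * F \<le> E + K r + lam / 2 * (F + (t - s) * Q)"
    using lam st F E \<open>0 \<le> Q\<close> K_nonneg[OF \<open>0 \<le> r\<close>]
    by (subst (asm) ennreal_le_iff) (auto intro!: add_nonneg_nonneg mult_nonneg_nonneg)
  moreover have "K r + C * p * q \<le> K p + K q"
    using K2_const pq osc[of s t] st unfolding K2_const_def r_def[symmetric] by auto
  ultimately have "C * p * q \<le> lam / 2 * ((t - s) * Q)"
    unfolding distrib_left[of "lam / 2"] by linarith
  then show ?thesis by (simp add: p_def q_def mult.assoc)
qed

section \<open>Spacing and number of jumps, constancy between them\<close>

lemma C_pos: "C > 0"
  using K2_const by (simp add: K2_const_def)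

text \<open>The supremum \<open>Q\<close> ends up on both sides of the concentration bound, with the
  smaller factor on the right, so it cannot be positive. A product of increments that vanishes has a
  vanishing factor.\<close>

lemma two_values:
  assumes st: "a < s" "t < b" and x: "s \<le> x" "x \<le> t" and short: "lam * (t - s) < 2 * C"
  shows "V x = V s \<or> V x = V t"
proof (cases "s = t")
  case True
  then show ?thesis using x by simp
next
  case False
  then have "s < t" using x by simp
  define f where "f y = measure \<nu> {s<..y} * measure \<nu> {y<..t}" for y
  define Q where "Q = Sup (f ` {s..t})"
  have "bdd_above (f ` {s..t})"
  proof (rule bdd_aboveI)
    fix z assume "z \<in> f ` {s..t}"
    then show "z \<le> measure \<nu> UNIV * measure \<nu> UNIV"
      unfolding f_def by (auto intro!: mult_mono finite_borel_mono[OF \<nu>])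
  qed
  then have Q: "f y \<le> Q" if "s \<le> y" "y \<le> t" for y
    unfolding Q_def using that by (intro cSup_upper) auto
  have "Q \<le> lam / 2 * ((t - s) * Q) / C"
    unfolding Q_def
  proof (rule cSup_least)
    fix z assume "z \<in> f ` {s..t}"
    then obtain y where y: "s \<le> y" "y \<le> t" "z = f y" by auto
    have "C * f y \<le> lam / 2 * ((t - s) * Q)"
      unfolding f_def by (rule concentration_bound) (use st \<open>s < t\<close> y Q in \<open>auto simp: f_def\<close>)
    then show "z \<le> lam / 2 * ((t - s) * Sup (f ` {s..t})) / C"
      using C_pos y(3) by (simp add: Q_def field_simps)
  qed (use \<open>s < t\<close> in auto)
  then have "(2 * C - lam * (t - s)) * Q \<le> 0"
    using C_pos by (simp add: field_simps)
  then have "Q \<le> 0" using short by (simp add: mult_le_0_iff)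
  then have "f x \<le> 0" using Q[OF x] by simp
  then have "measure \<nu> {s<..x} = 0 \<or> measure \<nu> {x<..t} = 0"
    unfolding f_def by (metis measure_nonneg mult_eq_0_iff mult_nonneg_nonneg order_antisym)
  then show ?thesis using V_diff[of s x] V_diff[of x t] st x by auto
qed

definition jumps :: "real set" where
  "jumps = {x \<in> {a<..<b}. measure \<nu> {x} \<noteq> 0}"

lemma V_less_jump:
  assumes "x \<in> jumps" "a \<le> y" "y < x"
  shows "V y < V x"
proof -
  have "measure \<nu> {x} \<le> measure \<nu> {y<..x}"
    using assms by (intro finite_borel_mono[OF \<nu>]) auto
  moreover have "0 < measure \<nu> {x}" using assms(1) by (simp add: jumps_def zero_less_measure_iff)
  ultimately show ?thesis using V_diff[of y x] assms by linarith
qed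

text \<open>Two closer jumps would produce three distinct values, at a point slightly before
  \<open>x\<close>, at \<open>x\<close> and at \<open>y\<close>, within a length that allows only
  two.\<close>

lemma jumps_separated:
  assumes xy: "x \<in> jumps" "y \<in> jumps" "x < y"
  shows "2 * C \<le> lam * (y - x)"
proof (rule ccontr)
  assume "\<not> 2 * C \<le> lam * (y - x)"
  then have "lam * (y - x) < 2 * C" by simp
  then have "y - 2 * C / lam < x" using lam by (simp add: field_simps)
  moreover have "a < x" using xy by (simp add: jumps_def)
  ultimately obtain s where s: "max a (y - 2 * C / lam) < s" "s < x"
    using dense[of "max a (y - 2 * C / lam)" x] by auto
  have "V x = V s \<or> V x = V y"
  proof (rule two_values)
    show "lam * (y - s) < 2 * C" using s lam by (simp add: field_simps)
  qed (use s xy in \<open>auto simp: jumps_def\<close>)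
  moreover have "V s < V x" "V x < V y"
    using V_less_jump[OF xy(1), of s] V_less_jump[OF xy(2), of x] s xy by (auto simp: jumps_def)
  ultimately show False by auto
qed

lemma jumps_finite: "finite jumps"
  and card_jumps: "int (card jumps) \<le> \<lfloor>(b - a) * lam / (2 * C)\<rfloor> + 1"
proof -
  \<comment> \<open>The index of the half-open cell of length \<open>2 * C / lam\<close>, counted
    from \<open>a\<close>, that contains \<open>x\<close>. Cells hold at most one jump each, and
    indices start at 0, whence the additional 1 in the count.\<close>
  define f where "f x = \<lfloor>(x - a) * lam / (2 * C)\<rfloor>" for x
  have inj: "inj_on f jumps"
  proof (rule inj_onI, rule ccontr)
    fix x y assume xy: "x \<in> jumps" "y \<in> jumps" "f x = f y" "x \<noteq> y"
    have False if "x \<in> jumps" "y \<in> jumps" "x < y" "f x = f y" for x y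
    proof -
      have "1 \<le> (y - a) * lam / (2 * C) - (x - a) * lam / (2 * C)"
      proof -
        have "(y - a) * lam / (2 * C) - (x - a) * lam / (2 * C) = lam * (y - x) / (2 * C)"
          using C_pos by (simp add: field_simps)
        then show ?thesis using jumps_separated[OF that(1-3)] C_pos by (simp add: field_simps)
      qed
      then show False using that(4) unfolding f_def by linarith
    qed
    then show False using xy by (metis linorder_neq_iff)
  qed
  have range: "f ` jumps \<subseteq> {0..\<lfloor>(b - a) * lam / (2 * C)\<rfloor>}"
  proof
    fix k assume "k \<in> f ` jumps"
    then obtain x where x: "a < x" "x < b" "k = f x" by (auto simp: jumps_def)
    then show "k \<in> {0..\<lfloor>(b - a) * lam / (2 * C)\<rfloor>}"
      using lam C_pos by (auto simp: f_def intro!: floor_mono divide_right_mono mult_right_mono)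
  qed
  then show "finite jumps"
    using inj by (meson finite_atLeastAtMost_int finite_imageD finite_subset)
  have "card jumps = card (f ` jumps)" using inj by (simp add: card_image)
  also have "\<dots> \<le> card {0..\<lfloor>(b - a) * lam / (2 * C)\<rfloor>}"
    using range by (intro card_mono) auto
  finally have "int (card jumps) \<le> int (card {0..\<lfloor>(b - a) * lam / (2 * C)\<rfloor>})"
    by (rule of_nat_mono)
  also have "\<dots> = \<lfloor>(b - a) * lam / (2 * C)\<rfloor> + 1"
  proof -
    have "0 \<le> \<lfloor>(b - a) * lam / (2 * C)\<rfloor>" using ab lam C_pos by simp
    then show ?thesis by simp
  qed
  finally show "int (card jumps) \<le> \<lfloor>(b - a) * lam / (2 * C)\<rfloor> + 1" .
qed

lemma V_mono_le: "a \<le> x \<Longrightarrow> x \<le> y \<Longrightarrow> V x \<le> V y"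
  using V_diff[of x y] measure_nonneg[of \<nu> "{x<..y}"] by linarith

text \<open>Without an atom at \<open>x\<close>, \<open>V\<close> is continuous there. If it differs
  from \<open>V x\<close> at the far end of a short interval, then points close to \<open>x\<close>
  cannot take that far value, and two values being available they take \<open>V x\<close>.
  Monotonicity fills in between the points found on both sides.\<close>

lemma V_locally_constant:
  assumes x: "x \<in> {a<..<b} - jumps"
  shows "\<exists>l<x. \<exists>r>x. \<forall>y. l < y \<and> y < r \<longrightarrow> V y = V x"
proof -
  have ax: "a < x" "x < b" and "measure \<nu> {x} = 0" using x by (auto simp: jumps_def)
  \<comment> \<open>Half the critical length, which makes the inequality asked for by
    \<open>two_values\<close> strict.\<close>
  define d where "d = C / lam"
  have d: "d > 0" "lam * d < 2 * C" using C_pos lam by (auto simp: d_def)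
  have right: "(V \<longlongrightarrow> V x) (at_right x)"
    using Ioc_measure_at_right[OF \<nu>, of a x] ax by (intro tendsto_intros) auto
  have left: "(V \<longlongrightarrow> V x) (at_left x)"
    using Ioc_measure_at_left[OF \<nu> ax(1)] \<open>measure \<nu> {x} = 0\<close> by (intro tendsto_intros) simp
  have "\<exists>r>x. r < b \<and> V r = V x"
  proof -
    define t where "t = min (x + d) ((x + b) / 2)"
    have t: "x < t" "t < b" "lam * (t - x) < 2 * C"
    proof -
      show "x < t" "t < b" using d ax by (auto simp: t_def min_def)
      have "lam * (t - x) \<le> lam * d" using lam by (intro mult_left_mono) (auto simp: t_def)
      then show "lam * (t - x) < 2 * C" using d by simp
    qed
    show ?thesis
    proof (cases "V t = V x")
      case True
      then show ?thesis using t by blast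
    next
      case False
      then have "V x < V t" using V_mono_le[of x t] ax t by auto
      then have "\<forall>\<^sub>F y in at_right x. V y < V t" using right by (rule order_tendstoD(2)[rotated])
      then obtain u where u: "x < u" "\<And>y. x < y \<Longrightarrow> y < u \<Longrightarrow> V y < V t"
        by (auto simp: eventually_at_right_field)
      define y where "y = (x + min u t) / 2"
      have y: "x < y" "y < u" "y < t" using u t by (auto simp: y_def min_def)
      then have "V y = V x"
        using two_values[of x t y] u(2)[of y] t ax by auto
      then show ?thesis using y t by (intro exI[of _ y]) auto
    qed
  qed
  then obtain r where r: "x < r" "r < b" "V r = V x" by blast
  have "\<exists>l<x. a < l \<and> V l = V x"
  proof -
    define t where "t = max (x - d) ((x + a) / 2)"
    have t: "t < x" "a < t" "lam * (x - t) < 2 * C"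
    proof -
      show "t < x" "a < t" using d ax by (auto simp: t_def max_def)
      have "lam * (x - t) \<le> lam * d" using lam by (intro mult_left_mono) (auto simp: t_def)
      then show "lam * (x - t) < 2 * C" using d by simp
    qed
    show ?thesis
    proof (cases "V t = V x")
      case True
      then show ?thesis using t by blast
    next
      case False
      then have "V t < V x" using V_mono_le[of t x] ax t by auto
      then have "\<forall>\<^sub>F y in at_left x. V t < V y" using left by (rule order_tendstoD(1)[rotated])
      then obtain u where u: "u < x" "\<And>y. u < y \<Longrightarrow> y < x \<Longrightarrow> V t < V y"
        by (auto simp: eventually_at_left_field)
      define y where "y = (x + max u t) / 2"
      have y: "y < x" "u < y" "t < y" using u t by (auto simp: y_def max_def)
      then have "V y = V x"
        using two_values[of t x y] u(2)[of y] t ax by auto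
      then show ?thesis using y t by (intro exI[of _ y]) auto
    qed
  qed
  then obtain l where l: "l < x" "a < l" "V l = V x" by blast
  have "V y = V x" if "l < y" "y < r" for y
    using V_mono_le[of l y] V_mono_le[of y r] that l r by auto
  then show ?thesis using l(1) r(1) by blast
qed

lemma piecewise_constant_V: "piecewise_constant a b V"
  unfolding piecewise_constant_def
proof (intro exI[of _ jumps] conjI ballI jumps_finite)
  fix I assume I: "I \<in> components ({a<..<b} - jumps)"
  show "V constant_on I"
  proof (rule locally_constant_imp_constant)
    show "connected I" using I by (rule in_components_connected)
    fix x assume "x \<in> I"
    then have "x \<in> {a<..<b} - jumps" using I in_components_subset by blast
    from V_locally_constant[OF this]
    obtain l r where lr: "l < x" "x < r" "\<forall>y. l < y \<and> y < r \<longrightarrow> V y = V x"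
      by (elim exE conjE)
    show "\<exists>T. openin (top_of_set I) T \<and> x \<in> T \<and> (\<forall>y\<in>T. V y = V x)"
    proof (intro exI conjI ballI)
      show "openin (top_of_set I) (I \<inter> {l<..<r})" by (rule openin_open_Int) simp
      show "x \<in> I \<inter> {l<..<r}" using lr(1,2) \<open>x \<in> I\<close> by simp
      show "V y = V x" if "y \<in> I \<inter> {l<..<r}" for y using lr(3) that by simp
    qed
  qed
qed

end

section \<open>Essential bounds and the theorem for non-decreasing data\<close>

lemma esssup_real:
  fixes f :: "real \<Rightarrow> real"
  assumes "a < b" and f: "f \<in> borel_measurable (lebesgue_on {a<..<b})"
    and B: "AE x in lebesgue_on {a<..<b}. f x \<le> B"
  obtains r where "esssup (lebesgue_on {a<..<b}) (\<lambda>x. ereal (f x)) = ereal r"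
    "AE x in lebesgue_on {a<..<b}. f x \<le> r"
proof -
  let ?M = "lebesgue_on {a<..<b}"
  let ?s = "esssup ?M (\<lambda>x. ereal (f x))"
  have "(\<lambda>x. ereal (f x)) \<in> borel_measurable ?M"
    using f by simp
  then have "?s \<le> ereal B"
    using B by (intro esssup_I) auto
  moreover have "?s \<noteq> - \<infinity>"
  proof
    assume "?s = - \<infinity>"
    then have "AE x in ?M. ereal (f x) \<le> - \<infinity>"
      using esssup_AE[of "\<lambda>x. ereal (f x)" ?M] by simp
    then have "AE x in ?M. x \<notin> {a<..<b}" by eventually_elim simp
    from AE_notin_interval[OF this] show False using \<open>a < b\<close> by simp
  qed
  ultimately obtain r where r: "?s = ereal r" by (cases ?s) auto
  then have "AE x in ?M. f x \<le> r"
    using esssup_AE[of "\<lambda>x. ereal (f x)" ?M] by simp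
  with r that show thesis by blast
qed

lemma ess_bounds:
  assumes "a < b" "g \<in> Linfty a b"
  obtains Gi Gs where "ess_inf a b g = ereal Gi" "ess_sup a b g = ereal Gs"
    "AE x in lebesgue_on {a<..<b}. Gi \<le> g x" "AE x in lebesgue_on {a<..<b}. g x \<le> Gs"
proof -
  let ?M = "lebesgue_on {a<..<b}"
  obtain B where B: "AE x in ?M. \<bar>g x\<bar> \<le> B" and g: "g \<in> borel_measurable ?M"
    using assms(2) by (auto simp: Linfty_def)
  have le: "AE x in ?M. g x \<le> B" "AE x in ?M. - g x \<le> B"
    using B by (auto elim!: eventually_mono)
  obtain Gs where Gs: "esssup ?M (\<lambda>x. ereal (g x)) = ereal Gs" "AE x in ?M. g x \<le> Gs"
    using esssup_real[OF assms(1) g le(1)] by blast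
  obtain Gi where Gi: "esssup ?M (\<lambda>x. ereal (- g x)) = ereal Gi" "AE x in ?M. - g x \<le> Gi"
    using esssup_real[OF assms(1) borel_measurable_uminus[OF g] le(2)] by blast
  have "AE x in ?M. - Gi \<le> g x"
    using Gi(2) by eventually_elim simp
  with Gs Gi(1) show thesis
    using that[of "- Gi" Gs] by (simp add: ess_inf_def ess_sup_def)
qed

context segmentation_minimizer
begin

lemma nondecreasing_minimizer:
  assumes g_mono: "nondecreasing_ae a b g"
    and M: "ess_sup a b g - ess_inf a b g \<le> ereal M" and C: "K2_const K M C"
  shows "\<exists>V. ae_eq a b V U \<and> mono_on {a<..<b} V \<and> piecewise_constant a b V \<and>
      (\<forall>x\<in>{a<..<b}. ess_inf a b g \<le> ereal (V x) \<and> ereal (V x) \<le> ess_sup a b g)"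
    and "finite (jump_set a b U)"
    and "int (card (jump_set a b U)) \<le> \<lfloor>(b - a) * lam / (2 * C)\<rfloor> + 1"
proof -
  have U: "U \<in> BV a b" using minimizer by (simp add: is_minimizer_on_def)
  then have Uint: "integrable (lebesgue_on {a<..<b}) U" by (simp add: BV_def)
  obtain c0 P N \<mu> where P: "finite_borel_measure P" and N: "finite_borel_measure N"
    and \<mu>: "finite_borel_measure \<mu>" and eq: "ae_eq a b (primitive a c0 P N) U"
    and \<mu>_dom: "\<And>E. \<bar>measure P E - measure N E\<bar> \<le> measure \<mu> E"
    and "\<And>K. K 0 = 0 \<Longrightarrow> jump_energy K \<mu> {a<..<b} \<le> TV_K K a b U"
    using BV_primitive[OF ab U] by metis
  then have \<mu>_energy: "jump_energy K \<mu> {a<..<b} \<le> TV_K K a b U"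
    using K_0 by blast
  \<comment> \<open>At this stage the derivative may still have both signs; its variation
    \<open>\<mu>\<close> dominates the increments, which is enough for bounds and
    monotonicity.\<close>
  define V where "V = primitive a c0 P N"
  interpret R: minimizer_representative a b lam K g U V \<mu>
  proof (rule minimizer_representative.intro[OF segmentation_minimizer_axioms],
      rule minimizer_representative_axioms.intro)
    show "\<bar>V y - V x\<bar> \<le> measure \<mu> {x<..y}" if "a < x" "x \<le> y" "y < b" for x y
      using \<mu>_dom[of "{x<..y}"] finite_borel_Ioc[OF P, of a x y] finite_borel_Ioc[OF N, of a x y] that
      by (simp add: V_def primitive_def)
    show "ae_eq a b V U" using eq by (simp add: V_def)
  qed (fact \<mu> \<mu>_energy)+
  obtain Gi Gs where G: "ess_inf a b g = ereal Gi" "ess_sup a b g = ereal Gs"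
    "AE x in lebesgue_on {a<..<b}. Gi \<le> g x" "AE x in lebesgue_on {a<..<b}. g x \<le> Gs"
    using ess_bounds[OF ab g] by metis
  have bounds: "Gi \<le> V x" "V x \<le> Gs" if "x \<in> {a<..<b}" for x
    using R.V_ge[OF G(3)] R.V_le[OF G(4)] that by auto
  \<comment> \<open>Being monotone, bounded and right-continuous, \<open>V\<close> is the primitive
    of a positive measure. The zero measure \<open>Z\<close> below stands for the negative part, so
    that the results on signed derivatives apply to \<open>\<nu>\<close>.\<close>
  obtain c \<nu> where \<nu>: "finite_borel_measure \<nu>" and V_\<nu>: "\<And>x. x \<in> {a<..<b} \<Longrightarrow> V x = c + measure \<nu> {a<..x}"
  proof (rule Stieltjes_measure[OF ab R.V_mono[OF g_mono]])
    show "(V \<longlongrightarrow> V x) (at_right x)" if "x \<in> {a<..<b}" for x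
      unfolding V_def using that by (intro primitive_at_right P N) auto
    show "\<bar>V x\<bar> \<le> max \<bar>Gi\<bar> \<bar>Gs\<bar>" if "x \<in> {a<..<b}" for x
      using bounds[OF that] by linarith
  qed (use that in auto)
  obtain Z where Z: "finite_borel_measure Z" "\<And>E. E \<in> sets borel \<Longrightarrow> measure Z E = 0 * indicator E (0::real)"
    using finite_borel_dirac[of 0 0] by auto
  have Z0: "measure Z E = 0" for E
    using Z by (cases "E \<in> sets borel") (auto simp: measure_notin_sets finite_borelD(1))
  have eq\<nu>: "ae_eq a b (\<lambda>x. c + measure \<nu> {a<..x}) U"
  proof -
    have "ae_eq a b (\<lambda>x. c + measure \<nu> {a<..x}) V"
      unfolding ae_eq_def using V_\<nu> by (intro AE_I2) auto
    then show ?thesis using R.V_eq by (rule ae_eq_trans)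
  qed
  have eqZ: "ae_eq a b U (primitive a c \<nu> Z)"
    using ae_eq_sym[OF eq\<nu>] by (simp add: primitive_def[abs_def] Z0)
  interpret monotone_minimizer a b lam K g U c C M \<nu>
  proof (rule monotone_minimizer.intro[OF segmentation_minimizer_axioms],
      rule monotone_minimizer_axioms.intro)
    show "jump_energy K \<nu> {a<..<b} \<le> TV_K K a b U"
    proof (rule jump_energy_le_TV_K[OF ab \<nu> Z(1) Uint eqZ \<nu>])
      fix B :: "real set" assume B: "B \<in> sets borel"
      show "ennreal (measure \<nu> B) \<le> total_variation (\<lambda>E. measure \<nu> E - measure Z E) B"
      proof -
        \<comment> \<open>The trivial partition suffices, as a positive measure has no
          cancellation.\<close>
        let ?E = "\<lambda>n::nat. if n = 0 then B else {}"
        have "ennreal (measure \<nu> B) = (\<Sum>n\<in>{0}. ennreal \<bar>measure \<nu> (?E n) - measure Z (?E n)\<bar>)"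
          by (simp add: Z0)
        also have "\<dots> \<le> (\<Sum>n. ennreal \<bar>measure \<nu> (?E n) - measure Z (?E n)\<bar>)"
          by (rule sum_le_suminf) auto
        also have "\<dots> \<le> total_variation (\<lambda>E. measure \<nu> E - measure Z E) B"
          unfolding total_variation_def
          using B by (intro SUP_upper) (auto simp: disjoint_family_on_def)
        finally show ?thesis .
      qed
    qed (auto simp: K_0 Z0)
    show "measure \<nu> {s<..t} \<le> M" if "a < s" "s \<le> t" "t < b" for s t
    proof -
      have "measure \<nu> {s<..t} = V t - V s"
        using finite_borel_Ioc[OF \<nu>, of a s t] V_\<nu>[of s] V_\<nu>[of t] that by simp
      also have "\<dots> \<le> Gs - Gi" using bounds[of s] bounds[of t] that by simp
      also have "\<dots> \<le> M" using M by (simp add: G)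
      finally show ?thesis .
    qed
  qed (fact \<nu> eq\<nu> g_mono C)+
  have J: "jump_set a b U = jumps"
    unfolding jumps_def using jump_set_primitive[OF ab \<nu> Z(1) eqZ] by (simp add: Z0)
  show "finite (jump_set a b U)" "int (card (jump_set a b U)) \<le> \<lfloor>(b - a) * lam / (2 * C)\<rfloor> + 1"
    unfolding J by (fact jumps_finite card_jumps)+
  show "\<exists>V. ae_eq a b V U \<and> mono_on {a<..<b} V \<and> piecewise_constant a b V \<and>
      (\<forall>x\<in>{a<..<b}. ess_inf a b g \<le> ereal (V x) \<and> ereal (V x) \<le> ess_sup a b g)"
  proof (intro exI conjI ballI)
    show "ae_eq a b (\<lambda>x. c + measure \<nu> {a<..x}) U" by fact
    show "mono_on {a<..<b} (\<lambda>x. c + measure \<nu> {a<..x})"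
      by (intro mono_onI V_mono_le) auto
    show "piecewise_constant a b (\<lambda>x. c + measure \<nu> {a<..x})" by (rule piecewise_constant_V)
    fix x assume "x \<in> {a<..<b}"
    then show "ess_inf a b g \<le> ereal (c + measure \<nu> {a<..x})" "ereal (c + measure \<nu> {a<..x}) \<le> ess_sup a b g"
      using bounds[of x] V_\<nu>[of x] by (auto simp: G)
  qed
qed

end

section \<open>Non-increasing data by change of sign\<close>

lemma BV_uminus:
  assumes "a < b" "u \<in> BV a b"
  shows "(\<lambda>x. - u x) \<in> BV a b" "TV_K K a b (\<lambda>x. - u x) = TV_K K a b u"
    "jump_set a b (\<lambda>x. - u x) = jump_set a b u"
proof -
  have u: "integrable (lebesgue_on {a<..<b}) u" using assms by (simp add: BV_def)
  then have u': "integrable (lebesgue_on {a<..<b}) (\<lambda>x. - u x)" by simp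
  obtain c P N where P: "finite_borel_measure P" and N: "finite_borel_measure N"
    and "ae_eq a b (primitive a c P N) u"
    using BV_primitive[OF assms] by metis
  then have eq: "ae_eq a b u (primitive a c P N)" by (simp add: ae_eq_sym)
  then have eq': "ae_eq a b (\<lambda>x. - u x) (primitive a (- c) N P)"
    unfolding ae_eq_def by (auto simp: primitive_def elim!: eventually_mono)
  show "(\<lambda>x. - u x) \<in> BV a b"
  proof -
    have "has_distr_deriv a b (\<lambda>x. - u x) (signed_on a b N P)"
      using has_distr_deriv_signed[OF assms(1) N P u', of "- c"] eq' by (simp add: ae_eq_def primitive_def)
    with u' show ?thesis unfolding BV_def by blast
  qed
  show J: "jump_set a b (\<lambda>x. - u x) = jump_set a b u"
    unfolding jump_set_primitive[OF assms(1) P N eq] jump_set_primitive[OF assms(1) N P eq'] by auto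
  show "TV_K K a b (\<lambda>x. - u x) = TV_K K a b u"
    unfolding TV_K_primitive[OF assms(1) P N eq u] TV_K_primitive[OF assms(1) N P eq' u'] J
    by (simp add: total_variation_def abs_minus_commute)
qed

text \<open>Negation maps \<open>BV a b\<close> onto itself, exchanging \<open>P\<close> and
  \<open>N\<close>, and only absolute values enter the energy. With \<open>g\<close> negated as
  well, the functional is preserved.\<close>

lemma segmentation_minimizer_uminus:
  assumes "segmentation_minimizer a b lam K g U"
  shows "segmentation_minimizer a b lam K (\<lambda>x. - g x) (\<lambda>x. - U x)"
proof -
  interpret segmentation_minimizer a b lam K g U by fact
  have TV: "TV_Kg K lam (\<lambda>x. - g x) a b (\<lambda>x. - v x) = TV_Kg K lam g a b v" if "v \<in> BV a b" for v
    unfolding TV_Kg_def using BV_uminus(2)[OF ab that] by (simp add: abs_minus_commute power2_commute)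
  show ?thesis
  proof
    show "(\<lambda>x. - g x) \<in> Linfty a b" using g by (auto simp: Linfty_def)
    have U: "U \<in> BV a b" and min: "\<And>v. v \<in> BV a b \<Longrightarrow> TV_Kg K lam g a b U \<le> TV_Kg K lam g a b v"
      using minimizer by (auto simp: is_minimizer_on_def)
    show "is_minimizer_on (TV_Kg K lam (\<lambda>x. - g x) a b) (BV a b) (\<lambda>x. - U x)"
      unfolding is_minimizer_on_def
    proof (intro conjI ballI)
      show "(\<lambda>x. - U x) \<in> BV a b" using BV_uminus(1)[OF ab U] .
      fix v assume v: "v \<in> BV a b"
      show "TV_Kg K lam (\<lambda>x. - g x) a b (\<lambda>x. - U x) \<le> TV_Kg K lam (\<lambda>x. - g x) a b v"
        using min[OF BV_uminus(1)[OF ab v]] TV[OF U] TV[OF BV_uminus(1)[OF ab v]] by simp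
    qed
  qed (use ab lam K_nonneg K1 K2 K3 in auto)
qed

theorem corollary1p4:
  fixes a b lam M C\<^sub>M :: real and K g U :: "real \<Rightarrow> real"
  assumes "a < b" and "lam > 0"
    and "\<And>r. 0 \<le> r \<Longrightarrow> 0 \<le> K r"
    and "K1 K" and "K2 K" and "K3 K"
    and "g \<in> Linfty a b"
    and "M > 0" and "ess_sup a b g - ess_inf a b g \<le> ereal M"
    and "K2_const K M C\<^sub>M"
    and "is_minimizer_on (TV_Kg K lam g a b) (BV a b) U"
  shows
    "(nondecreasing_ae a b g \<longrightarrow>
       (\<exists>V. ae_eq a b V U \<and> mono_on {a<..<b} V \<and> piecewise_constant a b V \<and>
          (\<forall>x\<in>{a<..<b}. ess_inf a b g \<le> ereal (V x) \<and> ereal (V x) \<le> ess_sup a b g)) \<and>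
       finite (jump_set a b U) \<and>
       int (card (jump_set a b U)) \<le> \<lfloor>(b - a) * lam / (2 * C\<^sub>M)\<rfloor> + 1) \<and>
     (nonincreasing_ae a b g \<longrightarrow>
       (\<exists>V. ae_eq a b V U \<and> antimono_on {a<..<b} V \<and> piecewise_constant a b V \<and>
          (\<forall>x\<in>{a<..<b}. ess_inf a b g \<le> ereal (V x) \<and> ereal (V x) \<le> ess_sup a b g)) \<and>
       finite (jump_set a b U) \<and>
       int (card (jump_set a b U)) \<le> \<lfloor>(b - a) * lam / (2 * C\<^sub>M)\<rfloor> + 1)"
proof -
  have S: "segmentation_minimizer a b lam K g U"
    using assms by unfold_locales auto
  interpret N: segmentation_minimizer a b lam K "\<lambda>x. - g x" "\<lambda>x. - U x"
    using S by (rule segmentation_minimizer_uminus)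
  have "U \<in> BV a b" using assms by (simp add: is_minimizer_on_def)
  note J = BV_uminus(3)[OF assms(1) this]
  \<comment> \<open>The essential bounds trade places under negation, so the oscillation is
    unchanged and the same \<open>M\<close> and \<open>C\<^sub>M\<close> serve.\<close>
  have ess: "ess_sup a b (\<lambda>x. - g x) = - ess_inf a b g" "ess_inf a b (\<lambda>x. - g x) = - ess_sup a b g"
    by (simp_all add: ess_sup_def ess_inf_def)
  obtain Gi Gs where G: "ess_inf a b g = ereal Gi" "ess_sup a b g = ereal Gs"
    using ess_bounds[OF assms(1,7)] by metis
  have M: "ess_sup a b (\<lambda>x. - g x) - ess_inf a b (\<lambda>x. - g x) \<le> ereal M"
    using assms(9) by (simp add: ess G)
  have "(\<exists>V. ae_eq a b V U \<and> antimono_on {a<..<b} V \<and> piecewise_constant a b V \<and>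
          (\<forall>x\<in>{a<..<b}. ess_inf a b g \<le> ereal (V x) \<and> ereal (V x) \<le> ess_sup a b g)) \<and>
       finite (jump_set a b U) \<and>
       int (card (jump_set a b U)) \<le> \<lfloor>(b - a) * lam / (2 * C\<^sub>M)\<rfloor> + 1"
    if noninc: "nonincreasing_ae a b g"
  proof -
    obtain h where h: "ae_eq a b h g" "antimono_on {a<..<b} h"
      using noninc by (auto simp: nonincreasing_ae_def)
    have "nondecreasing_ae a b (\<lambda>x. - g x)"
      unfolding nondecreasing_ae_def
    proof (intro exI conjI)
      show "ae_eq a b (\<lambda>x. - h x) (\<lambda>x. - g x)"
        using h(1) unfolding ae_eq_def by (auto elim!: eventually_mono)
      show "mono_on {a<..<b} (\<lambda>x. - h x)"
        using h(2) by (auto simp: monotone_on_def)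
    qed
    note concl = N.nondecreasing_minimizer[OF this M assms(10)]
    obtain V where V: "ae_eq a b V (\<lambda>x. - U x)" "mono_on {a<..<b} V" "piecewise_constant a b V"
      "\<And>x. x \<in> {a<..<b} \<Longrightarrow> - ess_sup a b g \<le> ereal (V x) \<and> ereal (V x) \<le> - ess_inf a b g"
      using concl(1) unfolding ess by blast
    have "ae_eq a b (\<lambda>x. - V x) U"
      using V(1) unfolding ae_eq_def by (auto elim!: eventually_mono)
    moreover have "antimono_on {a<..<b} (\<lambda>x. - V x)"
      using V(2) by (auto simp: monotone_on_def)
    moreover have "piecewise_constant a b (\<lambda>x. - V x)"
      using V(3) unfolding piecewise_constant_def constant_on_def by (metis (no_types))
    moreover have "ess_inf a b g \<le> ereal (- V x) \<and> ereal (- V x) \<le> ess_sup a b g" if "x \<in> {a<..<b}" for x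
      using V(4)[OF that] by (simp add: G)
    ultimately show ?thesis
      using concl(2,3) unfolding J by blast
  qed
  then show ?thesis
    using segmentation_minimizer.nondecreasing_minimizer[OF S _ assms(9,10)] by blast
qed

end
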